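(* Let $C$ be a diamond category. For each isomorphism class $G$ of objects of $C$, let $M_G$ be a real number so that $(M_G)_G$ is well-behaved. For a level $\mathcal{L}$ and $F\in\mathcal{L}$ set $v_{\mathcal{L},F}:=\sum_{G\in\mathcal{L}}\frac{\hat{\mu}(F,G)}{|\mathrm{Aut}(G)|}M_G$. (Existence) There exists a measure $\nu$ on $\mathcal{P}$ with $G$-moment $M_G$ for all $G\in C$ if and only if for every level $\mathcal{L}$ and every $F\in\mathcal{L}$ we have $v_{\mathcal{L},F}\ge 0$. (Uniqueness) If such a measure $\nu$ exists, then it is unique, and for every level $\mathcal{L}$ and $F\in\mathcal{L}$ we have $\nu(U_{\mathcal{L},F})=v_{\mathcal{L},F}$.
   Context: Category notions. Let $C$ be a small category. A quotient of an object $G$ is a pair $(F,\pi)$ of an object $F$ and an epimorphism $\pi:G\to F$; quotients $(F,\pi),(F',\pi')$ are isomorphic if there is an isomorphism $\rho:F\to F'$ with $\pi'=\rho\pi$. Isomorphism classes of quotients of $G$ form a poset, where $H\ge F$ if there is $h:H\to F$ compatible with the morphisms from $G$; joins $\vee$ and meets $\wedge$ of quotients of $G$ are taken in this poset. A lattice (poset in which any two elements have a join and a meet) is modular if $a\le b$ implies $a\vee(x\wedge b)=(a\vee x)\wedge b$ for all $x$. For $F$ a quotient of $G$, $[F,G]$ is the poset of isomorphism classes of quotients of $G$ that are $\ge F$. An object is minimal if it has only one quotient (itself). A set $\mathcal{S}$ of objects, stable under isomorphism (equivalently a set of isomorphism classes), is downward-closed if every quotient of an object of $\mathcal{S}$ is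 in $\mathcal{S}$; it is join-closed if whenever $H,F\in\mathcal{S}$ are quotients of some object $G$ and $H\vee F$ exists, $H\vee F\in\mathcal{S}$. A formation is a downward-closed join-closed set of isomorphism classes containing every minimal object. A level is a set of isomorphism classes generated by a finite set $B$ of isomorphism classes, i.e. the smallest downward-closed join-closed set containing $B$ and every minimal object. An epimorphism $G\to F$ is simple if it is not an isomorphism and $[F,G]$ contains only $F$ and $G$. A diamond category is a small category $C$ such that: (1) for each object $G$, the set of isomorphism classes of quotients of $G$ is a finite modular lattice; (2) each object has finite automorphism group; (3) for each level $\mathcal{L}$ and each $G\in\mathcal{L}$, there are finitely many elements of $\mathcal{L}$ with a simple epimorphism to $G$; (4) $C$ has at most countably many isomorphism classes of minimal objects. Moment notions. $\mathrm{Epi}(G,F)$ is the set of epimorphisms $G\to F$. Sums over objects are over isomorphism classes; a sum being finite includes the claim that only countably many terms are non-zero. For an epimorphism $\pi:G\to F$, $\mu(\pi)=\mu(F,G)$ is the M\"obius function of the poset of quotients of $G$, evaluated at the quotients $(F,\pi)$ and $G$; $\hat{\mu}(F,G)=\sum_{\pi\in\mathrm{Epi}(G,F)/\mathrm{Aut}(F)}\mu(\pi)$; and $Z(\pi)$ is the number of $H\in[F,G]$ with $H\vee(K_1\wedge K_2)=(H\vee K_1)\wedge(H\vee K_2)$ for all $K_1,K_2\in[F,G]$. A tuple $(M_G)_G$ of reals is well-behaved if for every level $\mathcal{L}$ and all $F\in\mathcal{L}$, $\sum_{G\in\mathcal{L}}\sum_{\pi\in\mathrm{Epi}(G,F)}\frac{|\mu(\pi)|}{|\mathrm{Aut}(G)|}Z(\pi)^3|M_G|<\infty$.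 Pro-isomorphism classes. For a level $\mathcal{L}$, $G^{\mathcal{L}}$ is the maximal quotient of $G$ that is in $\mathcal{L}$ (the join of all quotients of $G$ in $\mathcal{L}$). A pro-isomorphism class $X$ of $C$ is, for each level $\mathcal{L}$, an isomorphism class $X^{\mathcal{L}}\in\mathcal{L}$ such that whenever $\mathcal{L}\subset\mathcal{L}'$ we have $(X^{\mathcal{L}'})^{\mathcal{L}}\cong X^{\mathcal{L}}$. $\mathcal{P}$ is the set of pro-isomorphism classes, $U_{\mathcal{L},F}=\{X\in\mathcal{P}\mid X^{\mathcal{L}}\cong F\}$ for a level $\mathcal{L}$ and $F\in\mathcal{L}$, and measures on $\mathcal{P}$ are for the $\sigma$-algebra generated by all the $U_{\mathcal{L},F}$. For $X\in\mathcal{P}$ and $G\in C$, $|\mathrm{Epi}(X,G)|:=|\mathrm{Epi}(X^{\mathcal{L}},G)|$ for any level $\mathcal{L}$ containing $G$ (independent of $\mathcal{L}$). The $G$-moment of a measure $\nu$ on $\mathcal{P}$ is $\int_{X\in\mathcal{P}}|\mathrm{Epi}(X,G)|\,d\nu$. *)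

theory Defs
  imports "HOL-Algebra.Lattice" "HOL-Analysis.Analysis"
begin

section \<open>Small categories\<close>

record ('o, 'm) cat =
  Ob :: "'o set"
  Arr :: "'m set"
  Dom :: "'m \<Rightarrow> 'o"
  Cod :: "'m \<Rightarrow> 'o"
  ident :: "'o \<Rightarrow> 'm"
  Comp :: "'m \<Rightarrow> 'm \<Rightarrow> 'm"  (infixl \<open>\<bullet>\<index>\<close> 70)

definition Hom :: "('o, 'm) cat \<Rightarrow> 'o \<Rightarrow> 'o \<Rightarrow> 'm set" where
  "Hom C G F = {f \<in> Arr C. Dom C f = G \<and> Cod C f = F}"

locale category =
  fixes C :: "('o, 'm) cat" (structure)
  assumes Dom_closed: "f \<in> Arr C \<Longrightarrow> Dom C f \<in> Ob C"
    and Cod_closed: "f \<in> Arr C \<Longrightarrow> Cod C f \<in> Ob C"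
    and ident_closed: "G \<in> Ob C \<Longrightarrow> ident C G \<in> Hom C G G"
    and Comp_closed: "f \<in> Hom C F G \<Longrightarrow> g \<in> Hom C G H \<Longrightarrow> g \<bullet> f \<in> Hom C F H"
    and Comp_ident: "f \<in> Hom C G F \<Longrightarrow> f \<bullet> ident C G = f"
    and ident_Comp: "f \<in> Hom C G F \<Longrightarrow> ident C F \<bullet> f = f"
    and Comp_assoc: "f \<in> Hom C E F \<Longrightarrow> g \<in> Hom C F G \<Longrightarrow> h \<in> Hom C G H \<Longrightarrow>
      (h \<bullet> g) \<bullet> f = h \<bullet> (g \<bullet> f)"

definition Epi :: "('o, 'm) cat \<Rightarrow> 'o \<Rightarrow> 'o \<Rightarrow> 'm set" where
  "Epi C G F = {\<pi> \<in> Hom C G F. \<forall>H \<in> Ob C. \<forall>g \<in> Hom C F H. \<forall>h \<in> Hom C F H.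
     g \<bullet>\<^bsub>C\<^esub> \<pi> = h \<bullet>\<^bsub>C\<^esub> \<pi> \<longrightarrow> g = h}"

definition Iso :: "('o, 'm) cat \<Rightarrow> 'o \<Rightarrow> 'o \<Rightarrow> 'm set" where
  "Iso C G F = {\<rho> \<in> Hom C G F. \<exists>\<sigma> \<in> Hom C F G.
     \<sigma> \<bullet>\<^bsub>C\<^esub> \<rho> = ident C G \<and> \<rho> \<bullet>\<^bsub>C\<^esub> \<sigma> = ident C F}"

abbreviation Aut :: "('o, 'm) cat \<Rightarrow> 'o \<Rightarrow> 'm set" where
  "Aut C G \<equiv> Iso C G G"

definition iso_rel :: "('o, 'm) cat \<Rightarrow> ('o \<times> 'o) set" where
  "iso_rel C = {(G, F). G \<in> Ob C \<and> F \<in> Ob C \<and> Iso C G F \<noteq> {}}"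

definition iso_classes :: "('o, 'm) cat \<Rightarrow> 'o set set" where
  "iso_classes C = Ob C // iso_rel C"

text \<open>An arbitrary member of an equivalence class. It is only used for quantities that do not
  depend on the choice.\<close>

definition rep :: "'a set \<Rightarrow> 'a" where
  "rep A = (SOME a. a \<in> A)"


section \<open>The poset of quotients\<close>

text \<open>A quotient \<open>(F, \<pi>)\<close> of \<open>G\<close> is encoded by the epimorphism \<open>\<pi>\<close> alone, since
  \<open>F = Cod C \<pi>\<close>.\<close>

definition quotients :: "('o, 'm) cat \<Rightarrow> 'o \<Rightarrow> 'm set" where
  "quotients C G = (\<Union>F \<in> Ob C. Epi C G F)"

definition quot_rel :: "('o, 'm) cat \<Rightarrow> 'o \<Rightarrow> ('m \<times> 'm) set" where
  "quot_rel C G = {(\<pi>, \<pi>'). \<pi> \<in> quotients C G \<and> \<pi>' \<in> quotients C G \<and>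
     (\<exists>\<rho> \<in> Iso C (Cod C \<pi>) (Cod C \<pi>'). \<pi>' = \<rho> \<bullet>\<^bsub>C\<^esub> \<pi>)}"

text \<open>The elements are isomorphism classes, so \<open>G\<close> itself (the class of \<open>ident C G\<close>) is the
  greatest element.\<close>

definition quot_poset :: "('o, 'm) cat \<Rightarrow> 'o \<Rightarrow> 'm set gorder" where
  "quot_poset C G =
    \<lparr>carrier = quotients C G // quot_rel C G,
     eq = (=),
     le = (\<lambda>x y. \<exists>\<pi> \<in> x. \<exists>\<sigma> \<in> y. \<exists>h \<in> Hom C (Cod C \<sigma>) (Cod C \<pi>). h \<bullet>\<^bsub>C\<^esub> \<sigma> = \<pi>)\<rparr>"

definition quot_class :: "('o, 'm) cat \<Rightarrow> 'm \<Rightarrow> 'm set" where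
  "quot_class C \<pi> = quot_rel C (Dom C \<pi>) `` {\<pi>}"

text \<open>For a class \<open>x\<close> of quotients \<open>(F, \<pi>)\<close>, the objects \<open>F\<close> that occur are exactly those of
  one isomorphism class of objects.\<close>

definition quot_obj :: "('o, 'm) cat \<Rightarrow> 'm set \<Rightarrow> 'o set" where
  "quot_obj C x = Cod C ` x"

text \<open>For \<open>\<pi> \<in> Epi C G F\<close>, this is the set underlying the poset \<open>[F, G]\<close>.\<close>

definition quot_interval :: "('o, 'm) cat \<Rightarrow> 'm \<Rightarrow> 'm set set" where
  "quot_interval C \<pi> = {x \<in> carrier (quot_poset C (Dom C \<pi>)).
     quot_class C \<pi> \<sqsubseteq>\<^bsub>quot_poset C (Dom C \<pi>)\<^esub> x}"

definition simple_epi :: "('o, 'm) cat \<Rightarrow> 'o \<Rightarrow> 'o \<Rightarrow> 'm \<Rightarrow> bool" where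
  "simple_epi C G F \<pi> \<longleftrightarrow> \<pi> \<in> Epi C G F \<and> \<pi> \<notin> Iso C G F \<and>
     quot_interval C \<pi> = {quot_class C \<pi>, quot_class C (ident C G)}"

definition minimal_obj :: "('o, 'm) cat \<Rightarrow> 'o \<Rightarrow> bool" where
  "minimal_obj C G \<longleftrightarrow> G \<in> Ob C \<and> carrier (quot_poset C G) = {quot_class C (ident C G)}"

definition minimal_classes :: "('o, 'm) cat \<Rightarrow> 'o set set" where
  "minimal_classes C = {\<gamma> \<in> iso_classes C. \<forall>G \<in> \<gamma>. minimal_obj C G}"


section \<open>Formations and levels\<close>

definition downward_closed :: "('o, 'm) cat \<Rightarrow> 'o set set \<Rightarrow> bool" where
  "downward_closed C S \<longleftrightarrow>
    (\<forall>\<gamma> \<in> S. \<forall>G \<in> \<gamma>. \<forall>x \<in> carrier (quot_poset C G). quot_obj C x \<in> S)"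

definition join_closed :: "('o, 'm) cat \<Rightarrow> 'o set set \<Rightarrow> bool" where
  "join_closed C S \<longleftrightarrow>
    (\<forall>G \<in> Ob C. \<forall>x \<in> carrier (quot_poset C G). \<forall>y \<in> carrier (quot_poset C G). \<forall>j.
       quot_obj C x \<in> S \<longrightarrow> quot_obj C y \<in> S \<longrightarrow>
       least (quot_poset C G) j (Upper (quot_poset C G) {x, y}) \<longrightarrow> quot_obj C j \<in> S)"

definition formation :: "('o, 'm) cat \<Rightarrow> 'o set set \<Rightarrow> bool" where
  "formation C S \<longleftrightarrow> S \<subseteq> iso_classes C \<and> downward_closed C S \<and> join_closed C S \<and>
     minimal_classes C \<subseteq> S"

definition levels :: "('o, 'm) cat \<Rightarrow> 'o set set set" where
  "levels C = {formation C hull B | B. finite B \<and> B \<subseteq> iso_classes C}"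


section \<open>Diamond categories\<close>

locale modular_lattice = Lattice.lattice L for L (structure) +
  assumes modular: "a \<in> carrier L \<Longrightarrow> b \<in> carrier L \<Longrightarrow> x \<in> carrier L \<Longrightarrow> a \<sqsubseteq> b \<Longrightarrow>
    a \<squnion> (x \<sqinter> b) = (a \<squnion> x) \<sqinter> b"

locale diamond_category = category C for C :: "('o, 'm) cat" (structure) +
  assumes finite_quotients: "G \<in> Ob C \<Longrightarrow> finite (carrier (quot_poset C G))"
    and modular_quotients: "G \<in> Ob C \<Longrightarrow> modular_lattice (quot_poset C G)"
    and finite_Aut: "G \<in> Ob C \<Longrightarrow> finite (Aut C G)"
    and finite_simple_epi: "L \<in> levels C \<Longrightarrow> \<gamma> \<in> L \<Longrightarrow>
      finite {\<eta> \<in> L. \<exists>H \<in> \<eta>. \<exists>G \<in> \<gamma>. \<exists>\<pi>. simple_epi C H G \<pi>}"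
    and countable_minimal: "countable (minimal_classes C)"


section \<open>Moebius function\<close>

text \<open>The value is 0 unless \<open>a \<sqsubseteq> b\<close>; the guard on finiteness and on the order axioms only
  serves termination.\<close>

function mobius :: "('a, 'b) gorder_scheme \<Rightarrow> 'a \<Rightarrow> 'a \<Rightarrow> int" where
  "mobius L a b =
    (if Order.partial_order L \<and> a \<in> carrier L \<and> b \<in> carrier L \<and>
        finite {z \<in> carrier L. a \<sqsubseteq>\<^bsub>L\<^esub> z \<and> z \<sqsubseteq>\<^bsub>L\<^esub> b} \<and> a \<sqsubseteq>\<^bsub>L\<^esub> b
     then if a = b then 1
          else - (\<Sum>z \<in> {z \<in> carrier L. a \<sqsubseteq>\<^bsub>L\<^esub> z \<and> z \<sqsubset>\<^bsub>L\<^esub> b}. mobius L a z)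
     else 0)"
  by pat_completeness auto
termination
proof (relation "Wellfounded.measure (\<lambda>(L, a, b). card {z \<in> carrier L. a \<sqsubseteq>\<^bsub>L\<^esub> z \<and> z \<sqsubseteq>\<^bsub>L\<^esub> b})", simp, clarsimp)
  fix L :: "('a, 'b) gorder_scheme" and a b x
  assume po: "Order.partial_order L" and a: "a \<in> carrier L" and b: "b \<in> carrier L"
    and fin: "finite {z \<in> carrier L. a \<sqsubseteq>\<^bsub>L\<^esub> z \<and> z \<sqsubseteq>\<^bsub>L\<^esub> b}" and ab: "a \<sqsubseteq>\<^bsub>L\<^esub> b"
    and x: "x \<in> carrier L" and xb: "x \<sqsubset>\<^bsub>L\<^esub> b"
  interpret Order.partial_order L by (rule po)
  have "x \<sqsubseteq>\<^bsub>L\<^esub> b" "x \<noteq> b"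
    using xb x b by (auto simp: lless_def eq_is_equal)
  then have "\<not> b \<sqsubseteq>\<^bsub>L\<^esub> x"
    using x b by (metis eq_is_equal weak_le_antisym)
  then have "{z \<in> carrier L. a \<sqsubseteq>\<^bsub>L\<^esub> z \<and> z \<sqsubseteq>\<^bsub>L\<^esub> x} \<subset> {z \<in> carrier L. a \<sqsubseteq>\<^bsub>L\<^esub> z \<and> z \<sqsubseteq>\<^bsub>L\<^esub> b}"
    using \<open>x \<sqsubseteq>\<^bsub>L\<^esub> b\<close> x b ab by (auto intro: le_trans)
  then show "card {z \<in> carrier L. a \<sqsubseteq>\<^bsub>L\<^esub> z \<and> z \<sqsubseteq>\<^bsub>L\<^esub> x} < card {z \<in> carrier L. a \<sqsubseteq>\<^bsub>L\<^esub> z \<and> z \<sqsubseteq>\<^bsub>L\<^esub> b}"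
    using fin by (simp add: psubset_card_mono)
qed

declare mobius.simps [simp del]

definition mu :: "('o, 'm) cat \<Rightarrow> 'm \<Rightarrow> int" where
  "mu C \<pi> = mobius (quot_poset C (Dom C \<pi>)) (quot_class C \<pi>) (quot_class C (ident C (Dom C \<pi>)))"

definition Epi_orbits :: "('o, 'm) cat \<Rightarrow> 'o \<Rightarrow> 'o \<Rightarrow> 'm set set" where
  "Epi_orbits C G F = Epi C G F // {(\<pi>, \<pi>'). \<exists>\<alpha> \<in> Aut C F. \<pi>' = \<alpha> \<bullet>\<^bsub>C\<^esub> \<pi>}"

definition mu_hat :: "('o, 'm) cat \<Rightarrow> 'o \<Rightarrow> 'o \<Rightarrow> int" where
  "mu_hat C F G = (\<Sum>orb \<in> Epi_orbits C G F. mu C (rep orb))"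

definition Z_count :: "('o, 'm) cat \<Rightarrow> 'm \<Rightarrow> nat" where
  "Z_count C \<pi> = (let Q = quot_poset C (Dom C \<pi>); I = quot_interval C \<pi> in
     card {H \<in> I. \<forall>K1 \<in> I. \<forall>K2 \<in> I.
       H \<squnion>\<^bsub>Q\<^esub> (K1 \<sqinter>\<^bsub>Q\<^esub> K2) = (H \<squnion>\<^bsub>Q\<^esub> K1) \<sqinter>\<^bsub>Q\<^esub> (H \<squnion>\<^bsub>Q\<^esub> K2)})"


section \<open>Moments\<close>

text \<open>The numbers \<open>M\<close> are indexed by isomorphism classes. In a diamond category the sets
  \<open>Epi C G F\<close> are finite (lemma \<open>finite_Epi\<close> below), so the inner sum is a genuine one.\<close>

definition well_behaved :: "('o, 'm) cat \<Rightarrow> ('o set \<Rightarrow> real) \<Rightarrow> bool" where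
  "well_behaved C M \<longleftrightarrow> (\<forall>L \<in> levels C. \<forall>F \<in> L.
     (\<lambda>G. \<Sum>\<pi> \<in> Epi C (rep G) (rep F).
        \<bar>real_of_int (mu C \<pi>)\<bar> / real (card (Aut C (rep G))) * real (Z_count C \<pi>) ^ 3 * \<bar>M G\<bar>)
     summable_on L)"

definition v_val :: "('o, 'm) cat \<Rightarrow> ('o set \<Rightarrow> real) \<Rightarrow> 'o set set \<Rightarrow> 'o set \<Rightarrow> real" where
  "v_val C M L F = (\<Sum>\<^sub>\<infinity>G \<in> L.
     real_of_int (mu_hat C (rep F) (rep G)) / real (card (Aut C (rep G))) * M G)"

text \<open>\<open>level_quot C L \<gamma>\<close> is the class of the maximal quotient in \<open>L\<close> of an object of class \<open>\<gamma>\<close>.\<close>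

definition level_quot :: "('o, 'm) cat \<Rightarrow> 'o set set \<Rightarrow> 'o set \<Rightarrow> 'o set" where
  "level_quot C L \<gamma> = (let Q = quot_poset C (rep \<gamma>) in
     quot_obj C (\<Squnion>\<^bsub>Q\<^esub> {x \<in> carrier Q. quot_obj C x \<in> L}))"

text \<open>Pro-isomorphism classes are extensional functions, i.e. have a fixed junk value outside
  \<open>levels C\<close>, so that they are determined by their values on levels.\<close>

definition pro_classes :: "('o, 'm) cat \<Rightarrow> ('o set set \<Rightarrow> 'o set) set" where
  "pro_classes C = {X \<in> (\<Pi>\<^sub>E L \<in> levels C. L).
     \<forall>L \<in> levels C. \<forall>L' \<in> levels C. L \<subseteq> L' \<longrightarrow> level_quot C L (X L') = X L}"

definition basic_open :: "('o, 'm) cat \<Rightarrow> 'o set set \<Rightarrow> 'o set \<Rightarrow> ('o set set \<Rightarrow> 'o set) set" where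
  "basic_open C L F = {X \<in> pro_classes C. X L = F}"

definition pro_algebra :: "('o, 'm) cat \<Rightarrow> ('o set set \<Rightarrow> 'o set) measure" where
  "pro_algebra C = sigma (pro_classes C) {basic_open C L F | L F. L \<in> levels C \<and> F \<in> L}"

text \<open>The number of epimorphisms from \<open>X\<close> to \<open>G\<close>, computed in the smallest level containing
  \<open>G\<close>.\<close>

definition epi_count :: "('o, 'm) cat \<Rightarrow> ('o set set \<Rightarrow> 'o set) \<Rightarrow> 'o set \<Rightarrow> nat" where
  "epi_count C X G = card (Epi C (rep (X (formation C hull {G}))) (rep G))"

text \<open>Finite moments only: the integrand is nonnegative, so an infinite integral is exactly a
  failure of integrability, and then \<open>has_moment\<close> holds for no real \<open>m\<close>.\<close>

definition has_moment ::
    "('o, 'm) cat \<Rightarrow> ('o set set \<Rightarrow> 'o set) measure \<Rightarrow> 'o set \<Rightarrow> real \<Rightarrow> bool" where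
  "has_moment C \<nu> G m \<longleftrightarrow> has_bochner_integral \<nu> (\<lambda>X. real (epi_count C X G)) m"

definition has_moments ::
    "('o, 'm) cat \<Rightarrow> ('o set \<Rightarrow> real) \<Rightarrow> ('o set set \<Rightarrow> 'o set) measure \<Rightarrow> bool" where
  "has_moments C M \<nu> \<longleftrightarrow> sets \<nu> = sets (pro_algebra C) \<and>
     (\<forall>G \<in> iso_classes C. has_moment C \<nu> G (M G))"


section \<open>Basic facts\<close>

context category
begin

lemma Hom_Ob: "f \<in> Hom C G F \<Longrightarrow> G \<in> Ob C \<and> F \<in> Ob C"
  using Dom_closed Cod_closed by (auto simp: Hom_def)

lemma Epi_Ob: "f \<in> Epi C G F \<Longrightarrow> G \<in> Ob C \<and> F \<in> Ob C"
  using Hom_Ob by (auto simp: Epi_def)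

lemma ident_Iso: "G \<in> Ob C \<Longrightarrow> ident C G \<in> Iso C G G"
  using ident_closed Comp_ident by (fastforce simp: Iso_def)

lemma Iso_inverse:
  assumes "\<rho> \<in> Iso C G F"
  obtains \<sigma> where "\<sigma> \<in> Iso C F G" "\<sigma> \<bullet> \<rho> = ident C G" "\<rho> \<bullet> \<sigma> = ident C F"
  using assms by (auto simp: Iso_def)

lemma Iso_Comp:
  assumes "\<rho> \<in> Iso C E F" "\<tau> \<in> Iso C F G"
  shows "\<tau> \<bullet> \<rho> \<in> Iso C E G"
proof -
  have h: "\<rho> \<in> Hom C E F" "\<tau> \<in> Hom C F G"
    using assms by (auto simp: Iso_def)
  obtain \<rho>' where r: "\<rho>' \<in> Hom C F E" "\<rho>' \<bullet> \<rho> = ident C E" "\<rho> \<bullet> \<rho>' = ident C F"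
    using assms(1) by (auto simp: Iso_def)
  obtain \<tau>' where t: "\<tau>' \<in> Hom C G F" "\<tau>' \<bullet> \<tau> = ident C F" "\<tau> \<bullet> \<tau>' = ident C G"
    using assms(2) by (auto simp: Iso_def)
  have "(\<rho>' \<bullet> \<tau>') \<bullet> (\<tau> \<bullet> \<rho>) = \<rho>' \<bullet> (\<tau>' \<bullet> (\<tau> \<bullet> \<rho>))"
    by (rule Comp_assoc[OF Comp_closed[OF h] t(1) r(1)])
  also have "\<tau>' \<bullet> (\<tau> \<bullet> \<rho>) = \<rho>"
    using Comp_assoc[OF h(1) h(2) t(1)] t(2) ident_Comp[OF h(1)] by simp
  finally have 1: "(\<rho>' \<bullet> \<tau>') \<bullet> (\<tau> \<bullet> \<rho>) = ident C E"
    using r by simp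
  have "(\<tau> \<bullet> \<rho>) \<bullet> (\<rho>' \<bullet> \<tau>') = \<tau> \<bullet> (\<rho> \<bullet> (\<rho>' \<bullet> \<tau>'))"
    by (rule Comp_assoc[OF Comp_closed[OF t(1) r(1)] h(1) h(2)])
  also have "\<rho> \<bullet> (\<rho>' \<bullet> \<tau>') = \<tau>'"
    using Comp_assoc[OF t(1) r(1) h(1)] r(3) ident_Comp[OF t(1)] by simp
  finally have 2: "(\<tau> \<bullet> \<rho>) \<bullet> (\<rho>' \<bullet> \<tau>') = ident C G"
    using t by simp
  show ?thesis
    unfolding Iso_def using 1 2 Comp_closed[OF h] Comp_closed[OF t(1) r(1)] by blast
qed

lemma equiv_iso_rel: "equiv (Ob C) (iso_rel C)"
proof (rule equivI)
  show "iso_rel C \<subseteq> Ob C \<times> Ob C"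
    by (auto simp: iso_rel_def)
  show "refl_on (Ob C) (iso_rel C)"
    using ident_Iso by (force simp: refl_on_def iso_rel_def)
  show "sym (iso_rel C)"
    unfolding sym_def iso_rel_def using Iso_inverse by blast
  show "trans (iso_rel C)"
    unfolding trans_def iso_rel_def using Iso_Comp by blast
qed

lemma quotients_iff: "\<pi> \<in> quotients C G \<longleftrightarrow> \<pi> \<in> Epi C G (Cod C \<pi>)"
  using Epi_Ob by (auto simp: quotients_def Epi_def Hom_def)

lemma equiv_quot_rel: "equiv (quotients C G) (quot_rel C G)"
proof (rule equivI)
  show "quot_rel C G \<subseteq> quotients C G \<times> quotients C G"
    by (auto simp: quot_rel_def)
  show "refl_on (quotients C G) (quot_rel C G)"
  proof (rule refl_onI)
    fix \<pi> assume p: "\<pi> \<in> quotients C G"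
    then have h: "\<pi> \<in> Hom C G (Cod C \<pi>)" by (simp add: quotients_iff Epi_def)
    then show "(\<pi>, \<pi>) \<in> quot_rel C G"
      using p ident_Iso[of "Cod C \<pi>"] ident_Comp[OF h] Hom_Ob[OF h] by (force simp: quot_rel_def)
  qed
  show "sym (quot_rel C G)"
  proof (rule symI)
    fix \<pi> \<pi>' assume "(\<pi>, \<pi>') \<in> quot_rel C G"
    then obtain \<rho> where p: "\<pi> \<in> quotients C G" "\<pi>' \<in> quotients C G"
      and r: "\<rho> \<in> Iso C (Cod C \<pi>) (Cod C \<pi>')" "\<pi>' = \<rho> \<bullet> \<pi>"
      by (auto simp: quot_rel_def)
    obtain \<sigma> where s: "\<sigma> \<in> Iso C (Cod C \<pi>') (Cod C \<pi>)" "\<sigma> \<bullet> \<rho> = ident C (Cod C \<pi>)"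
      using Iso_inverse[OF r(1)] by blast
    have h: "\<pi> \<in> Hom C G (Cod C \<pi>)" using p(1) by (simp add: quotients_iff Epi_def)
    have "\<sigma> \<bullet> \<pi>' = \<pi>"
      using Comp_assoc[OF h, of \<rho> _ \<sigma>] r s ident_Comp[OF h] by (auto simp: Iso_def)
    then show "(\<pi>', \<pi>) \<in> quot_rel C G"
      using p s by (force simp: quot_rel_def)
  qed
  show "trans (quot_rel C G)"
  proof (rule transI)
    fix \<pi> \<pi>' \<pi>'' assume "(\<pi>, \<pi>') \<in> quot_rel C G" "(\<pi>', \<pi>'') \<in> quot_rel C G"
    then obtain \<rho> \<tau> where p: "\<pi> \<in> quotients C G" "\<pi>' \<in> quotients C G" "\<pi>'' \<in> quotients C G"
      and r: "\<rho> \<in> Iso C (Cod C \<pi>) (Cod C \<pi>')" "\<pi>' = \<rho> \<bullet> \<pi>"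
      and t: "\<tau> \<in> Iso C (Cod C \<pi>') (Cod C \<pi>'')" "\<pi>'' = \<tau> \<bullet> \<pi>'"
      by (auto simp: quot_rel_def)
    have h: "\<pi> \<in> Hom C G (Cod C \<pi>)" using p(1) by (simp add: quotients_iff Epi_def)
    have "\<pi>'' = (\<tau> \<bullet> \<rho>) \<bullet> \<pi>"
      using Comp_assoc[OF h, of \<rho> _ \<tau>] r t by (auto simp: Iso_def)
    then show "(\<pi>, \<pi>'') \<in> quot_rel C G"
      using p Iso_Comp[OF r(1) t(1)] by (force simp: quot_rel_def)
  qed
qed

end

lemma (in diamond_category) finite_Epi:
  assumes "G \<in> Ob C" "F \<in> Ob C"
  shows "finite (Epi C G F)"
proof -
  let ?Q = "quotients C G // quot_rel C G"
  have fin: "finite ?Q"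
    using finite_quotients[OF assms(1)] by (simp add: quot_poset_def)
  have "finite {\<pi> \<in> x. Cod C \<pi> = F}" if x: "x \<in> ?Q" for x
  proof (cases "{\<pi> \<in> x. Cod C \<pi> = F} = {}")
    case False
    then obtain \<pi> where p: "\<pi> \<in> x" "Cod C \<pi> = F" by blast
    have "{\<pi> \<in> x. Cod C \<pi> = F} \<subseteq> (\<lambda>\<alpha>. \<alpha> \<bullet> \<pi>) ` Aut C F"
    proof clarify
      fix \<pi>' assume "\<pi>' \<in> x" "F = Cod C \<pi>'"
      then have "(\<pi>, \<pi>') \<in> quot_rel C G"
        using quotient_eq_iff[OF equiv_quot_rel x x p(1)] by simp
      then show "\<pi>' \<in> (\<lambda>\<alpha>. \<alpha> \<bullet> \<pi>) ` Aut C (Cod C \<pi>')"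
        using p \<open>F = Cod C \<pi>'\<close> by (auto simp: quot_rel_def)
    qed
    then show ?thesis
      using finite_Aut[OF assms(2)] by (meson finite_imageI finite_subset)
  qed (metis finite.emptyI)
  moreover have "Epi C G F \<subseteq> (\<Union>x \<in> ?Q. {\<pi> \<in> x. Cod C \<pi> = F})"
  proof
    fix \<pi> assume p: "\<pi> \<in> Epi C G F"
    then have c: "Cod C \<pi> = F" by (simp add: Epi_def Hom_def)
    then have "\<pi> \<in> quotients C G" using p by (simp add: quotients_iff)
    then have "\<pi> \<in> quot_rel C G `` {\<pi>}" "quot_rel C G `` {\<pi>} \<in> ?Q"
      using equiv_class_self[OF equiv_quot_rel] by (auto intro: quotientI)
    then show "\<pi> \<in> (\<Union>x \<in> ?Q. {\<pi> \<in> x. Cod C \<pi> = F})" using c by blast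
  qed
  ultimately show ?thesis
    using fin by (meson finite_UN finite_subset)
qed

end

theory Submission
  imports Defs
begin

text \<open>If a measure on a level has the given moments, Moebius inversion in the lattices of quotients
  recovers it as \<open>v\<close>, the sums being absolutely convergent because moments are sums of nonnegative
  terms. In the other direction the inversion does not converge absolutely as a whole. One therefore
  inverts in steps: the quotients \<open>F \<rightarrow> T\<close> are sorted by the socle of \<open>F\<close> over \<open>T\<close>, i.e. the
  largest quotient of \<open>F\<close> that is complemented over \<open>T\<close>, then by the socle over that, and so on. A
  step involves only complemented intervals, where the sum of the \<open>\<bar>\<mu>\<bar>\<close> is at most \<open>Z\<^sup>3\<close> times the
  \<open>\<bar>\<mu>\<bar>\<close> of the whole interval, so well-behavedness makes it absolutely convergent (Weisner's theorem
  identifies its terms). The number of steps is bounded on a level, since Loewy length does not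
  increase under quotients and joins. Hence the nonnegative numbers \<open>v\<close> have the right moments, and
  by uniqueness they are compatible between levels.

  They define a finitely additive measure on the sets determined at one level. It is countably
  additive by a compactness argument, for which a compatible sequence of objects in increasing levels
  must extend to a pro-isomorphism class. There may be uncountably many levels; the extension exists
  because the maximal quotients of the sequence in any fixed level stabilise: each of the boundedly
  many Loewy layers is built from finitely many simple epimorphisms.\<close>

no_notation inner (infix "\<bullet>" 70)
no_notation join (infixl "\<squnion>\<index>" 65)
no_notation meet (infixl "\<sqinter>\<index>" 70)
no_notation le (infixl "\<sqsubseteq>\<index>" 50)

section \<open>Finite modular lattices\<close>

text \<open>The obstacle lies in passing from \<open>v\<close> back to the moments. Rearranging the
  double sum over quotients \<open>G \<rightarrow> F \<rightarrow> T\<close> at once would need the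
  sum of \<open>\<bar>\<mu>(F,G)\<bar> * \<bar>M G\<bar>\<close> over all F between, while
  well-behavedness controls only \<open>\<mu>(T,G)\<close>, which vanishes whenever
  \<open>[T,G]\<close> is not complemented, even if \<open>\<mu>(F,G)\<close> does not. On a
  complemented interval the two are comparable. Lowering the bottom by one cover multiplies the
  ratio of \<open>mobius_mass\<close> to \<open>\<bar>m\<bar>\<close> by \<open>1 + 1 / N\<close>,
  where N counts the coatoms avoiding the cover. Seen from the top, the lattice is a projective
  geometry with several components. Within one component the lower bounds for N grow at least like
  1, 2, 4, ..., which keeps the product of the factors below 8 = 2^3. Every union of components
  yields an element counted by Z, so with c components the ratio is at most 8^c = (2^c)^3 \<le> Z^3.
  This is the origin of the cube: for N = 1, 2, 4, ... the product tends to about 4.77, which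
  exceeds 2^2.\<close>

locale finite_modular_lattice =
  fixes A :: "'a set" and leq :: "'a \<Rightarrow> 'a \<Rightarrow> bool" (infix "\<sqsubseteq>" 50)
    and jn :: "'a \<Rightarrow> 'a \<Rightarrow> 'a" (infixl "\<squnion>" 65) and mt :: "'a \<Rightarrow> 'a \<Rightarrow> 'a" (infixl "\<sqinter>" 70)
    and bt tp :: 'a
  assumes finite_carrier: "finite A"
    and le_refl [simp]: "x \<in> A \<Longrightarrow> x \<sqsubseteq> x"
    and antisym: "x \<in> A \<Longrightarrow> y \<in> A \<Longrightarrow> x \<sqsubseteq> y \<Longrightarrow> y \<sqsubseteq> x \<Longrightarrow> x = y"
    and trans: "x \<in> A \<Longrightarrow> y \<in> A \<Longrightarrow> z \<in> A \<Longrightarrow> x \<sqsubseteq> y \<Longrightarrow> y \<sqsubseteq> z \<Longrightarrow> x \<sqsubseteq> z"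
    and jn_closed [simp, intro]: "x \<in> A \<Longrightarrow> y \<in> A \<Longrightarrow> x \<squnion> y \<in> A"
    and mt_closed [simp, intro]: "x \<in> A \<Longrightarrow> y \<in> A \<Longrightarrow> x \<sqinter> y \<in> A"
    and jn_le_iff: "x \<in> A \<Longrightarrow> y \<in> A \<Longrightarrow> z \<in> A \<Longrightarrow> x \<squnion> y \<sqsubseteq> z \<longleftrightarrow> x \<sqsubseteq> z \<and> y \<sqsubseteq> z"
    and le_mt_iff: "x \<in> A \<Longrightarrow> y \<in> A \<Longrightarrow> z \<in> A \<Longrightarrow> z \<sqsubseteq> x \<sqinter> y \<longleftrightarrow> z \<sqsubseteq> x \<and> z \<sqsubseteq> y"
    and modular: "x \<in> A \<Longrightarrow> y \<in> A \<Longrightarrow> z \<in> A \<Longrightarrow> x \<sqsubseteq> z \<Longrightarrow> (x \<squnion> y) \<sqinter> z = x \<squnion> (y \<sqinter> z)"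
    and bt_closed [simp, intro]: "bt \<in> A" and tp_closed [simp, intro]: "tp \<in> A"
    and bt_le [simp]: "x \<in> A \<Longrightarrow> bt \<sqsubseteq> x" and le_tp [simp]: "x \<in> A \<Longrightarrow> x \<sqsubseteq> tp"
begin

section \<open>Lattice identities, duality, intervals and extremal elements\<close>

lemma jn_ub1 [simp]: "x \<in> A \<Longrightarrow> y \<in> A \<Longrightarrow> x \<sqsubseteq> x \<squnion> y"
  and jn_ub2 [simp]: "x \<in> A \<Longrightarrow> y \<in> A \<Longrightarrow> y \<sqsubseteq> x \<squnion> y"
  using jn_le_iff[of x y "x \<squnion> y"] by auto

lemma mt_lb1 [simp]: "x \<in> A \<Longrightarrow> y \<in> A \<Longrightarrow> x \<sqinter> y \<sqsubseteq> x"
  and mt_lb2 [simp]: "x \<in> A \<Longrightarrow> y \<in> A \<Longrightarrow> x \<sqinter> y \<sqsubseteq> y"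
  using le_mt_iff[of x y "x \<sqinter> y"] by auto

lemma mt_greatest: "x \<in> A \<Longrightarrow> y \<in> A \<Longrightarrow> z \<in> A \<Longrightarrow> z \<sqsubseteq> x \<Longrightarrow> z \<sqsubseteq> y \<Longrightarrow> z \<sqsubseteq> x \<sqinter> y"
  by (simp add: le_mt_iff)

lemma jn_absorb: "x \<in> A \<Longrightarrow> y \<in> A \<Longrightarrow> x \<sqsubseteq> y \<Longrightarrow> x \<squnion> y = y"
  by (rule antisym) (auto simp: jn_le_iff)

lemma jn_absorb2: "x \<in> A \<Longrightarrow> y \<in> A \<Longrightarrow> y \<sqsubseteq> x \<Longrightarrow> x \<squnion> y = x"
  by (rule antisym) (auto simp: jn_le_iff)

lemma mt_absorb: "x \<in> A \<Longrightarrow> y \<in> A \<Longrightarrow> x \<sqsubseteq> y \<Longrightarrow> x \<sqinter> y = x"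
  by (rule antisym) (auto simp: le_mt_iff)

lemma mt_absorb2: "x \<in> A \<Longrightarrow> y \<in> A \<Longrightarrow> y \<sqsubseteq> x \<Longrightarrow> x \<sqinter> y = y"
  by (rule antisym) (auto simp: le_mt_iff)

lemma le_jn1: "x \<in> A \<Longrightarrow> y \<in> A \<Longrightarrow> z \<in> A \<Longrightarrow> z \<sqsubseteq> x \<Longrightarrow> z \<sqsubseteq> x \<squnion> y"
  using trans[of z x "x \<squnion> y"] by auto

lemma le_jn2: "x \<in> A \<Longrightarrow> y \<in> A \<Longrightarrow> z \<in> A \<Longrightarrow> z \<sqsubseteq> y \<Longrightarrow> z \<sqsubseteq> x \<squnion> y"
  using trans[of z y "x \<squnion> y"] by auto

lemma mt_le1: "x \<in> A \<Longrightarrow> y \<in> A \<Longrightarrow> z \<in> A \<Longrightarrow> x \<sqsubseteq> z \<Longrightarrow> x \<sqinter> y \<sqsubseteq> z"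
  using trans[of "x \<sqinter> y" x z] by auto

lemma mt_le2: "x \<in> A \<Longrightarrow> y \<in> A \<Longrightarrow> z \<in> A \<Longrightarrow> y \<sqsubseteq> z \<Longrightarrow> x \<sqinter> y \<sqsubseteq> z"
  using trans[of "x \<sqinter> y" y z] by auto

lemma jn_comm: "x \<in> A \<Longrightarrow> y \<in> A \<Longrightarrow> x \<squnion> y = y \<squnion> x"
  by (rule antisym) (auto simp: jn_le_iff)

lemma mt_comm: "x \<in> A \<Longrightarrow> y \<in> A \<Longrightarrow> x \<sqinter> y = y \<sqinter> x"
  by (rule antisym) (auto simp: le_mt_iff)

lemma jn_assoc: "x \<in> A \<Longrightarrow> y \<in> A \<Longrightarrow> z \<in> A \<Longrightarrow> (x \<squnion> y) \<squnion> z = x \<squnion> (y \<squnion> z)"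
  by (rule antisym) (auto simp: jn_le_iff intro: le_jn1 le_jn2)

lemma jn_mono: "x \<in> A \<Longrightarrow> y \<in> A \<Longrightarrow> x' \<in> A \<Longrightarrow> y' \<in> A \<Longrightarrow> x \<sqsubseteq> x' \<Longrightarrow> y \<sqsubseteq> y' \<Longrightarrow> x \<squnion> y \<sqsubseteq> x' \<squnion> y'"
  by (auto simp: jn_le_iff intro: le_jn1 le_jn2)

lemma mt_mono: "x \<in> A \<Longrightarrow> y \<in> A \<Longrightarrow> x' \<in> A \<Longrightarrow> y' \<in> A \<Longrightarrow> x \<sqsubseteq> x' \<Longrightarrow> y \<sqsubseteq> y' \<Longrightarrow> x \<sqinter> y \<sqsubseteq> x' \<sqinter> y'"
  by (auto simp: le_mt_iff intro: mt_le1 mt_le2)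

lemma modular2: "x \<in> A \<Longrightarrow> y \<in> A \<Longrightarrow> z \<in> A \<Longrightarrow> z \<sqsubseteq> x \<Longrightarrow> x \<sqinter> (y \<squnion> z) = (x \<sqinter> y) \<squnion> z"
  using modular[of z y x] by (simp add: mt_comm jn_comm)

lemma dual: "finite_modular_lattice A (\<lambda>x y. y \<sqsubseteq> x) mt jn tp bt"
proof (unfold_locales, goal_cases)
  case (3 x y)
  then show ?case using antisym by blast
next
  case (4 x y z)
  then show ?case using trans by blast
next
  case (9 x y z)
  then show ?case using modular2[of x y z] by simp
qed (simp_all add: finite_carrier jn_le_iff le_mt_iff)

lemma interval:
  assumes "a \<in> A" "b \<in> A" "a \<sqsubseteq> b"
  shows "finite_modular_lattice {x \<in> A. a \<sqsubseteq> x \<and> x \<sqsubseteq> b} leq jn mt a b"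
proof (unfold_locales, goal_cases)
  case (3 x y)
  then show ?case using antisym by blast
next
  case (4 x y z)
  then show ?case using trans by blast
next
  case (9 x y z)
  then show ?case using modular[of x y z] by simp
qed (use assms in \<open>auto simp: finite_carrier jn_le_iff le_mt_iff intro: le_jn1 mt_le1\<close>)

lemma ex_min:
  assumes "S \<subseteq> A" "S \<noteq> {}"
  shows "\<exists>m \<in> S. \<forall>x \<in> S. x \<sqsubseteq> m \<longrightarrow> x = m"
proof -
  have "finite S" using assms finite_carrier finite_subset by blast
  from this assms(2,1) show ?thesis
  proof (induction S rule: finite_ne_induct)
    case (insert x S)
    then obtain m where m: "m \<in> S" "\<forall>y \<in> S. y \<sqsubseteq> m \<longrightarrow> y = m" by auto
    have A: "m \<in> A" "x \<in> A" using insert m by auto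
    show ?case
    proof (cases "x \<sqsubseteq> m")
      case True
      have "y = x" if "y \<in> S" "y \<sqsubseteq> x" for y
      proof -
        have "y \<sqsubseteq> m" using trans[of y x m] that True A insert by auto
        then have "y = m" using m that by auto
        then show ?thesis using antisym[of x m] A True that by auto
      qed
      then show ?thesis by blast
    next
      case False
      then show ?thesis using m by blast
    qed
  qed auto
qed

lemma ex_max:
  assumes "S \<subseteq> A" "S \<noteq> {}"
  shows "\<exists>m \<in> S. \<forall>x \<in> S. m \<sqsubseteq> x \<longrightarrow> x = m"
  using finite_modular_lattice.ex_min[OF dual assms] by simp

section \<open>Joins of arbitrary subsets\<close>

definition Jn :: "'a set \<Rightarrow> 'a" where
  "Jn S = (SOME s. s \<in> A \<and> (\<forall>z \<in> A. s \<sqsubseteq> z \<longleftrightarrow> (\<forall>x \<in> S. x \<sqsubseteq> z)))"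

lemma Jn_ex:
  assumes "S \<subseteq> A"
  shows "\<exists>s. s \<in> A \<and> (\<forall>z \<in> A. s \<sqsubseteq> z \<longleftrightarrow> (\<forall>x \<in> S. x \<sqsubseteq> z))"
proof -
  have "finite S" using assms finite_carrier finite_subset by blast
  then show ?thesis using assms
  proof (induction S)
    case empty
    then show ?case using bt_le bt_closed by blast
  next
    case (insert x S)
    then obtain s where s: "s \<in> A" "\<forall>z \<in> A. s \<sqsubseteq> z \<longleftrightarrow> (\<forall>x \<in> S. x \<sqsubseteq> z)" by auto
    have "x \<squnion> s \<in> A \<and> (\<forall>z \<in> A. x \<squnion> s \<sqsubseteq> z \<longleftrightarrow> (\<forall>y \<in> insert x S. y \<sqsubseteq> z))"
      using s insert by (auto simp: jn_le_iff)
    then show ?case by blast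
  qed
qed

lemma Jn_closed [simp, intro]: "S \<subseteq> A \<Longrightarrow> Jn S \<in> A"
  and Jn_le_iff: "S \<subseteq> A \<Longrightarrow> z \<in> A \<Longrightarrow> Jn S \<sqsubseteq> z \<longleftrightarrow> (\<forall>x \<in> S. x \<sqsubseteq> z)"
  using someI_ex[OF Jn_ex, of S] unfolding Jn_def by auto

lemma Jn_upper: "S \<subseteq> A \<Longrightarrow> x \<in> S \<Longrightarrow> x \<sqsubseteq> Jn S"
  using Jn_le_iff[of S "Jn S"] by auto

lemma Jn_insert: "x \<in> A \<Longrightarrow> S \<subseteq> A \<Longrightarrow> Jn (insert x S) = x \<squnion> Jn S"
  by (rule antisym) (auto simp: Jn_le_iff jn_le_iff Jn_upper intro: le_jn2)

lemma Jn_empty: "Jn {} = bt"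
  by (rule antisym) (auto simp: Jn_le_iff)

section \<open>Covers and their transposition\<close>

definition cov :: "'a \<Rightarrow> 'a \<Rightarrow> bool" where
  "cov a p \<longleftrightarrow> a \<in> A \<and> p \<in> A \<and> a \<sqsubseteq> p \<and> a \<noteq> p \<and> (\<forall>z \<in> A. a \<sqsubseteq> z \<and> z \<sqsubseteq> p \<longrightarrow> z = a \<or> z = p)"

lemma covD: "cov a p \<Longrightarrow> a \<in> A" "cov a p \<Longrightarrow> p \<in> A" "cov a p \<Longrightarrow> a \<sqsubseteq> p" "cov a p \<Longrightarrow> a \<noteq> p"
  "cov a p \<Longrightarrow> z \<in> A \<Longrightarrow> a \<sqsubseteq> z \<Longrightarrow> z \<sqsubseteq> p \<Longrightarrow> z = a \<or> z = p"
  by (auto simp: cov_def)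

lemma ex_cov:
  assumes "a \<in> A" "b \<in> A" "a \<sqsubseteq> b" "a \<noteq> b"
  obtains p where "cov a p" "p \<sqsubseteq> b"
proof -
  obtain p where p: "p \<in> {x \<in> A. a \<sqsubseteq> x \<and> x \<sqsubseteq> b \<and> x \<noteq> a}"
      "\<forall>x \<in> {x \<in> A. a \<sqsubseteq> x \<and> x \<sqsubseteq> b \<and> x \<noteq> a}. x \<sqsubseteq> p \<longrightarrow> x = p"
    using ex_min[of "{x \<in> A. a \<sqsubseteq> x \<and> x \<sqsubseteq> b \<and> x \<noteq> a}"] assms le_refl[of b] by blast
  have "cov a p"
    unfolding cov_def using p assms by (auto intro: trans)
  then show ?thesis using that p by blast
qed

text \<open>By modularity every w in \<open>[z, z \<squnion> p]\<close> equals
  \<open>z \<squnion> (p \<sqinter> w)\<close>, and \<open>p \<sqinter> w\<close> lies in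
  \<open>[a, p]\<close>, which leaves two values.\<close>

lemma cov_jn:
  assumes c: "cov a p" and z: "z \<in> A" "a \<sqsubseteq> z" and n: "\<not> p \<sqsubseteq> z"
  shows "cov z (z \<squnion> p)"
proof -
  note d = covD[OF c]
  have "w = z \<or> w = z \<squnion> p" if w: "w \<in> A" "z \<sqsubseteq> w" "w \<sqsubseteq> z \<squnion> p" for w
  proof -
    have e: "w = z \<squnion> (p \<sqinter> w)"
      using modular[of z p w] mt_absorb2[of "z \<squnion> p" w] w d z by auto
    have "a \<sqsubseteq> p \<sqinter> w" using w d z trans[of a z w] by (auto simp: le_mt_iff)
    then have "p \<sqinter> w = a \<or> p \<sqinter> w = p" using d w by auto
    then show ?thesis using e z d by (auto simp: jn_absorb2)
  qed
  moreover have "z \<noteq> z \<squnion> p" using n jn_ub2[of z p] z d by metis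
  ultimately show ?thesis using z d by (auto simp: cov_def)
qed

text \<open>The downward transposition. The hypothesis \<open>p \<sqsubseteq> c \<squnion> x\<close>
  gives \<open>p = c \<squnion> (x \<sqinter> p)\<close>, so nothing of the cover is lost when
  meeting with x.\<close>

lemma cov_mt:
  assumes c: "cov c p" and x: "x \<in> A" "p \<sqsubseteq> c \<squnion> x"
  shows "cov (c \<sqinter> x) (p \<sqinter> x)"
proof -
  note d = covD[OF c]
  have m: "(c \<squnion> x) \<sqinter> p = c \<squnion> (x \<sqinter> p)" using modular[of c x p] d x by auto
  have "p = c \<squnion> (x \<sqinter> p)" using m mt_absorb2[of "c \<squnion> x" p] x d by auto
  then have ne: "c \<sqinter> x \<noteq> p \<sqinter> x" using d x by (metis jn_absorb2 mt_closed mt_comm mt_lb1)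
  have "w = c \<sqinter> x \<or> w = p \<sqinter> x" if w: "w \<in> A" "c \<sqinter> x \<sqsubseteq> w" "w \<sqsubseteq> p \<sqinter> x" for w
  proof -
    have w': "w \<sqsubseteq> p" "w \<sqsubseteq> x" using w d x by (auto simp: le_mt_iff)
    have "c \<squnion> w = c \<or> c \<squnion> w = p" using d(5)[of "c \<squnion> w"] d w w' by (auto simp: jn_le_iff)
    then show ?thesis
    proof
      assume "c \<squnion> w = c"
      then have "w \<sqsubseteq> c" using jn_ub2[of c w] d w by auto
      then have "w \<sqsubseteq> c \<sqinter> x" using w' d w x by (auto simp: le_mt_iff)
      then show ?thesis using antisym[of w "c \<sqinter> x"] w d x by auto
    next
      assume e: "c \<squnion> w = p"
      have "(w \<squnion> c) \<sqinter> x = w \<squnion> (c \<sqinter> x)" using modular[of w c x] w w' d x by auto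
      then show ?thesis using e w d x by (simp add: jn_comm[of w c] jn_absorb2)
    qed
  qed
  then show ?thesis using ne d x by (auto simp: cov_def intro!: mt_mono)
qed

section \<open>Socles and complemented intervals\<close>

definition Soc :: "'a \<Rightarrow> 'a \<Rightarrow> 'a" where
  "Soc a b = Jn (insert a {p. cov a p \<and> p \<sqsubseteq> b})"

lemma Soc_sub: "a \<in> A \<Longrightarrow> insert a {p. cov a p \<and> p \<sqsubseteq> b} \<subseteq> A"
  by (auto simp: cov_def)

lemma Soc_closed [simp, intro]: "a \<in> A \<Longrightarrow> Soc a b \<in> A"
  unfolding Soc_def using Soc_sub by blast

lemma Soc_le_iff: "a \<in> A \<Longrightarrow> z \<in> A \<Longrightarrow> Soc a b \<sqsubseteq> z \<longleftrightarrow> a \<sqsubseteq> z \<and> (\<forall>p. cov a p \<and> p \<sqsubseteq> b \<longrightarrow> p \<sqsubseteq> z)"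
  unfolding Soc_def using Soc_sub[of a b] by (subst Jn_le_iff) auto

lemma le_Soc [simp]: "a \<in> A \<Longrightarrow> a \<sqsubseteq> Soc a b"
  using Soc_le_iff[of a "Soc a b" b] by auto

lemma cov_le_Soc: "cov a p \<Longrightarrow> p \<sqsubseteq> b \<Longrightarrow> p \<sqsubseteq> Soc a b"
  using Soc_le_iff[of a "Soc a b" b] covD(1)[of a p] by auto

lemma Soc_le: "a \<in> A \<Longrightarrow> b \<in> A \<Longrightarrow> a \<sqsubseteq> b \<Longrightarrow> Soc a b \<sqsubseteq> b"
  by (auto simp: Soc_le_iff)

lemma Soc_mono: "a \<in> A \<Longrightarrow> b \<in> A \<Longrightarrow> c \<in> A \<Longrightarrow> b \<sqsubseteq> c \<Longrightarrow> Soc a b \<sqsubseteq> Soc a c"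
  using trans[of _ b c] by (auto simp: Soc_le_iff covD intro!: cov_le_Soc)

text \<open>The lattice form of semisimplicity: \<open>[a, b]\<close> is generated by its atoms. In
  a finite modular lattice this is equivalent to \<open>[a, b]\<close> being complemented.\<close>

definition ss :: "'a \<Rightarrow> 'a \<Rightarrow> bool" where
  "ss a b \<longleftrightarrow> a \<in> A \<and> b \<in> A \<and> a \<sqsubseteq> b \<and> Soc a b = b"

lemma ssD: "ss a b \<Longrightarrow> a \<in> A" "ss a b \<Longrightarrow> b \<in> A" "ss a b \<Longrightarrow> a \<sqsubseteq> b" "ss a b \<Longrightarrow> Soc a b = b"
  by (auto simp: ss_def)

lemma ssI:
  assumes "a \<in> A" "b \<in> A" "a \<sqsubseteq> b"
    and "\<And>z. z \<in> A \<Longrightarrow> a \<sqsubseteq> z \<Longrightarrow> (\<And>p. cov a p \<Longrightarrow> p \<sqsubseteq> b \<Longrightarrow> p \<sqsubseteq> z) \<Longrightarrow> b \<sqsubseteq> z"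
  shows "ss a b"
proof -
  have "b \<sqsubseteq> Soc a b" using assms by (intro assms(4)) (auto intro: cov_le_Soc)
  then show ?thesis using assms Soc_le[of a b] by (auto simp: ss_def intro: antisym)
qed

lemma ss_le: "ss a b \<Longrightarrow> z \<in> A \<Longrightarrow> a \<sqsubseteq> z \<Longrightarrow> (\<And>p. cov a p \<Longrightarrow> p \<sqsubseteq> b \<Longrightarrow> p \<sqsubseteq> z) \<Longrightarrow> b \<sqsubseteq> z"
  using Soc_le_iff[of a z b] by (auto simp: ss_def)

lemma ss_refl [simp]: "a \<in> A \<Longrightarrow> ss a a"
  by (rule ssI) auto

lemma ss_Soc: "a \<in> A \<Longrightarrow> b \<in> A \<Longrightarrow> a \<sqsubseteq> b \<Longrightarrow> ss a (Soc a b)"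
  by (rule ssI) (auto simp: Soc_le_iff intro: cov_le_Soc)

lemma ss_le_Soc: "ss a c \<Longrightarrow> b \<in> A \<Longrightarrow> c \<sqsubseteq> b \<Longrightarrow> c \<sqsubseteq> Soc a b"
  using Soc_mono[of a c b] by (auto simp: ss_def)

text \<open>Joining with z sends a cover of a either below z or to a cover of z, so generation by
  atoms survives, as for quotients of semisimple modules.\<close>

lemma ss_jn:
  assumes s: "ss a b" and z: "z \<in> A" "a \<sqsubseteq> z"
  shows "ss z (z \<squnion> b)"
proof (rule ssI)
  note d = ssD[OF s]
  fix w assume w: "w \<in> A" "z \<sqsubseteq> w" and c: "\<And>p. cov z p \<Longrightarrow> p \<sqsubseteq> z \<squnion> b \<Longrightarrow> p \<sqsubseteq> w"
  have "b \<sqsubseteq> w"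
  proof (rule ss_le[OF s])
    show "a \<sqsubseteq> w" using trans[of a z w] w z d by auto
    fix p assume p: "cov a p" "p \<sqsubseteq> b"
    show "p \<sqsubseteq> w"
    proof (cases "p \<sqsubseteq> z")
      case True then show ?thesis using trans[of p z w] w z p covD by auto
    next
      case False
      then have "cov z (z \<squnion> p)" using cov_jn p z by auto
      moreover have "z \<squnion> p \<sqsubseteq> z \<squnion> b" using p z d covD(2)[OF p(1)] by (intro jn_mono) auto
      ultimately have "z \<squnion> p \<sqsubseteq> w" using c by blast
      then show ?thesis using jn_le_iff[of z p w] z w p covD by auto
    qed
  qed (use w in auto)
  then show "z \<squnion> b \<sqsubseteq> w" using w d z by (auto simp: jn_le_iff)
qed (use z ssD[OF s] in auto)

lemma ss_upper: "ss a b \<Longrightarrow> z \<in> A \<Longrightarrow> a \<sqsubseteq> z \<Longrightarrow> z \<sqsubseteq> b \<Longrightarrow> ss z b"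
  using ss_jn[of a b z] jn_absorb[of z b] ssD(2)[of a b] by auto

lemma ss_jn2:
  assumes s: "ss a b" "ss a c"
  shows "ss a (b \<squnion> c)"
proof (rule ssI)
  note d = ssD[OF s(1)] ssD[OF s(2)]
  show "a \<sqsubseteq> b \<squnion> c" using d by (auto intro: le_jn1)
  fix z assume z: "z \<in> A" "a \<sqsubseteq> z" and p: "\<And>p. cov a p \<Longrightarrow> p \<sqsubseteq> b \<squnion> c \<Longrightarrow> p \<sqsubseteq> z"
  have "b \<sqsubseteq> z" by (rule ss_le[OF s(1)]) (use z p d in \<open>auto dest: covD(2) intro!: p le_jn1\<close>)
  moreover have "c \<sqsubseteq> z" by (rule ss_le[OF s(2)]) (use z p d in \<open>auto dest: covD(2) intro!: p le_jn2\<close>)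
  ultimately show "b \<squnion> c \<sqsubseteq> z" using d z by (auto simp: jn_le_iff)
qed (use ssD[OF s(1)] ssD[OF s(2)] in auto)

text \<open>A complement is an element y maximal among those meeting x in a: if an atom p were
  missing from \<open>x \<squnion> y\<close>, it could be added to y without enlarging the meet with
  x.\<close>

lemma ss_compl:
  assumes s: "ss a b" and x: "x \<in> A" "a \<sqsubseteq> x" "x \<sqsubseteq> b"
  obtains y where "y \<in> A" "a \<sqsubseteq> y" "y \<sqsubseteq> b" "x \<squnion> y = b" "x \<sqinter> y = a"
proof -
  note d = ssD[OF s]
  let ?S = "{y \<in> A. a \<sqsubseteq> y \<and> y \<sqsubseteq> b \<and> x \<sqinter> y = a}"
  have "a \<in> ?S" using d x by (auto simp: mt_absorb2)
  then obtain y where y: "y \<in> A" "a \<sqsubseteq> y" "y \<sqsubseteq> b" "x \<sqinter> y = a"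
    and m: "\<And>z. z \<in> ?S \<Longrightarrow> y \<sqsubseteq> z \<Longrightarrow> z = y"
    using ex_max[of ?S] by blast
  have "b \<sqsubseteq> x \<squnion> y"
  proof (rule ss_le[OF s])
    show "a \<sqsubseteq> x \<squnion> y" using y x d by (auto intro: le_jn1)
    fix p assume p: "cov a p" "p \<sqsubseteq> b"
    note pd = covD[OF p(1)]
    show "p \<sqsubseteq> x \<squnion> y"
    proof (rule ccontr)
      assume np: "\<not> p \<sqsubseteq> x \<squnion> y"
      have "p \<sqinter> (x \<squnion> y) \<noteq> p" using mt_lb2[OF pd(2) jn_closed[OF x(1) y(1)]] np by metis
      then have "p \<sqinter> (x \<squnion> y) = a"
        using pd(5)[of "p \<sqinter> (x \<squnion> y)"] pd x y \<open>a \<sqsubseteq> x \<squnion> y\<close> by (auto simp: le_mt_iff)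
      then have e: "(y \<squnion> p) \<sqinter> (x \<squnion> y) = y"
        using modular[of y p "x \<squnion> y"] x y pd by (auto simp: jn_absorb2)
      have l: "x \<sqinter> (y \<squnion> p) \<sqsubseteq> y"
        using mt_mono[of x "y \<squnion> p" "x \<squnion> y" "y \<squnion> p"] mt_comm[of "x \<squnion> y" "y \<squnion> p"] e x y pd by auto
      have "x \<sqinter> (y \<squnion> p) \<sqsubseteq> x \<sqinter> y"
        by (rule mt_greatest) (use l x y pd in auto)
      moreover have "a \<sqsubseteq> x \<sqinter> (y \<squnion> p)" using x y pd d by (auto simp: le_mt_iff intro: le_jn1)
      ultimately have "x \<sqinter> (y \<squnion> p) = a"
        using y x pd antisym[of "x \<sqinter> (y \<squnion> p)" a] by auto
      then have "y \<squnion> p = y" using m[of "y \<squnion> p"] y pd p d x by (auto simp: jn_le_iff intro: le_jn1)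
      then have "p \<sqsubseteq> y" using jn_ub2[of y p] y pd by auto
      then show False using np le_jn2[of x y p] x y pd by auto
    qed
  qed (use x y in auto)
  then have "x \<squnion> y = b" using antisym[of "x \<squnion> y" b] d x y by (auto simp: jn_le_iff)
  then show ?thesis using that y by blast
qed

text \<open>A complement y of the socle of x splits x as the socle joined with
  \<open>y \<sqinter> x\<close>. If the second part were larger than a, it would contain an atom,
  which lies in the socle and in its complement at once.\<close>

lemma ss_lower:
  assumes s: "ss a b" and x: "x \<in> A" "a \<sqsubseteq> x" "x \<sqsubseteq> b"
  shows "ss a x"
proof -
  note d = ssD[OF s]
  let ?s = "Soc a x"
  have sx: "?s \<in> A" "a \<sqsubseteq> ?s" "?s \<sqsubseteq> x" using d x Soc_le by auto
  obtain y where y: "y \<in> A" "a \<sqsubseteq> y" "y \<sqsubseteq> b" "?s \<squnion> y = b" "?s \<sqinter> y = a"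
    using ss_compl[OF s sx(1,2)] trans[of ?s x b] sx x d by auto
  have xe: "x = ?s \<squnion> (y \<sqinter> x)"
    using modular[of ?s y x] y sx x d by (auto simp: mt_absorb2)
  have "y \<sqinter> x = a"
  proof (rule ccontr)
    assume "y \<sqinter> x \<noteq> a"
    then obtain q where q: "cov a q" "q \<sqsubseteq> y \<sqinter> x"
      using ex_cov[of a "y \<sqinter> x"] x y d by (auto simp: le_mt_iff)
    have "q \<sqsubseteq> x" "q \<sqsubseteq> y" using q x y by (auto simp: le_mt_iff covD)
    then have "q \<sqsubseteq> ?s \<sqinter> y" using cov_le_Soc[OF q(1), of x] sx(1) y(1) covD(2)[OF q(1)]
      by (simp add: le_mt_iff)
    then show False using y(5) covD[OF q(1)] antisym[of a q] by auto
  qed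
  then have "?s = x" using xe sx d by (auto simp: jn_absorb2)
  then show ?thesis using x d by (auto simp: ss_def)
qed

text \<open>The socle of a subobject is its intersection with the socle of the whole. This is what
  later makes the condition \<open>Soc a x = s\<close> accessible to Weisner's theorem.\<close>

lemma Soc_mt:
  assumes "a \<in> A" "b \<in> A" "x \<in> A" "a \<sqsubseteq> x" "x \<sqsubseteq> b"
  shows "Soc a x = x \<sqinter> Soc a b"
proof (rule antisym)
  have ab: "a \<sqsubseteq> b" using trans[of a x b] assms by auto
  show "Soc a x \<sqsubseteq> x \<sqinter> Soc a b"
    using assms Soc_le[of a x] Soc_mono[of a x b] by (auto simp: le_mt_iff)
  have "ss a (x \<sqinter> Soc a b)"
    using ss_lower[OF ss_Soc[OF assms(1,2) ab], of "x \<sqinter> Soc a b"] assms by (auto simp: le_mt_iff)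
  then show "x \<sqinter> Soc a b \<sqsubseteq> Soc a x"
    using ss_le_Soc[of a "x \<sqinter> Soc a b" x] assms by auto
qed (use assms in auto)

text \<open>Raising the base from a to s keeps \<open>s \<squnion> Soc a b\<close> semisimple over
  s, so it is absorbed by the socle over s.\<close>

lemma Soc_antimono:
  assumes "a \<in> A" "b \<in> A" "s \<in> A" "a \<sqsubseteq> s" "s \<sqsubseteq> b"
  shows "Soc a b \<sqsubseteq> Soc s b"
proof -
  have ab: "a \<sqsubseteq> b" using trans[of a s b] assms by auto
  have "ss s (s \<squnion> Soc a b)" using ss_jn[OF ss_Soc[OF assms(1,2) ab], of s] assms by auto
  moreover have "s \<squnion> Soc a b \<sqsubseteq> b" using assms Soc_le[of a b] ab by (auto simp: jn_le_iff)
  ultimately have "s \<squnion> Soc a b \<sqsubseteq> Soc s b" using ss_le_Soc[of s "s \<squnion> Soc a b" b] assms by auto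
  then show ?thesis using assms by (auto simp: jn_le_iff)
qed

subsection \<open>Loewy length\<close>

text \<open>The layers may be trivial, so the predicate says that the Loewy length of
  \<open>[a, b]\<close> is at most n.\<close>

primrec loewy :: "nat \<Rightarrow> 'a \<Rightarrow> 'a \<Rightarrow> bool" where
  "loewy 0 a b \<longleftrightarrow> a = b"
| "loewy (Suc n) a b \<longleftrightarrow> (\<exists>c \<in> A. ss a c \<and> c \<sqsubseteq> b \<and> loewy n c b)"

lemma loewy_le: "a \<in> A \<Longrightarrow> b \<in> A \<Longrightarrow> loewy n a b \<Longrightarrow> a \<sqsubseteq> b"
proof (induction n arbitrary: a)
  case (Suc n)
  then obtain c where "c \<in> A" "ss a c" "c \<sqsubseteq> b" by auto
  then show ?case using Suc trans[of a c b] by (auto simp: ss_def)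
qed auto

lemma loewy_jn:
  assumes "a \<in> A" "b \<in> A" "z \<in> A" "loewy n a b"
  shows "loewy n (z \<squnion> a) (z \<squnion> b)"
  using assms
proof (induction n arbitrary: a)
  case (Suc n)
  then obtain c where c: "c \<in> A" "ss a c" "c \<sqsubseteq> b" "loewy n c b" by auto
  have "ss (z \<squnion> a) ((z \<squnion> a) \<squnion> c)" using ss_jn[of a c "z \<squnion> a"] c Suc by auto
  moreover have "(z \<squnion> a) \<squnion> c = z \<squnion> c"
    using Suc c by (simp add: jn_assoc jn_absorb ss_def)
  moreover have "loewy n (z \<squnion> c) (z \<squnion> b)" using Suc c by auto
  moreover have "z \<squnion> c \<sqsubseteq> z \<squnion> b" using Suc c by (auto intro: jn_mono)
  ultimately show ?case using c Suc by auto
qed auto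

lemma loewy_upper:
  assumes "a \<in> A" "b \<in> A" "z \<in> A" "loewy n a b" "a \<sqsubseteq> z" "z \<sqsubseteq> b"
  shows "loewy n z b"
  using loewy_jn[OF assms(1-4)] assms by (simp add: jn_absorb jn_absorb2)

lemma loewy_Suc: "a \<in> A \<Longrightarrow> b \<in> A \<Longrightarrow> loewy n a b \<Longrightarrow> loewy (Suc n) a b"
  using ss_refl[of a] loewy_le[of a b n] unfolding loewy.simps by blast

lemma loewy_mono: "a \<in> A \<Longrightarrow> b \<in> A \<Longrightarrow> loewy n a b \<Longrightarrow> n \<le> m \<Longrightarrow> loewy m a b"
  by (induction m) (auto simp: le_Suc_eq simp del: loewy.simps intro: loewy_Suc)

text \<open>The socle series is the fastest one: the first layer c of any chain lies below the
  socle, and raising the base of the remaining chain does not lengthen it.\<close>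

lemma loewy_Soc:
  assumes "a \<in> A" "b \<in> A" "loewy (Suc n) a b"
  shows "loewy n (Soc a b) b"
proof -
  obtain c where c: "c \<in> A" "ss a c" "c \<sqsubseteq> b" "loewy n c b" using assms by auto
  have "a \<sqsubseteq> b" using loewy_le assms by blast
  then show ?thesis
    using loewy_upper[of c b "Soc a b" n] c assms ss_le_Soc[of a c b] Soc_le[of a b] by auto
qed

text \<open>The join of the two first layers is again a layer over a. Both remaining chains are then
  pushed up to start at that join, where the induction hypothesis applies.\<close>

lemma loewy_jn2:
  assumes "a \<in> A" "b \<in> A" "c \<in> A" "loewy n a b" "loewy n a c"
  shows "loewy n a (b \<squnion> c)"
  using assms
proof (induction n arbitrary: a b c)
  case 0
  then show ?case by (auto simp: jn_absorb)
next
  case (Suc n)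
  obtain d where d: "d \<in> A" "ss a d" "d \<sqsubseteq> b" "loewy n d b" using Suc by auto
  obtain e where e: "e \<in> A" "ss a e" "e \<sqsubseteq> c" "loewy n e c" using Suc by auto
  have 1: "loewy n (d \<squnion> e) (e \<squnion> b)" using loewy_jn[of d b e n] d e Suc by (simp add: jn_comm)
  have 2: "loewy n (d \<squnion> e) (d \<squnion> c)" using loewy_jn[of e c d n] d e Suc by (simp add: jn_comm)
  have "loewy n (d \<squnion> e) ((e \<squnion> b) \<squnion> (d \<squnion> c))" using Suc.IH[OF _ _ _ 1 2] d e Suc by auto
  moreover have "(e \<squnion> b) \<squnion> (d \<squnion> c) = b \<squnion> c"
    using d e Suc.prems by (intro antisym) (auto simp: jn_le_iff intro: le_jn1 le_jn2)
  moreover have "ss a (d \<squnion> e)" using ss_jn2 d e by auto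
  ultimately show ?case using d e Suc.prems by (auto intro!: bexI[of _ "d \<squnion> e"] jn_mono)
qed

text \<open>When \<open>d \<sqsubseteq> c \<squnion> x\<close>, joining with c identifies
  \<open>[c \<sqinter> x, d \<sqinter> x]\<close> with \<open>[c, d]\<close>, so atoms of the upper
  interval come from atoms of the lower one.\<close>

lemma ss_mt:
  assumes s: "ss c d" and x: "x \<in> A" "d \<sqsubseteq> c \<squnion> x"
  shows "ss (c \<sqinter> x) (d \<sqinter> x)"
proof (rule ssI)
  note dd = ssD[OF s]
  show "c \<sqinter> x \<sqsubseteq> d \<sqinter> x" using dd x by (auto intro: mt_mono)
  fix z assume z: "z \<in> A" "c \<sqinter> x \<sqsubseteq> z" and p: "\<And>p. cov (c \<sqinter> x) p \<Longrightarrow> p \<sqsubseteq> d \<sqinter> x \<Longrightarrow> p \<sqsubseteq> z"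
  have dx: "d = c \<squnion> (x \<sqinter> d)" using modular[of c x d] mt_absorb2[of "c \<squnion> x" d] x dd by auto
  let ?z = "z \<sqinter> (d \<sqinter> x)"
  have "d \<sqsubseteq> c \<squnion> ?z"
  proof (rule ss_le[OF s])
    fix q assume q: "cov c q" "q \<sqsubseteq> d"
    note qd = covD[OF q(1)]
    have qx: "q \<sqsubseteq> c \<squnion> x" using trans[of q d "c \<squnion> x"] q qd x dd by auto
    have "q \<sqinter> x \<sqsubseteq> z" using q qd x dd by (intro p[OF cov_mt[OF q(1) x(1) qx]] mt_mono) auto
    then have "q \<sqinter> x \<sqsubseteq> ?z" using q qd x dd z by (auto simp: le_mt_iff intro: mt_le1)
    moreover have "q = c \<squnion> (x \<sqinter> q)" using modular[of c x q] mt_absorb2[of "c \<squnion> x" q] x qd qx by auto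
    ultimately show "q \<sqsubseteq> c \<squnion> ?z"
      using jn_mono[of c "x \<sqinter> q" c ?z] qd x dd z mt_comm[of x q] by auto
  qed (use dd x z in auto)
  then have e: "c \<squnion> ?z = d"
    using dd x z by (intro antisym) (auto simp: jn_le_iff intro: mt_le2)
  have "?z \<sqsubseteq> x" using dd x z by (intro mt_le2) auto
  then have "(?z \<squnion> c) \<sqinter> x = ?z \<squnion> (c \<sqinter> x)" using modular[of ?z c x] dd x z by auto
  then have "d \<sqinter> x = ?z \<squnion> (c \<sqinter> x)" using e dd x z by (simp add: jn_comm[of ?z c])
  moreover have "?z \<squnion> (c \<sqinter> x) \<sqsubseteq> z" using dd x z by (auto simp: jn_le_iff)
  ultimately show "d \<sqinter> x \<sqsubseteq> z" by metis
qed (use x ssD[OF s] in auto)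

lemma loewy_mt:
  assumes "c \<in> A" "x \<in> A" "loewy n c (c \<squnion> x)"
  shows "loewy n (c \<sqinter> x) x"
  using assms
proof (induction n arbitrary: c)
  case 0
  then have "x \<sqsubseteq> c" using jn_ub2[of c x] by auto
  then show ?case using 0 by (auto simp: mt_absorb2)
next
  case (Suc n)
  then obtain d where d: "d \<in> A" "ss c d" "d \<sqsubseteq> c \<squnion> x" "loewy n d (c \<squnion> x)" by auto
  have "d \<squnion> x = c \<squnion> x"
    using d Suc.prems ssD(3)[of c d] by (intro antisym) (auto simp: jn_le_iff intro: le_jn1)
  then have "loewy n (d \<sqinter> x) x" using Suc.IH[of d] d Suc.prems by auto
  moreover have "ss (c \<sqinter> x) (d \<sqinter> x)" using ss_mt d Suc.prems by auto
  ultimately show ?case using d Suc.prems by (auto intro!: bexI[of _ "d \<sqinter> x"])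
qed

text \<open>The chain is intersected with x. Its first layer becomes \<open>c \<sqinter> x\<close>;
  the rest is obtained by first enlarging x to \<open>c \<squnion> x\<close> and then transposing
  down.\<close>

lemma loewy_lower:
  assumes "a \<in> A" "b \<in> A" "x \<in> A" "a \<sqsubseteq> x" "x \<sqsubseteq> b" "loewy n a b"
  shows "loewy n a x"
  using assms
proof (induction n arbitrary: a b x)
  case 0
  then show ?case using antisym[of a x] by auto
next
  case (Suc n)
  then obtain c where c: "c \<in> A" "ss a c" "c \<sqsubseteq> b" "loewy n c b" by auto
  have "loewy n c (c \<squnion> x)"
    using Suc.IH[of c b "c \<squnion> x"] c Suc.prems by (auto simp: jn_le_iff)
  then have "loewy n (c \<sqinter> x) x" using loewy_mt c Suc.prems by blast
  moreover have "ss a (c \<sqinter> x)"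
    using ss_lower[OF c(2), of "c \<sqinter> x"] c Suc.prems by (auto simp: le_mt_iff ss_def)
  ultimately show ?case using c Suc.prems by (auto intro!: bexI[of _ "c \<sqinter> x"])
qed

lemma loewy_ex:
  assumes "a \<in> A" "b \<in> A" "a \<sqsubseteq> b"
  shows "\<exists>n. loewy n a b"
  using assms
proof (induction "card {x \<in> A. a \<sqsubseteq> x}" arbitrary: a rule: less_induct)
  case less
  show ?case
  proof (cases "a = b")
    case True
    then have "loewy 0 a b" by simp
    then show ?thesis by blast
  next
    case False
    then obtain p where p: "cov a p" "p \<sqsubseteq> b" using ex_cov less by blast
    note d = covD[OF p(1)]
    have s: "ss a p"
      by (rule ssI) (use d p in auto)
    have "{x \<in> A. p \<sqsubseteq> x} \<subset> {x \<in> A. a \<sqsubseteq> x}"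
    proof -
      have "\<not> p \<sqsubseteq> a" using d antisym[of a p] by blast
      moreover have "a \<sqsubseteq> x" if "x \<in> A" "p \<sqsubseteq> x" for x using trans[of a p x] that d by blast
      moreover have "a \<in> {x \<in> A. a \<sqsubseteq> x}" using d by simp
      ultimately show ?thesis by blast
    qed
    then have "card {x \<in> A. p \<sqsubseteq> x} < card {x \<in> A. a \<sqsubseteq> x}"
      using finite_carrier by (intro psubset_card_mono) auto
    then obtain n where "loewy n p b" using less p d by blast
    then have "loewy (Suc n) a b" using s p d by auto
    then show ?thesis by blast
  qed
qed

end

subsection \<open>Moebius functions\<close>

text \<open>The function is a parameter pinned down by its recursion. Thus an interval carries the
  same m, and the dual lattice carries m with swapped arguments.\<close>

locale mobius_lattice = finite_modular_lattice +
  fixes m :: "'a \<Rightarrow> 'a \<Rightarrow> int"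
  assumes sum_left: "a \<in> A \<Longrightarrow> b \<in> A \<Longrightarrow> a \<sqsubseteq> b \<Longrightarrow>
    (\<Sum>z | z \<in> A \<and> a \<sqsubseteq> z \<and> z \<sqsubseteq> b. m a z) = (if a = b then 1 else 0)"
begin

lemma fin_int [simp, intro]: "finite {z. z \<in> A \<and> P z}"
  using finite_carrier by simp

lemma m_refl [simp]: assumes "a \<in> A" shows "m a a = 1"
proof -
  have "{z. z \<in> A \<and> a \<sqsubseteq> z \<and> z \<sqsubseteq> a} = {a}" using assms antisym by auto
  then show ?thesis using sum_left[of a a] assms by simp
qed

text \<open>In the incidence algebra a one-sided inverse of the zeta function is two-sided. The
  recursion of the Moebius function gives one side; Weisner's theorem in both forms needs
  both.\<close>

lemma sum_right:
  assumes "a \<in> A" "b \<in> A" "a \<sqsubseteq> b"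
  shows "(\<Sum>z | z \<in> A \<and> a \<sqsubseteq> z \<and> z \<sqsubseteq> b. m z b) = (if a = b then 1 else 0)"
  using assms
proof (induction "card {x \<in> A. a \<sqsubseteq> x}" arbitrary: a rule: less_induct)
  case less
  define T where "T x = (\<Sum>z | z \<in> A \<and> x \<sqsubseteq> z \<and> z \<sqsubseteq> b. m z b)" for x
  define D where "D x = (if x = b then 1 else 0 :: int)" for x
  let ?I = "{z. z \<in> A \<and> a \<sqsubseteq> z \<and> z \<sqsubseteq> b}"
  have IH: "T x = D x" if x: "x \<in> ?I" "x \<noteq> a" for x
  proof -
    have "{y \<in> A. x \<sqsubseteq> y} \<subset> {y \<in> A. a \<sqsubseteq> y}"
    proof -
      have "\<not> x \<sqsubseteq> a" using x less antisym[of a x] by blast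
      moreover have "a \<sqsubseteq> y" if "y \<in> A" "x \<sqsubseteq> y" for y using trans[of a x y] that x less by blast
      moreover have "a \<in> {x \<in> A. a \<sqsubseteq> x}" using less by simp
      ultimately show ?thesis by blast
    qed
    then have "card {y \<in> A. x \<sqsubseteq> y} < card {y \<in> A. a \<sqsubseteq> y}" by (intro psubset_card_mono) auto
    then show ?thesis using less x by (auto simp: T_def D_def)
  qed
  \<comment> \<open>This double sum evaluates to \<open>m a b\<close> by the left identity, just as
    with D in place of T. Since T and D already agree away from a, and \<open>m a a = 1\<close>,
    they agree at a.\<close>
  have "(\<Sum>x \<in> ?I. m a x * T x) = (\<Sum>x \<in> ?I. \<Sum>z \<in> {z \<in> ?I. x \<sqsubseteq> z}. m a x * m z b)"
  proof (rule sum.cong)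
    fix x assume x: "x \<in> ?I"
    have "{z. z \<in> A \<and> x \<sqsubseteq> z \<and> z \<sqsubseteq> b} = {z \<in> ?I. x \<sqsubseteq> z}"
      using x less trans[of a x] by auto
    then show "m a x * T x = (\<Sum>z \<in> {z \<in> ?I. x \<sqsubseteq> z}. m a x * m z b)"
      by (simp add: T_def sum_distrib_left)
  qed auto
  also have "\<dots> = (\<Sum>z \<in> ?I. \<Sum>x \<in> {x \<in> ?I. x \<sqsubseteq> z}. m a x * m z b)"
    by (rule sum.swap_restrict) auto
  also have "\<dots> = (\<Sum>z \<in> ?I. (\<Sum>x | x \<in> A \<and> a \<sqsubseteq> x \<and> x \<sqsubseteq> z. m a x) * m z b)"
  proof (rule sum.cong)
    fix z assume z: "z \<in> ?I"
    have "{x. x \<in> A \<and> a \<sqsubseteq> x \<and> x \<sqsubseteq> z} = {x \<in> ?I. x \<sqsubseteq> z}"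
      using z less trans[of _ z b] by auto
    then show "(\<Sum>x \<in> {x \<in> ?I. x \<sqsubseteq> z}. m a x * m z b) = (\<Sum>x | x \<in> A \<and> a \<sqsubseteq> x \<and> x \<sqsubseteq> z. m a x) * m z b"
      by (simp add: sum_distrib_right)
  qed auto
  also have "\<dots> = (\<Sum>z \<in> ?I. if a = z then m a b else 0)"
    by (rule sum.cong) (use less sum_left in auto)
  also have "\<dots> = m a b" using less by (simp add: sum.delta)
  finally have 1: "(\<Sum>x \<in> ?I. m a x * T x) = m a b" .
  have 2: "(\<Sum>x \<in> ?I. m a x * D x) = m a b"
    using less by (simp add: D_def if_distrib[of "\<lambda>t. m a _ * t"] sum.delta cong: if_cong)
  have "0 = (\<Sum>x \<in> ?I. m a x * (T x - D x))"
    using 1 2 by (simp add: right_diff_distrib sum_subtractf)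
  also have "\<dots> = (\<Sum>x \<in> {a}. m a x * (T x - D x))"
    by (rule sum.mono_neutral_right) (use less IH in auto)
  finally show ?case using less by (simp add: T_def D_def)
qed

lemma dual_mobius: "mobius_lattice A (\<lambda>x y. y \<sqsubseteq> x) mt jn tp bt (\<lambda>x y. m y x)"
proof -
  interpret d: finite_modular_lattice A "\<lambda>x y. y \<sqsubseteq> x" mt jn tp bt by (rule dual)
  show ?thesis
  proof unfold_locales
    fix a b assume a: "a \<in> A" "b \<in> A" "b \<sqsubseteq> a"
    have "{z. z \<in> A \<and> z \<sqsubseteq> a \<and> b \<sqsubseteq> z} = {z. z \<in> A \<and> b \<sqsubseteq> z \<and> z \<sqsubseteq> a}" by auto
    then show "(\<Sum>z | z \<in> A \<and> z \<sqsubseteq> a \<and> b \<sqsubseteq> z. m z a) = (if a = b then 1 else 0)"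
      using sum_right[of b a] a by auto
  qed
qed

text \<open>All x in \<open>[a, b]\<close> are grouped by the value y of
  \<open>x \<sqinter> z\<close>. The total is 0, and the groups with y above a vanish by induction,
  being the same sum over a smaller interval.\<close>

lemma weisner_mt:
  assumes "a \<in> A" "b \<in> A" "z \<in> A" "a \<sqsubseteq> z" "z \<sqsubseteq> b" "z \<noteq> b"
  shows "(\<Sum>x | x \<in> A \<and> a \<sqsubseteq> x \<and> x \<sqsubseteq> b \<and> x \<sqinter> z = a. m x b) = 0"
  using assms
proof (induction "card {x \<in> A. a \<sqsubseteq> x}" arbitrary: a rule: less_induct)
  case less
  define N where "N y = (\<Sum>x | x \<in> A \<and> y \<sqsubseteq> x \<and> x \<sqsubseteq> b \<and> x \<sqinter> z = y. m x b)" for y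
  let ?Y = "{y. y \<in> A \<and> a \<sqsubseteq> y \<and> y \<sqsubseteq> z}" and ?I = "{x. x \<in> A \<and> a \<sqsubseteq> x \<and> x \<sqsubseteq> b}"
  have IH: "N x = 0" if x: "x \<in> ?Y" "x \<noteq> a" for x
  proof -
    have "{y \<in> A. x \<sqsubseteq> y} \<subset> {y \<in> A. a \<sqsubseteq> y}"
    proof -
      have "\<not> x \<sqsubseteq> a" using x less antisym[of a x] by blast
      moreover have "a \<sqsubseteq> y" if "y \<in> A" "x \<sqsubseteq> y" for y using trans[of a x y] that x less by blast
      moreover have "a \<in> {x \<in> A. a \<sqsubseteq> x}" using less by simp
      ultimately show ?thesis by blast
    qed
    then have "card {y \<in> A. x \<sqsubseteq> y} < card {y \<in> A. a \<sqsubseteq> y}" by (intro psubset_card_mono) auto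
    then show ?thesis using less x by (auto simp: N_def)
  qed
  have "(\<Sum>y \<in> ?Y. N y) = (\<Sum>y \<in> ?Y. \<Sum>x \<in> {x \<in> ?I. x \<sqinter> z = y}. m x b)"
  proof (rule sum.cong)
    fix y assume y: "y \<in> ?Y"
    have "{x. x \<in> A \<and> y \<sqsubseteq> x \<and> x \<sqsubseteq> b \<and> x \<sqinter> z = y} = {x \<in> ?I. x \<sqinter> z = y}"
      using y less trans[of a y] by auto
    then show "N y = (\<Sum>x \<in> {x \<in> ?I. x \<sqinter> z = y}. m x b)" by (simp add: N_def)
  qed auto
  also have "\<dots> = (\<Sum>x \<in> ?I. m x b)"
    by (rule sum.group) (use less in \<open>auto simp: le_mt_iff\<close>)
  also have "\<dots> = 0"
  proof -
    have "a \<noteq> b" using less antisym[of z b] by auto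
    then show ?thesis using sum_right[of a b] less trans[of a z b] by auto
  qed
  also have "(\<Sum>y \<in> ?Y. N y) = (\<Sum>y \<in> {a}. N y)"
    by (rule sum.mono_neutral_right) (use less IH in auto)
  finally show ?case by (simp add: N_def)
qed

lemma weisner_jn:
  assumes "a \<in> A" "b \<in> A" "z \<in> A" "a \<sqsubseteq> z" "z \<sqsubseteq> b" "z \<noteq> a"
  shows "(\<Sum>x | x \<in> A \<and> a \<sqsubseteq> x \<and> x \<sqsubseteq> b \<and> x \<squnion> z = b. m a x) = 0"
proof -
  have "{x. x \<in> A \<and> a \<sqsubseteq> x \<and> x \<sqsubseteq> b \<and> x \<squnion> z = b} = {x. x \<in> A \<and> x \<sqsubseteq> b \<and> a \<sqsubseteq> x \<and> x \<squnion> z = b}"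
    by auto
  then show ?thesis using mobius_lattice.weisner_mt[OF dual_mobius, of b a z] assms by simp
qed

text \<open>Weisner's theorem is applied to the socle: every x strictly above a contains an atom of
  the interval, so only \<open>x = a\<close> meets the socle in a, and the sum is the single term
  \<open>m a b\<close>.\<close>

lemma not_ss_imp_zero:
  assumes "a \<in> A" "b \<in> A" "a \<sqsubseteq> b" "\<not> ss a b"
  shows "m a b = 0"
proof -
  let ?z = "Soc a b"
  have z: "?z \<in> A" "a \<sqsubseteq> ?z" "?z \<sqsubseteq> b" "?z \<noteq> b" using assms Soc_le by (auto simp: ss_def)
  have "{x. x \<in> A \<and> a \<sqsubseteq> x \<and> x \<sqsubseteq> b \<and> x \<sqinter> ?z = a} = {a}"
  proof -
    have "x = a" if x: "x \<in> A" "a \<sqsubseteq> x" "x \<sqsubseteq> b" "x \<sqinter> ?z = a" for x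
    proof (rule ccontr)
      assume "x \<noteq> a"
      then obtain q where q: "cov a q" "q \<sqsubseteq> x" using ex_cov[of a x] x assms by auto
      note qd = covD[OF q(1)]
      have "q \<sqsubseteq> b" using trans[of q x b] q qd x assms by auto
      then have "q \<sqsubseteq> x \<sqinter> ?z" using cov_le_Soc[OF q(1)] q qd x z by (intro mt_greatest) auto
      then show False using x(4) qd antisym[of a q] by auto
    qed
    then show ?thesis using assms z by (auto simp: mt_absorb)
  qed
  then show ?thesis using weisner_mt[OF assms(1,2) z(1-4)] by simp
qed

end

text \<open>The recursion sees only the interval. The two lattices may differ, which serves both
  transposition inside one lattice and the passage between the quotient lattices of two
  objects.\<close>

lemma mobius_iso:
  assumes "mobius_lattice A1 le1 j1 m1 b1 t1 \<mu>1" "mobius_lattice A2 le2 j2 m2 b2 t2 \<mu>2"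
    and a: "a \<in> A1" "b \<in> A1" "le1 a b"
    and bij: "bij_betw \<phi> {x \<in> A1. le1 a x \<and> le1 x b} {y \<in> A2. le2 (\<phi> a) y \<and> le2 y (\<phi> b)}"
    and emb: "\<And>x y. x \<in> A1 \<Longrightarrow> y \<in> A1 \<Longrightarrow> le1 a x \<Longrightarrow> le1 x b \<Longrightarrow> le1 a y \<Longrightarrow> le1 y b \<Longrightarrow>
      le2 (\<phi> x) (\<phi> y) \<longleftrightarrow> le1 x y"
  shows "\<mu>1 a b = \<mu>2 (\<phi> a) (\<phi> b)"
proof -
  interpret L1: mobius_lattice A1 le1 j1 m1 b1 t1 \<mu>1 by fact
  interpret L2: mobius_lattice A2 le2 j2 m2 b2 t2 \<mu>2 by fact
  let ?I = "{x \<in> A1. le1 a x \<and> le1 x b}"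
  have inA: "\<phi> x \<in> A2" if "x \<in> ?I" for x using bij_betw_apply[OF bij that] by simp
  have inj: "inj_on \<phi> ?I" using bij by (simp add: bij_betw_def)
  have aI: "a \<in> ?I" and bI: "b \<in> ?I" using a by auto
  have "\<mu>1 a x = \<mu>2 (\<phi> a) (\<phi> x)" if "x \<in> ?I" for x
    using that
  proof (induction "card {y \<in> A1. le1 y x}" arbitrary: x rule: less_induct)
    case (less x)
    let ?J = "{z. z \<in> A1 \<and> le1 a z \<and> le1 z x}"
    let ?K = "{z. z \<in> A2 \<and> le2 (\<phi> a) z \<and> le2 z (\<phi> x)}"
    have xA: "x \<in> A1" "le1 a x" "le1 x b" using less by auto
    have JI: "z \<in> ?I" if "z \<in> ?J" for z using that L1.trans[of z x b] xA a by auto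
    have img: "\<phi> ` ?J = ?K"
    proof
      show "\<phi> ` ?J \<subseteq> ?K"
      proof
        fix w assume "w \<in> \<phi> ` ?J"
        then obtain z where z: "z \<in> ?J" "w = \<phi> z" by blast
        show "w \<in> ?K" using z JI[OF z(1)] inA emb[of a z] emb[of z x] xA a by auto
      qed
      show "?K \<subseteq> \<phi> ` ?J"
      proof
        fix w assume w: "w \<in> ?K"
        have "le2 (\<phi> x) (\<phi> b)" using emb[of x b] xA a by auto
        then have "le2 w (\<phi> b)" using L2.trans[of w "\<phi> x" "\<phi> b"] w inA[OF less(2)] inA[OF bI] by auto
        then obtain z where z: "z \<in> ?I" "w = \<phi> z" using bij w unfolding bij_betw_def by blast
        then have "z \<in> ?J" using w emb[of z x] xA a by auto
        then show "w \<in> \<phi> ` ?J" using z by blast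
      qed
    qed
    have injJ: "inj_on \<phi> ?J" by (rule inj_on_subset[OF inj]) (use JI in blast)
    have IH: "\<mu>1 a z = \<mu>2 (\<phi> a) (\<phi> z)" if z: "z \<in> ?J - {x}" for z
    proof -
      have "{y \<in> A1. le1 y z} \<subset> {y \<in> A1. le1 y x}"
      proof -
        have "\<not> le1 x z" using z xA L1.antisym[of x z] by blast
        moreover have "le1 y x" if "y \<in> A1" "le1 y z" for y using L1.trans[of y z x] that z xA by blast
        moreover have "x \<in> {y \<in> A1. le1 y x}" using xA by simp
        ultimately show ?thesis by blast
      qed
      then have "card {y \<in> A1. le1 y z} < card {y \<in> A1. le1 y x}" by (intro psubset_card_mono) auto
      then show ?thesis using less(1) JI z by blast
    qed
    have d: "(a = x) = (\<phi> a = \<phi> x)" using inj_onD[OF inj _ aI less(2)] by auto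
    have xJ: "x \<in> ?J" using xA by simp
    have "(\<Sum>z \<in> ?J. \<mu>1 a z) = (\<Sum>w \<in> ?K. \<mu>2 (\<phi> a) w)"
      using L1.sum_left[of a x] L2.sum_left[of "\<phi> a" "\<phi> x"] xA a inA[OF aI] inA[OF less(2)] d
        emb[of a x] by simp
    also have "\<dots> = (\<Sum>z \<in> ?J. \<mu>2 (\<phi> a) (\<phi> z))"
      unfolding img[symmetric] by (rule sum.reindex_cong[OF injJ]) auto
    finally have "(\<Sum>z \<in> ?J. \<mu>1 a z) = (\<Sum>z \<in> ?J. \<mu>2 (\<phi> a) (\<phi> z))" .
    moreover have "(\<Sum>z \<in> ?J. \<mu>1 a z) = \<mu>1 a x + (\<Sum>z \<in> ?J - {x}. \<mu>1 a z)"
      using xJ by (intro sum.remove) auto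
    moreover have "(\<Sum>z \<in> ?J. \<mu>2 (\<phi> a) (\<phi> z)) = \<mu>2 (\<phi> a) (\<phi> x) + (\<Sum>z \<in> ?J - {x}. \<mu>2 (\<phi> a) (\<phi> z))"
      using xJ by (intro sum.remove) auto
    moreover have "(\<Sum>z \<in> ?J - {x}. \<mu>1 a z) = (\<Sum>z \<in> ?J - {x}. \<mu>2 (\<phi> a) (\<phi> z))"
      by (rule sum.cong) (use IH in auto)
    ultimately show ?case by linarith
  qed
  then show ?thesis using bI by blast
qed

section \<open>Values of the Moebius function along covers\<close>

context mobius_lattice
begin

text \<open>Dedekind's transposition: \<open>x \<mapsto> x \<squnion> c\<close> and
  \<open>y \<mapsto> h \<sqinter> y\<close> are inverse isomorphisms between
  \<open>[h \<sqinter> c, h]\<close> and \<open>[c, h \<squnion> c]\<close>.\<close>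

lemma m_transpose:
  assumes "h \<in> A" "c \<in> A"
  shows "m (h \<sqinter> c) h = m c (h \<squnion> c)"
proof -
  let ?f = "\<lambda>x. x \<squnion> c"
  have e1: "?f (h \<sqinter> c) = c" using assms by (auto simp: jn_absorb)
  have r: "h \<sqinter> (x \<squnion> c) = x" if x: "x \<in> A" "h \<sqinter> c \<sqsubseteq> x" "x \<sqsubseteq> h" for x
  proof -
    have "(x \<squnion> c) \<sqinter> h = x \<squnion> (c \<sqinter> h)" using modular[of x c h] x assms by auto
    then show ?thesis using x assms by (simp add: mt_comm jn_absorb2)
  qed
  have r2: "(h \<sqinter> y) \<squnion> c = y" if y: "y \<in> A" "c \<sqsubseteq> y" "y \<sqsubseteq> h \<squnion> c" for y
  proof -
    have "y \<sqinter> (h \<squnion> c) = (y \<sqinter> h) \<squnion> c" using modular2[of y h c] y assms by auto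
    then show ?thesis using y assms by (simp add: mt_comm mt_absorb)
  qed
  have "m (h \<sqinter> c) h = m (?f (h \<sqinter> c)) (?f h)"
  proof (rule mobius_iso[OF mobius_lattice_axioms mobius_lattice_axioms, where \<phi> = ?f])
    show "bij_betw ?f {x \<in> A. h \<sqinter> c \<sqsubseteq> x \<and> x \<sqsubseteq> h} {y \<in> A. ?f (h \<sqinter> c) \<sqsubseteq> y \<and> y \<sqsubseteq> ?f h}"
      unfolding e1
      by (rule bij_betwI[where g = "\<lambda>y. h \<sqinter> y"])
        (use assms r r2 in \<open>auto intro: jn_mono mt_mono\<close>)
    fix x y assume xy: "x \<in> A" "y \<in> A" "h \<sqinter> c \<sqsubseteq> x" "x \<sqsubseteq> h" "h \<sqinter> c \<sqsubseteq> y" "y \<sqsubseteq> h"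
    show "x \<squnion> c \<sqsubseteq> y \<squnion> c \<longleftrightarrow> x \<sqsubseteq> y"
    proof
      assume "x \<squnion> c \<sqsubseteq> y \<squnion> c"
      then have "h \<sqinter> (x \<squnion> c) \<sqsubseteq> h \<sqinter> (y \<squnion> c)" using assms xy by (intro mt_mono) auto
      then show "x \<sqsubseteq> y" using r xy by simp
    qed (use assms xy in \<open>auto intro: jn_mono\<close>)
  qed (use assms in auto)
  then show ?thesis using e1 by simp
qed

text \<open>If c is an atom of \<open>[x, b]\<close>, these are exactly the complements of c in that
  interval.\<close>

definition avoiding :: "'a \<Rightarrow> 'a \<Rightarrow> 'a \<Rightarrow> 'a set" where
  "avoiding x c b = {h. cov h b \<and> x \<sqsubseteq> h \<and> \<not> c \<sqsubseteq> h}"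

lemma avoiding_sub: "avoiding x c b \<subseteq> A"
  by (auto simp: avoiding_def cov_def)

lemma finite_avoiding: "finite (avoiding x c b)"
  by (rule finite_subset[OF avoiding_sub finite_carrier])

text \<open>Weisner's theorem for the atom c: the elements whose join with c is b are b itself and
  the coatoms avoiding c, and transposition along c gives each of these coatoms the value
  \<open>m c b\<close>.\<close>

lemma m_step:
  assumes c: "cov x c" and b: "b \<in> A" "c \<sqsubseteq> b"
  shows "m x b = - int (card (avoiding x c b)) * m c b"
proof -
  note d = covD[OF c]
  have xb: "x \<sqsubseteq> b" using trans[of x c b] d b by auto
  have S: "{y. y \<in> A \<and> x \<sqsubseteq> y \<and> y \<sqsubseteq> b \<and> y \<squnion> c = b} = insert b (avoiding x c b)"
  proof (intro equalityI subsetI)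
    fix y assume y: "y \<in> {y. y \<in> A \<and> x \<sqsubseteq> y \<and> y \<sqsubseteq> b \<and> y \<squnion> c = b}"
    show "y \<in> insert b (avoiding x c b)"
    proof (cases "c \<sqsubseteq> y")
      case True
      then show ?thesis using y d by (auto simp: jn_absorb2)
    next
      case False
      then have "cov y (y \<squnion> c)" using cov_jn[OF c] y by auto
      then show ?thesis using y False by (auto simp: avoiding_def)
    qed
  next
    fix y assume "y \<in> insert b (avoiding x c b)"
    then consider "y = b" | "y \<in> avoiding x c b" by blast
    then show "y \<in> {y. y \<in> A \<and> x \<sqsubseteq> y \<and> y \<sqsubseteq> b \<and> y \<squnion> c = b}"
    proof cases
      case 1
      then show ?thesis using d b xb by (auto simp: jn_absorb2)
    next
      case 2
      then have y: "cov y b" "x \<sqsubseteq> y" "\<not> c \<sqsubseteq> y" by (auto simp: avoiding_def)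
      note yd = covD[OF y(1)]
      have "y \<squnion> c \<noteq> y" using jn_ub2[OF yd(1) d(2)] y by metis
      then have "y \<squnion> c = b" using yd(5)[of "y \<squnion> c"] yd d b by (auto simp: jn_le_iff)
      then show ?thesis using y yd by auto
    qed
  qed
  have nb: "b \<notin> avoiding x c b" using covD(4) by (auto simp: avoiding_def)
  have h: "m x h = m c b" if "h \<in> avoiding x c b" for h
  proof -
    have y: "cov h b" "x \<sqsubseteq> h" "\<not> c \<sqsubseteq> h" using that by (auto simp: avoiding_def)
    note yd = covD[OF y(1)]
    have "h \<in> {y. y \<in> A \<and> x \<sqsubseteq> y \<and> y \<sqsubseteq> b \<and> y \<squnion> c = b}" unfolding S using that by blast
    then have "h \<squnion> c = b" by blast
    moreover have "h \<sqinter> c = x"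
    proof -
      have "h \<sqinter> c \<noteq> c" using mt_lb1[OF yd(1) d(2)] y by metis
      then show ?thesis using d(5)[of "h \<sqinter> c"] d yd y by (auto simp: le_mt_iff)
    qed
    ultimately show ?thesis using m_transpose[of h c] yd d by simp
  qed
  have "0 = (\<Sum>y \<in> insert b (avoiding x c b). m x y)"
    using weisner_jn[of x b c] d b xb S by auto
  also have "\<dots> = m x b + (\<Sum>y \<in> avoiding x c b. m x y)"
    using nb finite_avoiding by simp
  also have "(\<Sum>y \<in> avoiding x c b. m x y) = int (card (avoiding x c b)) * m c b"
    using h by simp
  finally show ?thesis by simp
qed

definition mobius_mass :: "'a \<Rightarrow> 'a \<Rightarrow> int" where
  "mobius_mass a b = (\<Sum>x | x \<in> A \<and> a \<sqsubseteq> x \<and> x \<sqsubseteq> b. \<bar>m x b\<bar>)"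

text \<open>Elements above c contribute \<open>mobius_mass c b\<close>. For the others
  \<open>m_step\<close> writes \<open>\<bar>m x b\<bar>\<close> as a sum over the coatoms h above x
  that avoid c; exchanging the sums, each such h contributes \<open>mobius_mass c b\<close> once
  more.\<close>

lemma mobius_mass_step:
  assumes c: "cov a c" and b: "b \<in> A" "c \<sqsubseteq> b"
  shows "mobius_mass a b = (1 + int (card (avoiding a c b))) * mobius_mass c b"
proof -
  note d = covD[OF c]
  have ab: "a \<sqsubseteq> b" using trans[of a c b] d b by auto
  let ?Y = "{x. x \<in> A \<and> c \<sqsubseteq> x \<and> x \<sqsubseteq> b}" and ?X = "{x. x \<in> A \<and> a \<sqsubseteq> x \<and> x \<sqsubseteq> b \<and> \<not> c \<sqsubseteq> x}"
  have split: "{x. x \<in> A \<and> a \<sqsubseteq> x \<and> x \<sqsubseteq> b} = ?Y \<union> ?X" using trans[of a c] d by auto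
  have "mobius_mass a b = (\<Sum>x \<in> ?Y. \<bar>m x b\<bar>) + (\<Sum>x \<in> ?X. \<bar>m x b\<bar>)"
    unfolding mobius_mass_def split by (rule sum.union_disjoint) auto
  also have "(\<Sum>x \<in> ?X. \<bar>m x b\<bar>) = (\<Sum>x \<in> ?X. \<Sum>h \<in> {h \<in> avoiding a c b. x \<sqsubseteq> h}. \<bar>m (x \<squnion> c) b\<bar>)"
  proof (rule sum.cong)
    fix x assume x: "x \<in> ?X"
    have cv: "cov x (x \<squnion> c)" using cov_jn[OF c] x by auto
    have "m x b = - int (card (avoiding x (x \<squnion> c) b)) * m (x \<squnion> c) b"
      using m_step[OF cv b(1)] x d b by (auto simp: jn_le_iff)
    moreover have "avoiding x (x \<squnion> c) b = {h \<in> avoiding a c b. x \<sqsubseteq> h}"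
    proof (intro equalityI subsetI)
      fix h assume h: "h \<in> avoiding x (x \<squnion> c) b"
      then have "cov h b" "x \<sqsubseteq> h" "\<not> x \<squnion> c \<sqsubseteq> h" by (auto simp: avoiding_def)
      moreover have "h \<in> A" using \<open>cov h b\<close> covD by blast
      moreover have "a \<sqsubseteq> h" using trans[of a x h] x d calculation by auto
      ultimately show "h \<in> {h \<in> avoiding a c b. x \<sqsubseteq> h}" using x d by (auto simp: avoiding_def jn_le_iff)
    next
      fix h assume h: "h \<in> {h \<in> avoiding a c b. x \<sqsubseteq> h}"
      then have "h \<in> A" using avoiding_sub by auto
      then show "h \<in> avoiding x (x \<squnion> c) b" using h x d by (auto simp: avoiding_def jn_le_iff)
    qed
    ultimately show "\<bar>m x b\<bar> = (\<Sum>h \<in> {h \<in> avoiding a c b. x \<sqsubseteq> h}. \<bar>m (x \<squnion> c) b\<bar>)"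
      by (simp add: abs_mult)
  qed auto
  also have "\<dots> = (\<Sum>h \<in> avoiding a c b. \<Sum>x \<in> {x \<in> ?X. x \<sqsubseteq> h}. \<bar>m (x \<squnion> c) b\<bar>)"
    by (rule sum.swap_restrict) (auto simp: finite_avoiding)
  also have "\<dots> = (\<Sum>h \<in> avoiding a c b. mobius_mass c b)"
  proof (rule sum.cong)
    fix h assume "h \<in> avoiding a c b"
    then have h: "cov h b" "a \<sqsubseteq> h" "\<not> c \<sqsubseteq> h" by (auto simp: avoiding_def)
    note hd = covD[OF h(1)]
    have ch: "c \<sqinter> h = a"
    proof -
      have "c \<sqinter> h \<noteq> c" using mt_lb2[OF d(2) hd(1)] h by metis
      then show ?thesis using d(5)[of "c \<sqinter> h"] d hd h by (auto simp: le_mt_iff)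
    qed
    have hc: "h \<squnion> c = b"
    proof -
      have "h \<squnion> c \<noteq> h" using jn_ub2[OF hd(1) d(2)] h by metis
      then show ?thesis using hd(5)[of "h \<squnion> c"] hd d b by (auto simp: jn_le_iff)
    qed
    \<comment> \<open>Since h is a complement of c over a, this is the transposition of
      \<open>[a, h]\<close> onto \<open>[c, b]\<close>.\<close>
    have "bij_betw (\<lambda>x. x \<squnion> c) {x \<in> ?X. x \<sqsubseteq> h} ?Y"
    proof (rule bij_betwI[where g = "\<lambda>y. h \<sqinter> y"])
      show "(\<lambda>x. x \<squnion> c) \<in> {x \<in> ?X. x \<sqsubseteq> h} \<rightarrow> ?Y" using d b by (auto simp: jn_le_iff)
      show "(\<lambda>y. h \<sqinter> y) \<in> ?Y \<rightarrow> {x \<in> ?X. x \<sqsubseteq> h}"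
      proof
        fix y assume y: "y \<in> ?Y"
        have "a \<sqsubseteq> y" using trans[of a c y] y d by auto
        moreover have "\<not> c \<sqsubseteq> h \<sqinter> y" using h y d hd by (auto simp: le_mt_iff)
        ultimately show "h \<sqinter> y \<in> {x \<in> ?X. x \<sqsubseteq> h}" using y h hd b d by (auto simp: le_mt_iff intro: mt_le2)
      qed
      show "h \<sqinter> (x \<squnion> c) = x" if "x \<in> {x \<in> ?X. x \<sqsubseteq> h}" for x
      proof -
        have "(x \<squnion> c) \<sqinter> h = x \<squnion> (c \<sqinter> h)" using modular[of x c h] that d hd by auto
        then show ?thesis using that ch d hd by (simp add: mt_comm[of h] jn_absorb2)
      qed
      show "(h \<sqinter> y) \<squnion> c = y" if "y \<in> ?Y" for y
      proof -
        have "y \<sqinter> (h \<squnion> c) = (y \<sqinter> h) \<squnion> c" using modular2[of y h c] that d hd by auto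
        then show ?thesis using that hc d hd by (simp add: mt_comm[of h] mt_absorb)
      qed
    qed
    then show "(\<Sum>x \<in> {x \<in> ?X. x \<sqsubseteq> h}. \<bar>m (x \<squnion> c) b\<bar>) = mobius_mass c b"
      unfolding mobius_mass_def by (rule sum.reindex_bij_betw)
  qed auto
  finally show ?thesis by (simp add: mobius_mass_def algebra_simps)
qed

end

subsection \<open>Atoms of a complemented modular lattice\<close>

text \<open>Atoms are the points and joins of two atoms the lines of a projective geometry. The
  results will be used upside down, with coatoms of an interval as points.\<close>

locale atomic_modular_lattice = finite_modular_lattice +
  assumes atomic: "ss bt tp"
begin

definition At :: "'a set" where
  "At = {p. cov bt p}"

lemma AtD: "p \<in> At \<Longrightarrow> p \<in> A" "p \<in> At \<Longrightarrow> p \<noteq> bt"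
  by (auto simp: At_def cov_def)

lemma At_sub: "At \<subseteq> A"
  using AtD by blast

lemma finite_At: "finite At"
  by (rule finite_subset[OF At_sub finite_carrier])

lemma At_le: "p \<in> At \<Longrightarrow> x \<in> A \<Longrightarrow> x \<sqsubseteq> p \<Longrightarrow> x = bt \<or> x = p"
  by (auto simp: At_def cov_def)

lemma At_eq: "p \<in> At \<Longrightarrow> q \<in> At \<Longrightarrow> p \<sqsubseteq> q \<Longrightarrow> p = q"
  using At_le[of q p] AtD by blast

lemma At_cov: "p \<in> At \<Longrightarrow> x \<in> A \<Longrightarrow> \<not> p \<sqsubseteq> x \<Longrightarrow> cov x (x \<squnion> p)"
  using cov_jn[of bt p x] by (auto simp: At_def)

lemma At_jn: 
  assumes "p \<in> At" "x \<in> A" "y \<in> A" "\<not> y \<sqsubseteq> x" "x \<sqsubseteq> y" "y \<sqsubseteq> x \<squnion> p"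
  shows "y = x \<squnion> p"
proof (cases "p \<sqsubseteq> x")
  case True
  then show ?thesis using assms AtD by (metis jn_absorb2)
next
  case False
  then show ?thesis using covD(5)[OF At_cov[OF assms(1,2)]] assms by (metis le_refl)
qed

lemma le_iff_At:
  assumes "x \<in> A" "z \<in> A"
  shows "x \<sqsubseteq> z \<longleftrightarrow> (\<forall>p \<in> At. p \<sqsubseteq> x \<longrightarrow> p \<sqsubseteq> z)"
proof
  assume "\<forall>p \<in> At. p \<sqsubseteq> x \<longrightarrow> p \<sqsubseteq> z"
  moreover have "ss bt x" using ss_lower[OF atomic] assms by auto
  ultimately show "x \<sqsubseteq> z" using ss_le[of bt x z] assms by (auto simp: At_def)
qed (use assms trans AtD in blast)

lemma exchange:
  assumes "p \<in> At" "q \<in> At" "x \<in> A" "p \<sqsubseteq> x \<squnion> q" "\<not> p \<sqsubseteq> x"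
  shows "q \<sqsubseteq> x \<squnion> p"
proof -
  have A: "p \<in> A" "q \<in> A" using assms AtD by auto
  have "x \<squnion> p = x \<squnion> q"
    using At_jn[of q x "x \<squnion> p"] assms A by (auto simp: jn_le_iff)
  then show ?thesis using A assms by simp
qed

text \<open>The projective law: a point of the join of two subspaces that lies in neither is on a
  line joining a point of one to a point of the other.\<close>

lemma projective:
  assumes p: "p \<in> At" and x: "x \<in> A" and y: "y \<in> A"
    and px: "\<not> p \<sqsubseteq> x" and py: "\<not> p \<sqsubseteq> y" and pxy: "p \<sqsubseteq> x \<squnion> y"
  obtains q r where "q \<in> At" "r \<in> At" "q \<sqsubseteq> x" "r \<sqsubseteq> y" "p \<sqsubseteq> q \<squnion> r"
proof -
  have pA: "p \<in> A" using p AtD by auto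
  \<comment> \<open>The projection of p into y from x: by modularity
    \<open>x \<squnion> r0 = x \<squnion> p\<close>. Hence it contains an atom outside x, which
    becomes r.\<close>
  define r0 where "r0 = y \<sqinter> (x \<squnion> p)"
  have r0: "r0 \<in> A" using x y pA by (auto simp: r0_def)
  have xr0: "x \<squnion> r0 = x \<squnion> p"
  proof -
    have "(x \<squnion> y) \<sqinter> (x \<squnion> p) = x \<squnion> (y \<sqinter> (x \<squnion> p))" using modular[of x y "x \<squnion> p"] x y pA by auto
    then show ?thesis using x y pA pxy by (simp add: r0_def mt_absorb2 jn_le_iff)
  qed
  have "\<not> r0 \<sqsubseteq> x"
  proof
    assume "r0 \<sqsubseteq> x"
    then have "x = x \<squnion> p" using xr0 x r0 by (simp add: jn_absorb2)
    then show False using px jn_ub2[OF x pA] by metis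
  qed
  then obtain r where r: "r \<in> At" "r \<sqsubseteq> r0" "\<not> r \<sqsubseteq> x" using le_iff_At[of r0 x] r0 x by auto
  have rA: "r \<in> A" using r AtD by auto
  have ry: "r \<sqsubseteq> y" and rxp: "r \<sqsubseteq> x \<squnion> p" using r rA x y pA by (auto simp: r0_def le_mt_iff)
  have pr: "p \<noteq> r" using py ry by auto
  have xr: "p \<sqsubseteq> x \<squnion> r" using exchange[OF r(1) p x rxp r(3)] .
  \<comment> \<open>Now the line through p and r is intersected with x; modularity makes the
    intersection nontrivial and supplies q.\<close>
  define q0 where "q0 = x \<sqinter> (p \<squnion> r)"
  have q0: "q0 \<in> A" using x pA rA by (auto simp: q0_def)
  have q0r: "p \<sqsubseteq> q0 \<squnion> r"
  proof -
    have "(p \<squnion> r) \<sqinter> (x \<squnion> r) = ((p \<squnion> r) \<sqinter> x) \<squnion> r" using modular2[of "p \<squnion> r" x r] x rA pA by auto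
    moreover have "p \<sqsubseteq> (p \<squnion> r) \<sqinter> (x \<squnion> r)" using xr x rA pA by (auto simp: le_mt_iff)
    ultimately show ?thesis using x rA pA by (simp add: q0_def mt_comm)
  qed
  have "\<not> q0 \<sqsubseteq> bt"
  proof
    assume "q0 \<sqsubseteq> bt"
    then have "q0 \<squnion> r = r" using q0 rA trans[of q0 bt r] by (intro jn_absorb) auto
    then show False using q0r At_eq[OF p r(1)] pr by simp
  qed
  then obtain q where q: "q \<in> At" "q \<sqsubseteq> q0" using le_iff_At[of q0 bt] q0 by auto
  have qA: "q \<in> A" using q AtD by auto
  have qx: "q \<sqsubseteq> x" and qpr: "q \<sqsubseteq> r \<squnion> p" using q qA x pA rA by (auto simp: q0_def le_mt_iff jn_comm)
  have "\<not> q \<sqsubseteq> r" using At_eq[OF q(1) r(1)] qx r(3) by auto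
  then have "p \<sqsubseteq> r \<squnion> q" using exchange[OF q(1) p rA qpr] by simp
  then show ?thesis using that q(1) r(1) qx ry qA rA by (simp add: jn_comm)
qed

text \<open>Two points are related when their line carries a third point. The classes of this
  relation are the irreducible components of the geometry.\<close>

definition perspective :: "'a \<Rightarrow> 'a \<Rightarrow> bool" where
  "perspective p q \<longleftrightarrow> p \<in> At \<and> q \<in> At \<and> (p = q \<or> (\<exists>r \<in> At. r \<noteq> p \<and> r \<noteq> q \<and> r \<sqsubseteq> p \<squnion> q))"

lemma perspective_refl: "p \<in> At \<Longrightarrow> perspective p p"
  by (simp add: perspective_def)

lemma perspective_sym: "perspective p q \<Longrightarrow> perspective q p"
  unfolding perspective_def using AtD jn_comm by metis

lemma perspectiveI: "p \<in> At \<Longrightarrow> q \<in> At \<Longrightarrow> r \<in> At \<Longrightarrow> r \<noteq> p \<Longrightarrow> r \<noteq> q \<Longrightarrow> r \<sqsubseteq> p \<squnion> q \<Longrightarrow> perspective p q"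
  by (auto simp: perspective_def)

lemma exch: "p \<in> At \<Longrightarrow> q \<in> At \<Longrightarrow> r \<in> At \<Longrightarrow> p \<sqsubseteq> q \<squnion> r \<Longrightarrow> p \<noteq> q \<Longrightarrow> r \<sqsubseteq> q \<squnion> p"
  using exchange[of p r q] At_eq[of p q] AtD by blast

lemma collinear_perspective:
  assumes "p \<in> At" "q \<in> At" "r \<in> At" "p \<sqsubseteq> q \<squnion> r" "p \<noteq> q" "p \<noteq> r" "q \<noteq> r"
  shows "perspective p q" "perspective p r" "perspective q r"
proof -
  have A: "p \<in> A" "q \<in> A" "r \<in> A" using assms AtD by auto
  have 1: "r \<sqsubseteq> q \<squnion> p" using exch assms by auto
  have 2: "q \<sqsubseteq> r \<squnion> p" using exch[of p r q] assms A by (auto simp: jn_comm)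
  show "perspective p q" using perspectiveI[of p q r] assms 1 A by (auto simp: jn_comm)
  show "perspective p r" using perspectiveI[of p r q] assms 2 A by (auto simp: jn_comm)
  show "perspective q r" using perspectiveI[of q r p] assms by auto
qed

text \<open>A plane argument: given third points s on pq and t on qr, the projective law finds a
  third point on pr as the intersection of that line with st.\<close>

lemma perspective_trans:
  assumes "perspective p q" "perspective q r" shows "perspective p r"
proof (cases "p = q \<or> q = r \<or> p = r")
  case True
  then show ?thesis using assms by (auto simp: perspective_def)
next
  case False
  then obtain s t where At: "p \<in> At" "q \<in> At" "r \<in> At" "s \<in> At" "t \<in> At"
    and s: "s \<noteq> p" "s \<noteq> q" "s \<sqsubseteq> p \<squnion> q" and t: "t \<noteq> q" "t \<noteq> r" "t \<sqsubseteq> q \<squnion> r"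
    using assms unfolding perspective_def by blast
  have A: "p \<in> A" "q \<in> A" "r \<in> A" "s \<in> A" "t \<in> A" using At AtD by auto
  have qps: "q \<sqsubseteq> p \<squnion> s" using exch[of s p q] At s by auto
  have rqt: "r \<sqsubseteq> q \<squnion> t" using exch[of t q r] At t by auto
  \<comment> \<open>q lies on the line ps and r on the line qt, so r is in the plane spanned by p, s
    and t.\<close>
  have 1: "r \<sqsubseteq> p \<squnion> (s \<squnion> t)"
  proof -
    have "q \<squnion> t \<sqsubseteq> (p \<squnion> s) \<squnion> t" using qps A by (intro jn_mono) auto
    then have "r \<sqsubseteq> (p \<squnion> s) \<squnion> t" using trans[OF _ _ _ rqt, of "(p \<squnion> s) \<squnion> t"] A by auto
    then show ?thesis using A by (simp add: jn_assoc)
  qed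
  show ?thesis
  proof (cases "r \<sqsubseteq> s \<squnion> t")
    case True
    \<comment> \<open>In this degenerate position s lies on qr, hence so does p, and q itself is a
      third point on the line pr.\<close>
    have "s \<sqsubseteq> t \<squnion> r" using exch[of r t s] True At t A by (auto simp: jn_comm)
    moreover have "t \<squnion> r \<sqsubseteq> q \<squnion> r" using A t by (auto simp: jn_le_iff)
    ultimately have sqr: "s \<sqsubseteq> q \<squnion> r" using trans[of s "t \<squnion> r" "q \<squnion> r"] A by auto
    have "p \<sqsubseteq> q \<squnion> s" using exch[of s q p] s At A by (auto simp: jn_comm)
    moreover have "q \<squnion> s \<sqsubseteq> q \<squnion> r" using A sqr by (auto simp: jn_le_iff)
    ultimately have "p \<sqsubseteq> q \<squnion> r" using trans[of p "q \<squnion> s" "q \<squnion> r"] A by auto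
    then show ?thesis using collinear_perspective[of p q r] At False by auto
  next
    case nst: False
    have "\<not> r \<sqsubseteq> p" using At_eq False At by blast
    then obtain p' u where u: "p' \<in> At" "u \<in> At" "p' \<sqsubseteq> p" "u \<sqsubseteq> s \<squnion> t" "r \<sqsubseteq> p' \<squnion> u"
      using projective[of r p "s \<squnion> t"] 1 nst At A by blast
    have p': "p' = p" using At_eq u At by blast
    have uA: "u \<in> A" using u AtD by auto
    have ur: "u \<noteq> r" using nst u by auto
    have "u \<noteq> p"
    proof
      assume "u = p"
      then have "r \<sqsubseteq> p" using u(5) p' A by (simp add: jn_absorb)
      then show False using \<open>\<not> r \<sqsubseteq> p\<close> by simp
    qed
    then show ?thesis using collinear_perspective[of r p u] At u p' ur False by (auto intro: perspective_sym)
  qed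
qed

section \<open>Components and distributive elements\<close>

definition closed_set :: "'a set \<Rightarrow> bool" where
  "closed_set J \<longleftrightarrow> J \<subseteq> At \<and> (\<forall>p q. p \<in> J \<longrightarrow> perspective p q \<longrightarrow> q \<in> J)"

text \<open>A point in the span of J lies on a line through a point j of J and a point of a smaller
  span. If it is neither of them, it is perspective to j and so belongs to J.\<close>

lemma At_le_Jn:
  assumes J: "closed_set J" and p: "p \<in> At" "p \<sqsubseteq> Jn J"
  shows "p \<in> J"
proof -
  have "finite J" using J finite_At finite_subset by (auto simp: closed_set_def)
  \<comment> \<open>The induction runs over arbitrary subsets of J, because closedness is lost when
    a point is removed.\<close>
  have "p \<in> At \<Longrightarrow> p \<sqsubseteq> Jn J' \<Longrightarrow> p \<in> J" if "finite J'" "J' \<subseteq> J" for J' p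
    using that
  proof (induction J' arbitrary: p)
    case empty
    then have "p \<sqsubseteq> bt" by (simp add: Jn_empty)
    then show ?case using empty AtD antisym[of p bt] by auto
  next
    case (insert j J')
    have jA: "j \<in> At" "j \<in> A" "J' \<subseteq> A" using insert J AtD by (auto simp: closed_set_def)
    have pA: "p \<in> A" using insert AtD by auto
    have l: "p \<sqsubseteq> j \<squnion> Jn J'" using insert Jn_insert jA by auto
    show ?case
    proof (cases "p = j \<or> p \<sqsubseteq> Jn J'")
      case True
      then show ?thesis using insert by auto
    next
      case False
      then have "\<not> p \<sqsubseteq> j" using At_eq insert jA by blast
      then obtain q r where qr: "q \<in> At" "r \<in> At" "q \<sqsubseteq> j" "r \<sqsubseteq> Jn J'" "p \<sqsubseteq> q \<squnion> r"
        using projective[of p j "Jn J'"] insert l False jA by blast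
      have q: "q = j" using At_eq qr jA by blast
      have "p \<noteq> r" using False qr by auto
      moreover have "j \<noteq> r"
      proof
        assume "j = r"
        then have "p \<sqsubseteq> j" using qr q jA by (simp add: jn_absorb)
        then show False using \<open>\<not> p \<sqsubseteq> j\<close> by simp
      qed
      ultimately have "perspective p j" using collinear_perspective[of p j r] insert qr q jA False by auto
      then have "perspective j p" by (rule perspective_sym)
      then show ?thesis using J insert by (auto simp: closed_set_def)
    qed
  qed
  then show ?thesis using p \<open>finite J\<close> by blast
qed

text \<open>In the dual lattice this becomes the condition counted by
  \<open>Z_count\<close>.\<close>

definition neutral :: "'a \<Rightarrow> bool" where
  "neutral h \<longleftrightarrow> h \<in> A \<and> (\<forall>k1 \<in> A. \<forall>k2 \<in> A. h \<sqinter> (k1 \<squnion> k2) = (h \<sqinter> k1) \<squnion> (h \<sqinter> k2))"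

text \<open>A point below \<open>Jn J\<close> and \<open>k1 \<squnion> k2\<close> but below neither
  k lies on a line joining points q of k1 and r of k2. Both are perspective to it, so they also lie
  in J and hence below \<open>Jn J\<close>.\<close>

lemma neutral_Jn:
  assumes J: "closed_set J"
  shows "neutral (Jn J)"
  unfolding neutral_def
proof (intro conjI ballI)
  have JA: "J \<subseteq> A" using J At_sub by (auto simp: closed_set_def)
  let ?h = "Jn J"
  show hA: "?h \<in> A" using JA by auto
  fix k1 k2 assume k: "k1 \<in> A" "k2 \<in> A"
  show "?h \<sqinter> (k1 \<squnion> k2) = (?h \<sqinter> k1) \<squnion> (?h \<sqinter> k2)"
  proof (rule antisym)
    show "(?h \<sqinter> k1) \<squnion> (?h \<sqinter> k2) \<sqsubseteq> ?h \<sqinter> (k1 \<squnion> k2)"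
      using hA k by (auto simp: jn_le_iff intro!: mt_mono)
    have "p \<sqsubseteq> (?h \<sqinter> k1) \<squnion> (?h \<sqinter> k2)" if p: "p \<in> At" "p \<sqsubseteq> ?h \<sqinter> (k1 \<squnion> k2)" for p
    proof -
      have pA: "p \<in> A" using p AtD by auto
      have ph: "p \<sqsubseteq> ?h" and pk: "p \<sqsubseteq> k1 \<squnion> k2" using p pA hA k by (auto simp: le_mt_iff)
      have pJ: "p \<in> J" using At_le_Jn J p ph by auto
      consider "p \<sqsubseteq> k1" | "p \<sqsubseteq> k2" | "\<not> p \<sqsubseteq> k1" "\<not> p \<sqsubseteq> k2" by blast
      then show ?thesis
      proof cases
        case 1
        then have "p \<sqsubseteq> ?h \<sqinter> k1" using ph pA hA k by (auto simp: le_mt_iff)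
        then show ?thesis using pA hA k by (intro le_jn1) auto
      next
        case 2
        then have "p \<sqsubseteq> ?h \<sqinter> k2" using ph pA hA k by (auto simp: le_mt_iff)
        then show ?thesis using pA hA k by (intro le_jn2) auto
      next
        case 3
        then obtain q r where qr: "q \<in> At" "r \<in> At" "q \<sqsubseteq> k1" "r \<sqsubseteq> k2" "p \<sqsubseteq> q \<squnion> r"
          using projective[of p k1 k2] p pk k by blast
        have qrA: "q \<in> A" "r \<in> A" using qr AtD by auto
        have "p \<noteq> q" "p \<noteq> r" using 3 qr by auto
        moreover have "q \<noteq> r"
        proof
          assume "q = r"
          then have "p \<sqsubseteq> q" using qr qrA by (simp add: jn_absorb)
          then show False using At_eq p qr \<open>p \<noteq> q\<close> by blast
        qed
        ultimately have "perspective p q" "perspective p r" using collinear_perspective[of p q r] p qr by auto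
        then have "q \<in> J" "r \<in> J" using J pJ by (auto simp: closed_set_def)
        then have "q \<sqsubseteq> ?h" "r \<sqsubseteq> ?h" using JA Jn_upper by auto
        then have "q \<sqsubseteq> ?h \<sqinter> k1" "r \<sqsubseteq> ?h \<sqinter> k2" using qr qrA hA k by (auto simp: le_mt_iff)
        then have "q \<squnion> r \<sqsubseteq> (?h \<sqinter> k1) \<squnion> (?h \<sqinter> k2)" using qrA hA k by (intro jn_mono) auto
        then show ?thesis using trans[OF _ _ _ qr(5)] pA qrA hA k by auto
      qed
    qed
    then show "?h \<sqinter> (k1 \<squnion> k2) \<sqsubseteq> (?h \<sqinter> k1) \<squnion> (?h \<sqinter> k2)"
      using le_iff_At[of "?h \<sqinter> (k1 \<squnion> k2)"] hA k by auto
  qed (use hA k in auto)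
qed

definition components :: "'a set set" where
  "components = At // {(p, q). perspective p q}"

lemma equiv_perspective: "equiv At {(p, q). perspective p q}"
  by (rule equivI)
    (auto simp: refl_on_def sym_def trans_def perspective_refl intro: perspective_sym perspective_trans, auto simp: perspective_def)

lemma finite_components: "finite components"
  unfolding components_def by (rule finite_quotient[OF finite_At]) (auto simp: perspective_def)

lemma closed_components: "I \<subseteq> components \<Longrightarrow> closed_set (\<Union>I)"
  unfolding closed_set_def components_def
  using in_quotient_imp_subset[OF equiv_perspective] in_quotient_imp_closed[OF equiv_perspective] by fast

lemma Union_components: "\<Union>components = At"
  unfolding components_def by (rule Union_quotient[OF equiv_perspective])

text \<open>Each union of components is recovered from its join as the set of points below it, so
  different sets of components give different distributive elements.\<close>

lemma components_neutral: "2 ^ card components \<le> card {h. neutral h}"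
proof -
  have At: "{p \<in> At. p \<sqsubseteq> Jn (\<Union>I)} = \<Union>I" if I: "I \<subseteq> components" for I
  proof -
    have sub: "\<Union>I \<subseteq> At" using closed_components[OF I] by (simp add: closed_set_def)
    then have "\<Union>I \<subseteq> A" using At_sub by (rule subset_trans)
    then have "p \<sqsubseteq> Jn (\<Union>I)" if "p \<in> \<Union>I" for p using Jn_upper that by blast
    then show ?thesis using At_le_Jn[OF closed_components[OF I]] sub by blast
  qed
  have inj: "inj_on (\<lambda>I. Jn (\<Union>I)) (Pow components)"
  proof (rule inj_onI)
    fix I I' assume I0: "I \<in> Pow components" "I' \<in> Pow components" and J: "Jn (\<Union>I) = Jn (\<Union>I')"
    then have I: "I \<subseteq> components" "I' \<subseteq> components" by (simp_all only: Pow_iff)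
    have "{p \<in> At. p \<sqsubseteq> Jn (\<Union>I)} = {p \<in> At. p \<sqsubseteq> Jn (\<Union>I')}" by (simp only: J)
    then have e: "\<Union>I = \<Union>I'" by (simp only: At[OF I(1)] At[OF I(2)])
    have sub: "I1 \<subseteq> I2" if U: "\<Union>I1 = \<Union>I2" and "I1 \<subseteq> components" "I2 \<subseteq> components" for I1 I2
    proof
      fix K assume KI: "K \<in> I1"
      then have K: "K \<in> At // {(p, q). perspective p q}" using that by (auto simp: components_def)
      then obtain p where p: "p \<in> K" using in_quotient_imp_non_empty[OF equiv_perspective] by fastforce
      then have "p \<in> \<Union>I2" using KI unfolding U[symmetric] by (rule UnionI[rotated])
      then obtain K' where K': "K' \<in> I2" "p \<in> K'" by (elim UnionE)
      then have "K' \<in> At // {(p, q). perspective p q}" using that by (auto simp: components_def)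
      then have "K = K'" using quotient_disj[OF equiv_perspective K, of K'] p K' by blast
      then show "K \<in> I2" using \<open>K' \<in> I2\<close> by simp
    qed
    show "I = I'" by (rule equalityI) (rule sub, (rule e e[symmetric] I)+)+
  qed
  have "2 ^ card components = card ((\<lambda>I. Jn (\<Union>I)) ` Pow components)"
    using card_image[OF inj] card_Pow[OF finite_components] by simp
  also have "\<dots> \<le> card {h. neutral h}"
  proof (rule card_mono)
    show "finite {h. neutral h}" by (rule finite_subset[OF _ finite_carrier]) (auto simp: neutral_def)
  qed (auto intro: neutral_Jn closed_components)
  finally show ?thesis .
qed

text \<open>The invariant for a single component: k of its points have been reached and r is the
  product of the factors \<open>1 + 1 / N\<close> so far. The three cases are the start, the first
  point (factor at most 2) and the regime in which the number of points keeps doubling; there r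
  stays below 8.\<close>

definition growth :: "nat \<Rightarrow> real \<Rightarrow> bool" where
  "growth k r \<longleftrightarrow> r \<le> 1 \<or> (k \<ge> 1 \<and> r \<le> 2) \<or> (k \<ge> 3 \<and> r \<le> 8 * (1 - 2 / (real k + 1)))"

lemma growth_le: "growth k r \<Longrightarrow> r \<le> 8"
proof -
  have "8 * (1 - 2 / (real k + 1)) \<le> 8 * (1 - 0)" by (intro mult_left_mono diff_left_mono) auto
  then have "8 * (1 - 2 / (real k + 1)) \<le> 8" by simp
  moreover assume "growth k r"
  ultimately show "r \<le> 8" unfolding growth_def by linarith
qed

lemma growth_step:
  assumes g: "growth k r" and N: "N \<ge> 1 + k" and k': "k' \<ge> 2 * k + 1" and r: "r \<ge> 0"
  shows "growth k' (r * (1 + 1 / real N))"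
proof -
  have N0: "real N \<ge> 1 + real k" using N by linarith
  have le: "r * (1 + 1 / real N) \<le> r * (1 + 1 / (1 + real k))"
    using N0 r by (intro mult_left_mono add_left_mono divide_left_mono) auto
  consider "r \<le> 1" | "k \<ge> 1" "r \<le> 2" | "k \<ge> 3" "r \<le> 8 * (1 - 2 / (real k + 1))"
    using g by (auto simp: growth_def)
  then show ?thesis
  proof cases
    case 1
    have "r * (1 + 1 / (1 + real k)) \<le> 1 * 2" using 1 r by (intro mult_mono) auto
    then show ?thesis using le k' by (auto simp: growth_def)
  next
    case 2
    have "1 / (1 + real k) \<le> 1 / 2" using 2 by (intro divide_left_mono) auto
    \<comment> \<open>The second factor is at most 3/2, so the product is at most 3, below the value
      4 = 8 * (1 - 2 / 4) where the third regime starts.\<close>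
    then have "r * (1 + 1 / (1 + real k)) \<le> 2 * (3 / 2)" using 2 r by (intro mult_mono) auto
    then have "r * (1 + 1 / real N) \<le> 3" using le by linarith
    moreover have "2 / (real k' + 1) \<le> 2 / 4" using 2 k' by (intro divide_left_mono) auto
    then have "8 * (1 - 2 / 4) \<le> 8 * (1 - 2 / (real k' + 1))" by (intro mult_left_mono diff_left_mono) auto
    then have "8 * (1 - 2 / (real k' + 1)) \<ge> 4" by simp
    moreover have "k' \<ge> 3" using k' 2 by linarith
    ultimately show ?thesis unfolding growth_def by linarith
  next
    case 3
    let ?y = "1 / (1 + real k)"
    \<comment> \<open>With y = 1 / (k + 1) the bound before the step is 8 * (1 - 2y). Multiplying by
      1 + y leaves at most 8 * (1 - y), and \<open>k' + 1 \<ge> 2 * (k + 1)\<close> turns y back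
      into a bound of the shape \<open>2 / (k' + 1)\<close>.\<close>
    have "r * (1 + ?y) \<le> (8 * (1 - 2 * ?y)) * (1 + ?y)"
      using 3 by (intro mult_right_mono) (auto simp: add.commute)
    also have "\<dots> = 8 * (1 - ?y - 2 * ?y^2)"
    proof -
      have "(8 * (1 - 2 * y)) * (1 + y) = 8 * (1 - y - 2 * y^2)" for y :: real
        by (simp add: algebra_simps power2_eq_square)
      then show ?thesis .
    qed
    also have "\<dots> \<le> 8 * (1 - ?y)" by simp
    also have "?y \<ge> 2 / (real k' + 1)"
    proof -
      have "real k' + 1 \<ge> 2 * (1 + real k)" using of_nat_mono[OF k', where 'a = real] by simp
      then have "2 / (real k' + 1) \<le> 2 / (2 * (1 + real k))" by (intro divide_left_mono) auto
      also have "2 / (2 * (1 + real k)) = ?y"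
      proof -
        have "2 / (2 * t) = 1 / t" for t :: real by simp
        then show ?thesis .
      qed
      finally show ?thesis .
    qed
    then have "8 * (1 - ?y) \<le> 8 * (1 - 2 / (real k' + 1))" by simp
    finally have "r * (1 + ?y) \<le> 8 * (1 - 2 / (real k' + 1))" .
    then have "r * (1 + 1 / real N) \<le> 8 * (1 - 2 / (real k' + 1))" using le by linarith
    moreover have "k' \<ge> 3" using k' 3 by linarith
    ultimately show ?thesis by (auto simp: growth_def)
  qed
qed

definition new_atoms :: "'a \<Rightarrow> 'a \<Rightarrow> 'a set" where
  "new_atoms y x = {q \<in> At. q \<sqsubseteq> x \<and> \<not> q \<sqsubseteq> y}"

lemma finite_new_atoms [simp]: "finite (new_atoms y x)"
  using finite_At by (simp add: new_atoms_def)

text \<open>Each point of the component of \<open>p\<close> in \<open>x\<close> yields a third point on its line through \<open>p\<close>.\<close>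

lemma card_new_atoms:
  assumes x: "x \<in> A" and p: "p \<in> At" "\<not> p \<sqsubseteq> x"
    and K: "\<And>q. q \<in> K \<Longrightarrow> perspective p q" "\<And>q. perspective p q \<Longrightarrow> q \<in> K"
  shows "card (new_atoms x (x \<squnion> p) \<inter> K) \<ge> 1 + card {q \<in> K. q \<sqsubseteq> x}"
proof -
  have pA: "p \<in> A" using p AtD by auto
  let ?k = "{q \<in> K. q \<sqsubseteq> x}"
  have KAt: "K \<subseteq> At" using K(1) by (auto simp: perspective_def)
  have fk: "finite ?k" by (rule finite_subset[OF _ finite_At]) (use KAt in auto)
  have "\<exists>t. t \<in> At \<and> t \<noteq> p \<and> t \<noteq> q \<and> t \<sqsubseteq> p \<squnion> q" if "q \<in> ?k" for q
    using K(1)[of q] that p by (auto simp: perspective_def)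
  then obtain t where t: "\<And>q. q \<in> ?k \<Longrightarrow> t q \<in> At \<and> t q \<noteq> p \<and> t q \<noteq> q \<and> t q \<sqsubseteq> p \<squnion> q"
    by metis
  have q_props: "q \<in> At" "q \<in> A" "q \<sqsubseteq> x" "t q \<in> A" "p \<noteq> q" if "q \<in> ?k" for q
    using that KAt AtD t p by auto
  have nx: "\<not> t q \<sqsubseteq> x" if q: "q \<in> ?k" for q
  proof
    assume l: "t q \<sqsubseteq> x"
    have "p \<sqsubseteq> q \<squnion> t q" using exch[of "t q" q p] t[OF q] q_props[OF q] p pA by (auto simp: jn_comm)
    moreover have "q \<squnion> t q \<sqsubseteq> x" using l q_props[OF q] x by (auto simp: jn_le_iff)
    ultimately show False using trans[of p "q \<squnion> t q" x] p pA x q_props[OF q] by auto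
  qed
  have sub: "insert p (t ` ?k) \<subseteq> new_atoms x (x \<squnion> p) \<inter> K"
  proof -
    have "p \<in> new_atoms x (x \<squnion> p) \<inter> K" using p K perspective_refl x pA by (auto simp: new_atoms_def)
    moreover have "t q \<in> new_atoms x (x \<squnion> p) \<inter> K" if q: "q \<in> ?k" for q
    proof -
      have "p \<squnion> q \<sqsubseteq> x \<squnion> p" using q_props[OF q] x pA by (auto simp: jn_le_iff intro: le_jn1)
      then have "t q \<sqsubseteq> x \<squnion> p" using t[OF q] trans[of "t q" "p \<squnion> q" "x \<squnion> p"] x pA q_props[OF q] by auto
      moreover have "perspective (t q) p" using collinear_perspective[of "t q" p q] t[OF q] q_props[OF q] p by auto
      then have "t q \<in> K" using K perspective_sym by blast
      ultimately show ?thesis using t[OF q] nx[OF q] by (auto simp: new_atoms_def)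
    qed
    ultimately show ?thesis by blast
  qed
  \<comment> \<open>If q and q' had the same third point, both would lie on its line with p, so p
    would lie on the line qq', which is contained in x.\<close>
  have inj: "inj_on t ?k"
  proof (rule inj_onI, rule ccontr)
    fix q q' assume q: "q \<in> ?k" "q' \<in> ?k" and e: "t q = t q'" and ne: "q \<noteq> q'"
    have 1: "q \<sqsubseteq> p \<squnion> t q" using exch[of "t q" p q] t[OF q(1)] q_props[OF q(1)] p by auto
    have 2: "q' \<sqsubseteq> p \<squnion> t q" using exch[of "t q'" p q'] t[OF q(2)] q_props[OF q(2)] p e by auto
    have "p \<squnion> t q \<sqsubseteq> p \<squnion> q" using t[OF q(1)] q_props[OF q(1)] pA by (auto simp: jn_le_iff)
    then have "q' \<sqsubseteq> q \<squnion> p" using 2 trans[of q' "p \<squnion> t q" "p \<squnion> q"] q_props[OF q(1)] q_props[OF q(2)] pA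
      by (auto simp: jn_comm)
    then have "p \<sqsubseteq> q \<squnion> q'" using exch[of q' q p] q_props[OF q(1)] q_props[OF q(2)] p ne by auto
    moreover have "q \<squnion> q' \<sqsubseteq> x" using q_props[OF q(1)] q_props[OF q(2)] x by (auto simp: jn_le_iff)
    ultimately show False using trans[of p "q \<squnion> q'" x] p pA x q_props[OF q(1)] q_props[OF q(2)] by auto
  qed
  have "1 + card ?k = card (insert p (t ` ?k))"
  proof -
    have "p \<notin> t ` ?k" using t by auto
    then show ?thesis using card_image[OF inj] fk by simp
  qed
  also have "\<dots> \<le> card (new_atoms x (x \<squnion> p) \<inter> K)"
    by (rule card_mono) (use sub in auto)
  finally show ?thesis .
qed

text \<open>The factors \<open>1 + 1 / N\<close> multiply to at most 8 along each component, because the number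
  of its points at least doubles in each step.\<close>

theorem ratio_bound:
  fixes f g :: "'a \<Rightarrow> real"
  assumes f_nonneg: "\<And>x. x \<in> A \<Longrightarrow> 0 \<le> f x" and base: "f bt = 1" "g bt = 1"
    and f_step: "\<And>x y. cov y x \<Longrightarrow> f x = real (card (new_atoms y x)) * f y"
    and g_step: "\<And>x y. cov y x \<Longrightarrow> g x = (1 + real (card (new_atoms y x))) * g y"
  shows "g tp \<le> f tp * real (card {h. neutral h}) ^ 3"
proof -
  \<comment> \<open>The points of one component are adjoined to e one by one. The constant c
    collects the earlier components and r the factors of this one; a point already below the current
    element changes nothing.\<close>
  have inner: "\<exists>r. 0 \<le> r \<and> growth (card {q \<in> K. q \<sqsubseteq> e \<squnion> Jn J}) r \<and> g (e \<squnion> Jn J) \<le> r * c * f (e \<squnion> Jn J)"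
    if K: "K \<in> components" and e: "e \<in> A" "g e \<le> c * f e" and J: "finite J" "J \<subseteq> K" and c: "c \<ge> 0" for K e c J
    using J
  proof (induction J)
    case empty
    then show ?case using e by (intro exI[of _ 1]) (auto simp: growth_def Jn_empty jn_absorb2)
  next
    case (insert p J)
    have KAt: "K \<subseteq> At" using K Union_components by auto
    have p: "p \<in> At" "p \<in> K" "p \<in> A" "J \<subseteq> A" using insert KAt AtD by auto
    let ?x = "e \<squnion> Jn J"
    have x: "?x \<in> A" using e p by auto
    have x': "e \<squnion> Jn (insert p J) = ?x \<squnion> p"
    proof -
      have "p \<squnion> Jn J = Jn J \<squnion> p" using p by (intro jn_comm) auto
      then show ?thesis using e p by (simp add: Jn_insert jn_assoc)
    qed
    obtain r where r: "0 \<le> r" "growth (card {q \<in> K. q \<sqsubseteq> ?x}) r" "g ?x \<le> r * c * f ?x" using insert by auto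
    show ?case
    proof (cases "p \<sqsubseteq> ?x")
      case True
      then have "?x \<squnion> p = ?x" using x p by (simp add: jn_absorb2)
      then show ?thesis unfolding x' using r by auto
    next
      case False
      have Kr: "perspective p q" if "q \<in> K" for q
        using quotient_eq_iff[OF equiv_perspective, of K K p q] K that p by (auto simp: components_def)
      have Kc: "q \<in> K" if "perspective p q" for q
        using in_quotient_imp_closed[OF equiv_perspective, of K p q] K that p by (auto simp: components_def)
      let ?k = "card {q \<in> K. q \<sqsubseteq> ?x}" and ?k' = "card {q \<in> K. q \<sqsubseteq> ?x \<squnion> p}" and ?N = "card (new_atoms ?x (?x \<squnion> p))"
      have n: "card (new_atoms ?x (?x \<squnion> p) \<inter> K) \<ge> 1 + ?k" using card_new_atoms[OF x p(1) False Kr Kc] by simp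
      have N: "?N \<ge> 1 + ?k" using n card_mono[of "new_atoms ?x (?x \<squnion> p)" "new_atoms ?x (?x \<squnion> p) \<inter> K"] by auto
      have fin: "finite {q \<in> K. q \<sqsubseteq> z}" for z by (rule finite_subset[OF _ finite_At]) (use KAt in auto)
      \<comment> \<open>The old points of K and the new ones are disjoint and there are at least
        \<open>k\<close> and \<open>1 + k\<close> of them, whence the doubling.\<close>
      have "{q \<in> K. q \<sqsubseteq> ?x} \<union> (new_atoms ?x (?x \<squnion> p) \<inter> K) \<subseteq> {q \<in> K. q \<sqsubseteq> ?x \<squnion> p}"
        using x p KAt AtD by (auto simp: new_atoms_def intro!: le_jn1[of ?x p])
      then have "card ({q \<in> K. q \<sqsubseteq> ?x} \<union> (new_atoms ?x (?x \<squnion> p) \<inter> K)) \<le> ?k'"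
        by (rule card_mono[OF fin])
      moreover have "card ({q \<in> K. q \<sqsubseteq> ?x} \<union> (new_atoms ?x (?x \<squnion> p) \<inter> K)) = ?k + card (new_atoms ?x (?x \<squnion> p) \<inter> K)"
        by (rule card_Un_disjoint) (simp_all add: fin, auto simp: new_atoms_def)
      ultimately have k': "?k' \<ge> 2 * ?k + 1" using n by linarith
      have cv: "cov ?x (?x \<squnion> p)" using At_cov p x False by auto
      have N0: "?N > 0" using N by linarith
      have "g (?x \<squnion> p) = (1 + real ?N) * g ?x" using g_step[OF cv] .
      also have "\<dots> \<le> (1 + real ?N) * (r * c * f ?x)" using r by (intro mult_left_mono) auto
      also have "\<dots> = (r * (1 + 1 / real ?N)) * c * (real ?N * f ?x)" 
      proof -
        have "(1 + n) * (r * c * F) = (r * (1 + 1 / n)) * c * (n * F)" if "n \<noteq> 0" for n F :: real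
          using that by (simp add: field_simps)
        moreover have "real ?N \<noteq> 0" using N0 by linarith
        ultimately show ?thesis by blast
      qed
      also have "\<dots> = (r * (1 + 1 / real ?N)) * c * f (?x \<squnion> p)" using f_step[OF cv] by simp
      finally have "g (?x \<squnion> p) \<le> (r * (1 + 1 / real ?N)) * c * f (?x \<squnion> p)" .
      moreover have "growth ?k' (r * (1 + 1 / real ?N))" using growth_step[OF r(2) N k' r(1)] .
      moreover have "0 \<le> r * (1 + 1 / real ?N)" using r by auto
      ultimately show ?thesis unfolding x' by blast
    qed
  qed
  \<comment> \<open>Each completed component costs at most a factor 8, whatever has been adjoined
    before.\<close>
  have outer: "g (Jn (\<Union>I)) \<le> 8 ^ card I * f (Jn (\<Union>I))" if "finite I" "I \<subseteq> components" for I
    using that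
  proof (induction I)
    case empty
    then show ?case using base by (simp add: Jn_empty)
  next
    case (insert K I)
    let ?e = "Jn (\<Union>I)"
    have sub: "\<Union>I \<subseteq> A" "K \<subseteq> A" using insert Union_components At_sub by auto
    have fK: "finite K" using finite_subset[OF sub(2) finite_carrier] .
    have e: "?e \<in> A" "g ?e \<le> 8 ^ card I * f ?e" using insert sub by auto
    obtain r where r: "growth (card {q \<in> K. q \<sqsubseteq> ?e \<squnion> Jn K}) r" "g (?e \<squnion> Jn K) \<le> r * 8 ^ card I * f (?e \<squnion> Jn K)"
      using inner[OF _ e fK] insert by auto
    have j: "?e \<squnion> Jn K = Jn (\<Union>(insert K I))"
    proof (rule antisym)
      have sub': "\<Union>(insert K I) \<subseteq> A" using sub by simp
      have u: "x \<sqsubseteq> Jn (\<Union>(insert K I))" if "x \<in> K \<or> x \<in> \<Union>I" for x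
        using Jn_upper[OF sub'] that by blast
      have "?e \<sqsubseteq> Jn (\<Union>(insert K I))" "Jn K \<sqsubseteq> Jn (\<Union>(insert K I))"
        using u Jn_le_iff[OF sub(1) Jn_closed[OF sub']] Jn_le_iff[OF sub(2) Jn_closed[OF sub']] by simp_all
      then show "?e \<squnion> Jn K \<sqsubseteq> Jn (\<Union>(insert K I))"
        using Jn_closed[OF sub'] Jn_closed[OF sub(1)] Jn_closed[OF sub(2)] by (simp only: jn_le_iff)
      have "x \<sqsubseteq> ?e \<squnion> Jn K" if x: "x \<in> \<Union>(insert K I)" for x
      proof -
        have "x \<in> A" using x sub' by blast
        moreover have "x \<sqsubseteq> ?e \<or> x \<sqsubseteq> Jn K" using x Jn_upper[OF sub(1)] Jn_upper[OF sub(2)] by blast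
        ultimately show ?thesis using Jn_closed[OF sub(1)] Jn_closed[OF sub(2)] le_jn1 le_jn2 by meson
      qed
      then show "Jn (\<Union>(insert K I)) \<sqsubseteq> ?e \<squnion> Jn K"
        using Jn_le_iff[OF sub'] Jn_closed[OF sub(1)] Jn_closed[OF sub(2)] by blast
    qed (use sub in auto)
    have "g (?e \<squnion> Jn K) \<le> 8 * 8 ^ card I * f (?e \<squnion> Jn K)"
      using r(2) growth_le[OF r(1)] f_nonneg[of "?e \<squnion> Jn K"] e sub
      by (auto intro!: mult_right_mono elim: order_trans)
    then show ?case using insert j by simp
  qed
  have tp: "Jn At = tp"
  proof (rule antisym)
    show "tp \<sqsubseteq> Jn At" using ss_le[OF atomic, of "Jn At"] Jn_upper[OF At_sub] At_sub by (auto simp: At_def)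
  qed (use At_sub in auto)
  have "(8::real) ^ card components = (2 ^ card components) ^ 3"
    by (simp add: power_mult[symmetric] mult.commute power_mult)
  also have "\<dots> \<le> real (card {h. neutral h}) ^ 3"
    using of_nat_mono[OF components_neutral, where 'a = real] by (intro power_mono) auto
  finally have "8 ^ card components * f tp \<le> real (card {h. neutral h}) ^ 3 * f tp"
    using f_nonneg[of tp] by (intro mult_right_mono) auto
  then show ?thesis using outer[OF finite_components] tp Union_components by (simp add: mult.commute)
qed

end

text \<open>Complementation is self-dual. If z lies below all coatoms and y is a complement of z,
  then y is below no coatom, so y is the top and z the bottom.\<close>

lemma (in finite_modular_lattice) dual_atomic:
  assumes s: "ss bt tp"
  shows "atomic_modular_lattice A (\<lambda>x y. y \<sqsubseteq> x) mt jn tp bt"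
proof -
  interpret d: finite_modular_lattice A "\<lambda>x y. y \<sqsubseteq> x" mt jn tp bt by (rule dual)
  show ?thesis
  proof (unfold_locales, rule d.ssI)
    fix z assume z: "z \<in> A" and c: "\<And>h. d.cov tp h \<Longrightarrow> bt \<sqsubseteq> h \<Longrightarrow> z \<sqsubseteq> h"
    obtain y where y: "y \<in> A" "z \<squnion> y = tp" "z \<sqinter> y = bt" using ss_compl[OF s z] z by auto
    have "y = tp"
    proof (rule ccontr)
      assume "y \<noteq> tp"
      then obtain h where h: "d.cov tp h" "y \<sqsubseteq> h" using d.ex_cov[of tp y] y by auto
      have "tp \<sqsubseteq> h" using c[OF h(1)] h y(2) z y d.covD(2)[OF h(1)] by (metis bt_le jn_le_iff)
      then show False using d.covD[OF h(1)] antisym[of tp h] by auto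
    qed
    then have "z = bt" using y z by (simp add: mt_absorb)
    then show "z \<sqsubseteq> bt" by simp
  qed auto
qed

section \<open>The bound by the cube of the number of distributive elements\<close>

context mobius_lattice
begin

text \<open>The recursions for \<open>m x tp\<close> and \<open>mobius_mass x tp\<close> start at
  the top and move x down, so \<open>ratio_bound\<close> is applied to the dual lattice. There the
  new atoms of a step are the coatoms avoiding the cover.\<close>

lemma ss_bound_top:
  assumes s: "ss bt tp"
  shows "real_of_int (mobius_mass bt tp) \<le> \<bar>real_of_int (m bt tp)\<bar> *
    real (card {h \<in> A. \<forall>k1 \<in> A. \<forall>k2 \<in> A. h \<squnion> (k1 \<sqinter> k2) = (h \<squnion> k1) \<sqinter> (h \<squnion> k2)}) ^ 3"
    (is "_ \<le> _ * real (card ?N) ^ 3")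
proof -
  interpret d: atomic_modular_lattice A "\<lambda>x y. y \<sqsubseteq> x" mt jn tp bt by (rule dual_atomic[OF s])
  have cov: "d.cov y x \<longleftrightarrow> cov x y" for x y
    unfolding d.cov_def cov_def by auto
  have new_atoms: "d.new_atoms y x = avoiding x y tp" for x y
    unfolding d.new_atoms_def d.At_def avoiding_def cov by (auto simp: cov_def)
  have "real_of_int (mobius_mass bt tp) \<le> \<bar>real_of_int (m bt tp)\<bar> * real (card {h. d.neutral h}) ^ 3"
  proof (rule d.ratio_bound[where f = "\<lambda>x. \<bar>real_of_int (m x tp)\<bar>" and g = "\<lambda>x. real_of_int (mobius_mass x tp)"])
    have "{x. x \<in> A \<and> tp \<sqsubseteq> x \<and> x \<sqsubseteq> tp} = {tp}" using antisym by auto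
    then show "real_of_int (mobius_mass tp tp) = 1" by (simp add: mobius_mass_def)
    fix x y assume "d.cov y x"
    then have c: "cov x y" by (simp add: cov)
    show "\<bar>real_of_int (m x tp)\<bar> = real (card (d.new_atoms y x)) * \<bar>real_of_int (m y tp)\<bar>"
      using m_step[OF c tp_closed] covD(2)[OF c] new_atoms by (simp add: abs_mult)
    show "real_of_int (mobius_mass x tp) = (1 + real (card (d.new_atoms y x))) * real_of_int (mobius_mass y tp)"
      using mobius_mass_step[OF c tp_closed] covD(2)[OF c] new_atoms by simp
  qed auto
  moreover have "{h. d.neutral h} = ?N" by (auto simp: d.neutral_def)
  ultimately show ?thesis by simp
qed

lemma interval_mobius:
  assumes "a \<in> A" "b \<in> A" "a \<sqsubseteq> b"
  shows "mobius_lattice {x \<in> A. a \<sqsubseteq> x \<and> x \<sqsubseteq> b} leq jn mt a b m"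
  unfolding mobius_lattice_def mobius_lattice_axioms_def
proof (intro conjI allI impI)
  show "finite_modular_lattice {x \<in> A. a \<sqsubseteq> x \<and> x \<sqsubseteq> b} leq jn mt a b" by (rule interval[OF assms])
  fix x y assume xy: "x \<in> {x \<in> A. a \<sqsubseteq> x \<and> x \<sqsubseteq> b}" "y \<in> {x \<in> A. a \<sqsubseteq> x \<and> x \<sqsubseteq> b}" "x \<sqsubseteq> y"
  have "{z. z \<in> {x \<in> A. a \<sqsubseteq> x \<and> x \<sqsubseteq> b} \<and> x \<sqsubseteq> z \<and> z \<sqsubseteq> y} = {z. z \<in> A \<and> x \<sqsubseteq> z \<and> z \<sqsubseteq> y}"
  proof -
    have "a \<sqsubseteq> z" "z \<sqsubseteq> b" if "z \<in> A" "x \<sqsubseteq> z" "z \<sqsubseteq> y" for z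
      using trans[of a x z] trans[of z y b] that xy assms by simp_all
    then show ?thesis by blast
  qed
  then show "(\<Sum>z | z \<in> {x \<in> A. a \<sqsubseteq> x \<and> x \<sqsubseteq> b} \<and> x \<sqsubseteq> z \<and> z \<sqsubseteq> y. m x z) = (if x = y then 1 else 0)"
    using sum_left[of x y] xy by simp
qed

theorem ss_bound:
  assumes s: "ss a tp"
  shows "(\<Sum>x | x \<in> A \<and> a \<sqsubseteq> x. \<bar>real_of_int (m x tp)\<bar>) \<le> \<bar>real_of_int (m a tp)\<bar> *
    real (card {h \<in> {x \<in> A. a \<sqsubseteq> x}. \<forall>k1 \<in> {x \<in> A. a \<sqsubseteq> x}. \<forall>k2 \<in> {x \<in> A. a \<sqsubseteq> x}.
      h \<squnion> (k1 \<sqinter> k2) = (h \<squnion> k1) \<sqinter> (h \<squnion> k2)}) ^ 3"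
proof -
  have a: "a \<in> A" using s ssD by auto
  have e: "{x \<in> A. a \<sqsubseteq> x \<and> x \<sqsubseteq> tp} = {x \<in> A. a \<sqsubseteq> x}" by auto
  interpret I: mobius_lattice "{x \<in> A. a \<sqsubseteq> x}" leq jn mt a tp m
    using interval_mobius[of a tp] a e by simp
  note [simp del] = I.bt_le I.le_tp
  have cv: "I.cov a p \<longleftrightarrow> cov a p" for p
    using a by (auto simp: I.cov_def cov_def)
  have "I.ss a tp"
    by (rule I.ssI) (use ss_le[OF s] cv a in auto)
  note b = I.ss_bound_top[OF this]
  have "{x. x \<in> {x \<in> A. a \<sqsubseteq> x} \<and> a \<sqsubseteq> x \<and> x \<sqsubseteq> tp} = {x. x \<in> A \<and> a \<sqsubseteq> x}" by auto
  then have "real_of_int (I.mobius_mass a tp) = (\<Sum>x | x \<in> A \<and> a \<sqsubseteq> x. \<bar>real_of_int (m x tp)\<bar>)"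
    unfolding I.mobius_mass_def by (simp only:) simp
  then show ?thesis using b by simp
qed

end

text \<open>An order embedding whose image is a down-set. The model is pulling back quotients along
  an epimorphism \<open>H \<rightarrow> G\<close>, which identifies the quotients of G with those of
  H lying below G; covers, socles and Loewy length are then the same in both lattices.\<close>

locale lower_embedding =
  L1: finite_modular_lattice A1 le1 j1 m1 b1 t1 + L2: finite_modular_lattice A2 le2 j2 m2 b2 t2
  for A1 :: "'a set" and le1 j1 m1 b1 t1 and A2 :: "'b set" and le2 j2 m2 b2 t2 +
  fixes \<phi> :: "'a \<Rightarrow> 'b"
  assumes closed: "x \<in> A1 \<Longrightarrow> \<phi> x \<in> A2"
    and le_iff: "x \<in> A1 \<Longrightarrow> y \<in> A1 \<Longrightarrow> le2 (\<phi> x) (\<phi> y) \<longleftrightarrow> le1 x y"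
    and lower: "z \<in> A2 \<Longrightarrow> x \<in> A1 \<Longrightarrow> le2 z (\<phi> x) \<Longrightarrow> z \<in> \<phi> ` A1"
begin

lemma eq_iff: "x \<in> A1 \<Longrightarrow> y \<in> A1 \<Longrightarrow> \<phi> x = \<phi> y \<longleftrightarrow> x = y"
  using le_iff[of x y] le_iff[of y x] L1.antisym[of x y] closed L2.le_refl by metis

lemma cov_iff:
  assumes "a \<in> A1" "p \<in> A1"
  shows "L2.cov (\<phi> a) (\<phi> p) \<longleftrightarrow> L1.cov a p"
proof
  assume c: "L2.cov (\<phi> a) (\<phi> p)"
  have "z = a \<or> z = p" if "z \<in> A1" "le1 a z" "le1 z p" for z
    using L2.covD(5)[OF c, of "\<phi> z"] that assms by (simp add: closed le_iff eq_iff)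
  then show "L1.cov a p"
    using L2.covD[OF c] assms by (simp add: L1.cov_def le_iff eq_iff)
next
  assume c: "L1.cov a p"
  have "w = \<phi> a \<or> w = \<phi> p" if w: "w \<in> A2" "le2 (\<phi> a) w" "le2 w (\<phi> p)" for w
  proof -
    obtain z where z: "z \<in> A1" "w = \<phi> z" using lower w assms by blast
    then show ?thesis using L1.covD(5)[OF c, of z] w assms by (auto simp: le_iff)
  qed
  then show "L2.cov (\<phi> a) (\<phi> p)"
    using L1.covD[OF c] assms by (simp add: L2.cov_def le_iff eq_iff closed)
qed

lemma Soc_eq:
  assumes "a \<in> A1" "b \<in> A1" "le1 a b"
  shows "\<phi> (L1.Soc a b) = L2.Soc (\<phi> a) (\<phi> b)"
proof (rule L2.antisym)
  note s = L1.Soc_closed[OF assms(1), of b] L2.Soc_closed[OF closed[OF assms(1)], of "\<phi> b"]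
  show "\<phi> (L1.Soc a b) \<in> A2" "L2.Soc (\<phi> a) (\<phi> b) \<in> A2" using s closed by auto
  have "le2 p' (\<phi> (L1.Soc a b))" if p: "L2.cov (\<phi> a) p'" "le2 p' (\<phi> b)" for p'
  proof -
    obtain p where "p \<in> A1" "p' = \<phi> p" using lower[of p' b] L2.covD[OF p(1)] p assms by blast
    then show ?thesis using p cov_iff assms s le_iff L1.cov_le_Soc by auto
  qed
  then show "le2 (L2.Soc (\<phi> a) (\<phi> b)) (\<phi> (L1.Soc a b))"
    using assms s closed by (auto simp: L2.Soc_le_iff le_iff)
  have "le2 (L2.Soc (\<phi> a) (\<phi> b)) (\<phi> b)" using assms closed le_iff L2.Soc_le by auto
  then obtain z where z: "z \<in> A1" "L2.Soc (\<phi> a) (\<phi> b) = \<phi> z" using lower[OF s(2) assms(2)] by blast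
  have "le1 (L1.Soc a b) z"
    using L2.le_Soc[of "\<phi> a" "\<phi> b"] L2.cov_le_Soc[of "\<phi> a" _ "\<phi> b"] cov_iff z assms closed le_iff L1.covD(2)
    by (auto simp: L1.Soc_le_iff) (metis le_iff cov_iff L1.covD(2))
  then show "le2 (\<phi> (L1.Soc a b)) (L2.Soc (\<phi> a) (\<phi> b))" using z s le_iff by simp
qed

lemma ss_iff:
  assumes "a \<in> A1" "b \<in> A1"
  shows "L2.ss (\<phi> a) (\<phi> b) \<longleftrightarrow> L1.ss a b"
proof (cases "le1 a b")
  case True
  then show ?thesis
    using assms Soc_eq[OF assms True, symmetric] eq_iff[of "L1.Soc a b" b] L1.Soc_closed[of a b]
    by (simp add: L1.ss_def L2.ss_def closed le_iff)
qed (simp add: L1.ss_def L2.ss_def le_iff assms)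

lemma loewy_iff:
  assumes "a \<in> A1" "b \<in> A1"
  shows "L2.loewy n (\<phi> a) (\<phi> b) \<longleftrightarrow> L1.loewy n a b"
  using assms
proof (induction n arbitrary: a)
  case 0
  then show ?case by (simp add: eq_iff)
next
  case (Suc n)
  show ?case
  proof
    assume "L2.loewy (Suc n) (\<phi> a) (\<phi> b)"
    then obtain c' where c': "c' \<in> A2" "L2.ss (\<phi> a) c'" "le2 c' (\<phi> b)" "L2.loewy n c' (\<phi> b)" by auto
    then obtain c where "c \<in> A1" "c' = \<phi> c" using lower Suc by blast
    then show "L1.loewy (Suc n) a b" using c' Suc ss_iff le_iff by auto
  next
    assume "L1.loewy (Suc n) a b"
    then obtain c where c: "c \<in> A1" "L1.ss a c" "le1 c b" "L1.loewy n c b" by auto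
    then show "L2.loewy (Suc n) (\<phi> a) (\<phi> b)"
      using Suc ss_iff le_iff closed by (auto intro!: bexI[of _ "\<phi> c"])
  qed
qed

lemma bij_int: "a \<in> A1 \<Longrightarrow> b \<in> A1 \<Longrightarrow>
    bij_betw \<phi> {x \<in> A1. le1 a x \<and> le1 x b} {z \<in> A2. le2 (\<phi> a) z \<and> le2 z (\<phi> b)}"
  unfolding bij_betw_def
proof
  assume ab: "a \<in> A1" "b \<in> A1"
  show "inj_on \<phi> {x \<in> A1. le1 a x \<and> le1 x b}" by (rule inj_onI) (simp add: eq_iff)
  show "\<phi> ` {x \<in> A1. le1 a x \<and> le1 x b} = {z \<in> A2. le2 (\<phi> a) z \<and> le2 z (\<phi> b)}"
  proof (intro equalityI subsetI)
    fix z assume z: "z \<in> {z \<in> A2. le2 (\<phi> a) z \<and> le2 z (\<phi> b)}"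
    then obtain x where "x \<in> A1" "z = \<phi> x" using lower ab by blast
    then show "z \<in> \<phi> ` {x \<in> A1. le1 a x \<and> le1 x b}" using z ab by (auto simp: le_iff)
  qed (use ab in \<open>auto simp: closed le_iff\<close>)
qed

end

section \<open>The lattice of quotients of an object\<close>

lemma mobius_sum:
  assumes "Order.partial_order L" "finite (carrier L)" "a \<in> carrier L" "b \<in> carrier L" "le L a b"
  shows "(\<Sum>z | z \<in> carrier L \<and> le L a z \<and> le L z b. mobius L a z) = (if a = b then 1 else 0)"
proof -
  interpret Order.partial_order L by fact
  have fin: "finite {z \<in> carrier L. le L a z \<and> le L z b}" using assms by simp
  show ?thesis
  proof (cases "a = b")
    case True
    then have "{z. z \<in> carrier L \<and> le L a z \<and> le L z b} = {a}" using assms le_antisym by auto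
    then show ?thesis using True assms mobius.simps[of L a a] by simp
  next
    case False
    have s: "{z. z \<in> carrier L \<and> le L a z \<and> le L z b} = insert b {z \<in> carrier L. le L a z \<and> lless L z b}"
      using assms by (auto simp: lless_def eq_is_equal)
    have f: "finite {z \<in> carrier L. le L a z \<and> lless L z b}" using assms by simp
    have "b \<notin> {z \<in> carrier L. le L a z \<and> lless L z b}" by (auto simp: lless_def)
    then show ?thesis unfolding s using f False assms mobius.simps[of L a b] by simp
  qed
qed

context category
begin

section \<open>Epimorphisms and classes of quotients\<close>

abbreviation car :: "'o \<Rightarrow> 'm set set" where "car G \<equiv> carrier (quot_poset C G)"
abbreviation qle :: "'o \<Rightarrow> 'm set \<Rightarrow> 'm set \<Rightarrow> bool" where "qle G \<equiv> le (quot_poset C G)"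
abbreviation cls :: "'m \<Rightarrow> 'm set" where "cls \<equiv> quot_class C"
abbreviation qtop :: "'o \<Rightarrow> 'm set" where "qtop G \<equiv> quot_class C (ident C G)"
abbreviation icls :: "'o \<Rightarrow> 'o set" where "icls G \<equiv> iso_rel C `` {G}"

lemma Epi_Hom: "\<pi> \<in> Epi C G F \<Longrightarrow> \<pi> \<in> Hom C G F"
  by (simp add: Epi_def)

lemma Epi_dom: "\<pi> \<in> Epi C G F \<Longrightarrow> Dom C \<pi> = G" and Epi_cod: "\<pi> \<in> Epi C G F \<Longrightarrow> Cod C \<pi> = F"
  by (simp_all add: Epi_def Hom_def)

lemma Epi_cancel: "\<pi> \<in> Epi C G F \<Longrightarrow> g \<in> Hom C F H \<Longrightarrow> h \<in> Hom C F H \<Longrightarrow> g \<bullet> \<pi> = h \<bullet> \<pi> \<Longrightarrow> g = h"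
  using Hom_Ob[of g F H] unfolding Epi_def by blast

lemma Epi_comp:
  assumes "\<tau> \<in> Epi C H G" "\<sigma> \<in> Epi C G F"
  shows "\<sigma> \<bullet> \<tau> \<in> Epi C H F"
proof -
  note h = Epi_Hom[OF assms(1)] Epi_Hom[OF assms(2)]
  have "g = k" if "g \<in> Hom C F K" "k \<in> Hom C F K" "g \<bullet> (\<sigma> \<bullet> \<tau>) = k \<bullet> (\<sigma> \<bullet> \<tau>)" for g k K
  proof -
    have "(g \<bullet> \<sigma>) \<bullet> \<tau> = (k \<bullet> \<sigma>) \<bullet> \<tau>" using Comp_assoc[OF h] that by simp
    then have "g \<bullet> \<sigma> = k \<bullet> \<sigma>" using Epi_cancel[OF assms(1)] Comp_closed[OF h(2)] that by blast
    then show ?thesis using Epi_cancel[OF assms(2)] that by blast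
  qed
  then show ?thesis using Comp_closed[OF h] by (auto simp: Epi_def)
qed

lemma Epi_left:
  assumes "\<tau> \<in> Hom C H G" "h \<in> Hom C G F" "h \<bullet> \<tau> \<in> Epi C H F"
  shows "h \<in> Epi C G F"
proof -
  have "g = k" if "g \<in> Hom C F K" "k \<in> Hom C F K" "g \<bullet> h = k \<bullet> h" for g k K
  proof -
    have "g \<bullet> (h \<bullet> \<tau>) = k \<bullet> (h \<bullet> \<tau>)" using Comp_assoc[OF assms(1,2)] that by metis
    then show ?thesis using Epi_cancel[OF assms(3)] that by blast
  qed
  then show ?thesis using assms by (auto simp: Epi_def)
qed

lemma Iso_Hom: "\<rho> \<in> Iso C G F \<Longrightarrow> \<rho> \<in> Hom C G F"
  by (simp add: Iso_def)

lemma Iso_Epi: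
  assumes "\<rho> \<in> Iso C G F"
  shows "\<rho> \<in> Epi C G F"
proof -
  obtain \<sigma> where s: "\<sigma> \<in> Hom C F G" "\<rho> \<bullet> \<sigma> = ident C F" using assms by (auto simp: Iso_def)
  have r: "\<rho> \<in> Hom C G F" using assms by (rule Iso_Hom)
  have "g = k" if "g \<in> Hom C F K" "k \<in> Hom C F K" "g \<bullet> \<rho> = k \<bullet> \<rho>" for g k K
  proof -
    have "g \<bullet> (\<rho> \<bullet> \<sigma>) = k \<bullet> (\<rho> \<bullet> \<sigma>)"
      using Comp_assoc[OF s(1) r that(1)] Comp_assoc[OF s(1) r that(2)] that(3) by simp
    then show ?thesis using s Comp_ident that by simp
  qed
  then show ?thesis using r by (auto simp: Epi_def)
qed

lemma ident_Epi: "G \<in> Ob C \<Longrightarrow> ident C G \<in> Epi C G G"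
  using ident_Iso Iso_Epi by blast

lemma Epi_quotients: "\<pi> \<in> Epi C G F \<Longrightarrow> \<pi> \<in> quotients C G"
  using Epi_Ob by (auto simp: quotients_def)

lemma car_iff: "x \<in> car G \<longleftrightarrow> (\<exists>F \<pi>. \<pi> \<in> Epi C G F \<and> x = cls \<pi>)"
proof
  assume "x \<in> car G"
  then obtain \<pi> where "\<pi> \<in> quotients C G" "x = quot_rel C G `` {\<pi>}"
    by (auto simp: quot_poset_def quotient_def)
  then show "\<exists>F \<pi>. \<pi> \<in> Epi C G F \<and> x = cls \<pi>"
    using Epi_dom unfolding quotients_def quot_class_def by blast
next
  assume "\<exists>F \<pi>. \<pi> \<in> Epi C G F \<and> x = cls \<pi>"
  then show "x \<in> car G"
    using Epi_dom Epi_quotients by (auto simp: quot_poset_def quot_class_def intro!: quotientI)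
qed

lemma cls_car: "\<pi> \<in> Epi C G F \<Longrightarrow> cls \<pi> \<in> car G"
  using car_iff by blast

lemma mem_cls:
  assumes "\<pi> \<in> Epi C G F"
  shows "\<sigma> \<in> cls \<pi> \<longleftrightarrow> (\<exists>F' \<rho>. \<rho> \<in> Iso C F F' \<and> \<sigma> = \<rho> \<bullet> \<pi>)"
proof
  assume "\<sigma> \<in> cls \<pi>"
  then show "\<exists>F' \<rho>. \<rho> \<in> Iso C F F' \<and> \<sigma> = \<rho> \<bullet> \<pi>"
    using assms by (auto simp: quot_class_def quot_rel_def Epi_cod)
next
  assume "\<exists>F' \<rho>. \<rho> \<in> Iso C F F' \<and> \<sigma> = \<rho> \<bullet> \<pi>"
  then obtain F' \<rho> where r: "\<rho> \<in> Iso C F F'" "\<sigma> = \<rho> \<bullet> \<pi>" by blast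
  have "\<sigma> \<in> Epi C G F'" using Epi_comp[OF assms Iso_Epi[OF r(1)]] r by simp
  then show "\<sigma> \<in> cls \<pi>"
    using r assms Epi_quotients by (auto simp: quot_class_def quot_rel_def Epi_cod Epi_dom)
qed

lemma self_cls: "\<pi> \<in> Epi C G F \<Longrightarrow> \<pi> \<in> cls \<pi>"
  using mem_cls[of \<pi> G F \<pi>] ident_Iso[of F] ident_Comp[of \<pi> G F] Epi_Ob Epi_Hom by metis

lemma cls_eq_iff:
  assumes "\<pi> \<in> Epi C G F" "\<sigma> \<in> Epi C G F'"
  shows "cls \<pi> = cls \<sigma> \<longleftrightarrow> (\<exists>\<rho> \<in> Iso C F F'. \<sigma> = \<rho> \<bullet> \<pi>)"
proof -
  have "cls \<pi> = cls \<sigma> \<longleftrightarrow> (\<pi>, \<sigma>) \<in> quot_rel C G"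
    using eq_equiv_class_iff[OF equiv_quot_rel, of \<pi> G \<sigma>] assms Epi_quotients
    by (simp add: quot_class_def Epi_dom)
  also have "\<dots> \<longleftrightarrow> (\<exists>\<rho> \<in> Iso C F F'. \<sigma> = \<rho> \<bullet> \<pi>)"
    using assms Epi_quotients by (auto simp: quot_rel_def Epi_cod)
  finally show ?thesis .
qed

lemma cls_eqI: "\<pi> \<in> Epi C G F \<Longrightarrow> \<rho> \<in> Iso C F F' \<Longrightarrow> cls (\<rho> \<bullet> \<pi>) = cls \<pi>"
  using cls_eq_iff[of \<pi> G F "\<rho> \<bullet> \<pi>" F'] Epi_comp Iso_Epi by blast

text \<open>The order is defined through some pair of representatives; conjugating by isomorphisms
  allows any given pair. The comparison morphism is an epimorphism because its composite with
  \<sigma> is one.\<close>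

lemma cls_le_iff:
  assumes p: "\<pi> \<in> Epi C G F" and s: "\<sigma> \<in> Epi C G F'"
  shows "qle G (cls \<pi>) (cls \<sigma>) \<longleftrightarrow> (\<exists>h \<in> Epi C F' F. h \<bullet> \<sigma> = \<pi>)"
proof
  assume "qle G (cls \<pi>) (cls \<sigma>)"
  then obtain \<pi>1 \<sigma>1 h where 1: "\<pi>1 \<in> cls \<pi>" "\<sigma>1 \<in> cls \<sigma>" "h \<in> Hom C (Cod C \<sigma>1) (Cod C \<pi>1)" "h \<bullet> \<sigma>1 = \<pi>1"
    by (auto simp: quot_poset_def)
  obtain F1 \<rho> where r: "\<rho> \<in> Iso C F F1" "\<pi>1 = \<rho> \<bullet> \<pi>" using 1 mem_cls[OF p] by blast
  obtain F2 \<tau> where t: "\<tau> \<in> Iso C F' F2" "\<sigma>1 = \<tau> \<bullet> \<sigma>" using 1 mem_cls[OF s] by blast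
  have cod: "Cod C \<pi>1 = F1" "Cod C \<sigma>1 = F2"
    using r t p s Epi_comp Iso_Epi Epi_cod by blast+
  obtain \<rho>' where r': "\<rho>' \<in> Iso C F1 F" "\<rho>' \<bullet> \<rho> = ident C F" using Iso_inverse[OF r(1)] by blast
  let ?h = "\<rho>' \<bullet> (h \<bullet> \<tau>)"
  have hh: "h \<in> Hom C F2 F1" using 1 cod by simp
  have ht: "h \<bullet> \<tau> \<in> Hom C F' F1" using Comp_closed[OF Iso_Hom[OF t(1)] hh] .
  have H: "?h \<in> Hom C F' F" using Comp_closed[OF ht Iso_Hom[OF r'(1)]] .
  have "?h \<bullet> \<sigma> = \<rho>' \<bullet> (h \<bullet> (\<tau> \<bullet> \<sigma>))"
    using Comp_assoc[OF Epi_Hom[OF s] ht Iso_Hom[OF r'(1)]] Comp_assoc[OF Epi_Hom[OF s] Iso_Hom[OF t(1)] hh] by simp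
  also have "\<dots> = \<rho>' \<bullet> (\<rho> \<bullet> \<pi>)" using 1 r t by simp
  also have "\<dots> = \<pi>"
    using Comp_assoc[OF Epi_Hom[OF p] Iso_Hom[OF r(1)] Iso_Hom[OF r'(1)]] r' ident_Comp[OF Epi_Hom[OF p]] by simp
  finally have e: "?h \<bullet> \<sigma> = \<pi>" .
  then have "?h \<in> Epi C F' F" using Epi_left[OF Epi_Hom[OF s] H] p by simp
  then show "\<exists>h \<in> Epi C F' F. h \<bullet> \<sigma> = \<pi>" using e by blast
next
  assume "\<exists>h \<in> Epi C F' F. h \<bullet> \<sigma> = \<pi>"
  then obtain h where "h \<in> Hom C (Cod C \<sigma>) (Cod C \<pi>)" "h \<bullet> \<sigma> = \<pi>"
    using Epi_Hom Epi_cod[OF p] Epi_cod[OF s] by auto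
  then have "\<exists>\<pi>' \<in> cls \<pi>. \<exists>\<sigma>' \<in> cls \<sigma>. \<exists>h \<in> Hom C (Cod C \<sigma>') (Cod C \<pi>'). h \<bullet> \<sigma>' = \<pi>'"
    using self_cls[OF p] self_cls[OF s] by blast
  then show "qle G (cls \<pi>) (cls \<sigma>)" by (simp add: quot_poset_def)
qed

lemma qle_top:
  assumes "G \<in> Ob C" "x \<in> car G"
  shows "qle G x (qtop G)"
proof -
  obtain F \<pi> where p: "\<pi> \<in> Epi C G F" "x = cls \<pi>" using assms car_iff by blast
  then show ?thesis
    using cls_le_iff[OF p(1) ident_Epi[OF assms(1)]] Comp_ident[OF Epi_Hom[OF p(1)]] by auto
qed

lemma qtop_car: "G \<in> Ob C \<Longrightarrow> qtop G \<in> car G"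
  using ident_Epi cls_car by blast

lemma cls_top_iff:
  assumes "\<pi> \<in> Epi C G F"
  shows "cls \<pi> = qtop G \<longleftrightarrow> \<pi> \<in> Iso C G F"
proof -
  have G: "G \<in> Ob C" using Epi_Ob assms by blast
  have "qtop G = cls \<pi> \<longleftrightarrow> (\<exists>\<rho> \<in> Iso C G F. \<pi> = \<rho> \<bullet> ident C G)"
    using cls_eq_iff[OF ident_Epi[OF G] assms] .
  also have "\<dots> \<longleftrightarrow> \<pi> \<in> Iso C G F" using Comp_ident Iso_Hom by metis
  finally show ?thesis by auto
qed

lemma icls_iso: "G \<in> Ob C \<Longrightarrow> icls G \<in> iso_classes C"
  by (simp add: iso_classes_def quotientI)

lemma icls_mem: "F \<in> icls G \<longleftrightarrow> G \<in> Ob C \<and> F \<in> Ob C \<and> Iso C G F \<noteq> {}"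
  by (auto simp: iso_rel_def)

lemma iso_class_mem: "\<gamma> \<in> iso_classes C \<Longrightarrow> G \<in> \<gamma> \<Longrightarrow> G \<in> Ob C \<and> icls G = \<gamma>"
  unfolding iso_classes_def
  using in_quotient_imp_subset[OF equiv_iso_rel] Image_singleton_iff
    quotient_eq_iff[OF equiv_iso_rel] by (smt (verit) equiv_class_eq_iff equiv_iso_rel quotientE subsetD)

lemma rep_mem: "\<gamma> \<in> iso_classes C \<Longrightarrow> rep \<gamma> \<in> \<gamma>"
  unfolding iso_classes_def rep_def using in_quotient_imp_non_empty[OF equiv_iso_rel] some_in_eq by blast

lemma rep_Ob: "\<gamma> \<in> iso_classes C \<Longrightarrow> rep \<gamma> \<in> Ob C" and icls_rep: "\<gamma> \<in> iso_classes C \<Longrightarrow> icls (rep \<gamma>) = \<gamma>"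
  using rep_mem iso_class_mem by blast+

lemma quot_obj_cls:
  assumes p: "\<pi> \<in> Epi C G F"
  shows "quot_obj C (cls \<pi>) = icls F"
proof -
  have F: "F \<in> Ob C" using Epi_Ob p by blast
  have "F' \<in> quot_obj C (cls \<pi>) \<longleftrightarrow> Iso C F F' \<noteq> {}" for F'
  proof
    assume "F' \<in> quot_obj C (cls \<pi>)"
    then obtain \<sigma> where "\<sigma> \<in> cls \<pi>" "F' = Cod C \<sigma>" by (auto simp: quot_obj_def)
    then obtain F1 \<rho> where "\<rho> \<in> Iso C F F1" "\<sigma> = \<rho> \<bullet> \<pi>" using mem_cls[OF p] by blast
    then show "Iso C F F' \<noteq> {}" using \<open>F' = Cod C \<sigma>\<close> Epi_cod[OF Epi_comp[OF p Iso_Epi]] by auto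
  next
    assume "Iso C F F' \<noteq> {}"
    then obtain \<rho> where r: "\<rho> \<in> Iso C F F'" by blast
    then have "\<rho> \<bullet> \<pi> \<in> cls \<pi>" using mem_cls[OF p] by blast
    then show "F' \<in> quot_obj C (cls \<pi>)"
      using Epi_cod[OF Epi_comp[OF p Iso_Epi[OF r]]] by (auto simp: quot_obj_def intro: rev_image_eqI)
  qed
  moreover have "F' \<in> icls F \<longleftrightarrow> Iso C F F' \<noteq> {}" for F'
    unfolding icls_mem using F Hom_Ob Iso_Hom by blast
  ultimately show ?thesis by blast
qed

lemma quot_obj_iso: "x \<in> car G \<Longrightarrow> quot_obj C x \<in> iso_classes C"
  using car_iff quot_obj_cls icls_iso Epi_Ob by metis

lemma ex_rep:
  assumes x: "x \<in> car G" and F: "F \<in> quot_obj C x"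
  obtains \<tau> where "\<tau> \<in> Epi C G F" "x = cls \<tau>"
proof -
  obtain F' \<pi> where p: "\<pi> \<in> Epi C G F'" "x = cls \<pi>" using x car_iff by blast
  then obtain \<rho> where r: "\<rho> \<in> Iso C F' F" using F quot_obj_cls[OF p(1)] icls_mem by auto
  then show ?thesis using that[of "\<rho> \<bullet> \<pi>"] Epi_comp[OF p(1) Iso_Epi[OF r]] cls_eqI[OF p(1) r] p by simp
qed

text \<open>The choice of a representative is immaterial by \<open>pull_cls\<close>.\<close>

definition pull :: "'m \<Rightarrow> 'm set \<Rightarrow> 'm set" where
  "pull \<tau> x = cls ((SOME \<kappa>. \<kappa> \<in> x) \<bullet> \<tau>)"

lemma pull_cls:
  assumes t: "\<tau> \<in> Epi C H G" and k: "\<kappa> \<in> Epi C G F"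
  shows "pull \<tau> (cls \<kappa>) = cls (\<kappa> \<bullet> \<tau>)"
proof -
  have "(SOME \<kappa>'. \<kappa>' \<in> cls \<kappa>) \<in> cls \<kappa>" using self_cls[OF k] by (rule someI)
  then obtain F' \<rho> where r: "\<rho> \<in> Iso C F F'" "(SOME \<kappa>'. \<kappa>' \<in> cls \<kappa>) = \<rho> \<bullet> \<kappa>" using mem_cls[OF k] by blast
  have "(\<rho> \<bullet> \<kappa>) \<bullet> \<tau> = \<rho> \<bullet> (\<kappa> \<bullet> \<tau>)" using Comp_assoc[OF Epi_Hom[OF t] Epi_Hom[OF k] Iso_Hom[OF r(1)]] .
  then show ?thesis using cls_eqI[OF Epi_comp[OF t k] r(1)] r by (simp add: pull_def)
qed

lemma pull_car: "\<tau> \<in> Epi C H G \<Longrightarrow> x \<in> car G \<Longrightarrow> pull \<tau> x \<in> car H"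
  using car_iff pull_cls Epi_comp by metis

text \<open>The epimorphism \<tau> can be cancelled on the right of any factorisation.\<close>

lemma pull_le_iff:
  assumes t: "\<tau> \<in> Epi C H G" and x: "x \<in> car G" "y \<in> car G"
  shows "qle H (pull \<tau> x) (pull \<tau> y) \<longleftrightarrow> qle G x y"
proof -
  obtain F \<pi> where p: "\<pi> \<in> Epi C G F" "x = cls \<pi>" using x car_iff by blast
  obtain F' \<sigma> where s: "\<sigma> \<in> Epi C G F'" "y = cls \<sigma>" using x car_iff by blast
  have "h \<bullet> (\<sigma> \<bullet> \<tau>) = \<pi> \<bullet> \<tau> \<longleftrightarrow> h \<bullet> \<sigma> = \<pi>" if h: "h \<in> Epi C F' F" for h
  proof -
    have "h \<bullet> (\<sigma> \<bullet> \<tau>) = (h \<bullet> \<sigma>) \<bullet> \<tau>"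
      using Comp_assoc[OF Epi_Hom[OF t] Epi_Hom[OF s(1)] Epi_Hom[OF h]] by simp
    then show ?thesis
      using Epi_cancel[OF t Comp_closed[OF Epi_Hom[OF s(1)] Epi_Hom[OF h]] Epi_Hom[OF p(1)]] by auto
  qed
  then show ?thesis
    using p s pull_cls[OF t p(1)] pull_cls[OF t s(1)] cls_le_iff[OF p(1) s(1)]
      cls_le_iff[OF Epi_comp[OF t p(1)] Epi_comp[OF t s(1)]] by auto
qed

lemma pull_top: "\<tau> \<in> Epi C H G \<Longrightarrow> pull \<tau> (qtop G) = cls \<tau>"
  using pull_cls[OF _ ident_Epi] ident_Comp Epi_Hom Epi_Ob by metis

lemma pull_image:
  assumes t: "\<tau> \<in> Epi C H G" and z: "z \<in> car H" "qle H z (cls \<tau>)"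
  shows "z \<in> pull \<tau> ` car G"
proof -
  obtain F \<pi> where p: "\<pi> \<in> Epi C H F" "z = cls \<pi>" using z car_iff by blast
  then obtain h where "h \<in> Epi C G F" "h \<bullet> \<tau> = \<pi>" using z cls_le_iff[OF p(1) t] by auto
  then show ?thesis using pull_cls[OF t] p cls_car by (metis image_eqI)
qed

lemma quot_obj_pull: "\<tau> \<in> Epi C H G \<Longrightarrow> x \<in> car G \<Longrightarrow> quot_obj C (pull \<tau> x) = quot_obj C x"
  using car_iff pull_cls quot_obj_cls Epi_comp by metis

end

context diamond_category
begin

text \<open>A lattice supplies only binary meets; the least quotient is the meet of all of them and
  exists by finiteness.\<close>

definition qbot :: "'o \<Rightarrow> 'm set" where
  "qbot G = (SOME b. b \<in> car G \<and> (\<forall>x \<in> car G. qle G b x))"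

abbreviation "qjn G \<equiv> join (quot_poset C G)"
abbreviation "qmt G \<equiv> meet (quot_poset C G)"

lemma quot_bot:
  assumes G: "G \<in> Ob C"
  shows "qbot G \<in> car G \<and> (\<forall>x \<in> car G. qle G (qbot G) x)"
proof -
  interpret modular_lattice "quot_poset C G" by (rule modular_quotients[OF G])
  have "\<exists>b. b \<in> car G \<and> (\<forall>x \<in> S. qle G b x)" if "finite S" "S \<subseteq> car G" for S
    using that
  proof (induction S)
    case empty
    then show ?case using qtop_car[OF G] by blast
  next
    case (insert x S)
    then obtain b where b: "b \<in> car G" "\<forall>x \<in> S. qle G b x" by auto
    have "meet (quot_poset C G) x b \<in> car G \<and> (\<forall>y \<in> insert x S. qle G (meet (quot_poset C G) x b) y)"
      using b insert meet_left[of x b] meet_right[of x b] le_trans[of "meet (quot_poset C G) x b" b]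
      by (auto intro: meet_closed)
    then show ?case by blast
  qed
  then have "\<exists>b. b \<in> car G \<and> (\<forall>x \<in> car G. qle G b x)" using finite_quotients[OF G] by blast
  then show ?thesis unfolding qbot_def by (rule someI_ex)
qed

lemma quot_lattice:
  assumes G: "G \<in> Ob C"
  shows "mobius_lattice (car G) (qle G) (qjn G) (qmt G) (qbot G) (qtop G) (mobius (quot_poset C G))"
proof -
  interpret Q: modular_lattice "quot_poset C G" by (rule modular_quotients[OF G])
  show ?thesis
  proof (unfold_locales, goal_cases)
    case 1 show ?case by (rule finite_quotients[OF G])
  next
    case (3 x y) then show ?case using Q.le_antisym by blast
  next
    case (4 x y z) then show ?case using Q.le_trans by blast
  next
    case (7 x y z)
    then show ?case using Q.join_left[of x y] Q.join_right[of x y] Q.join_le[of x z y]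
        Q.le_trans[of x "qjn G x y" z] Q.le_trans[of y "qjn G x y" z] Q.join_closed[of x y] by blast
  next
    case (8 x y z)
    then show ?case using Q.meet_left[of x y] Q.meet_right[of x y] Q.meet_le[of z x y]
        Q.le_trans[of z "qmt G x y" x] Q.le_trans[of z "qmt G x y" y] Q.meet_closed[of x y] by blast
  next
    case (9 x y z)
    then show ?case using Q.modular[of x z y] by simp
  next
    case (14 a b)
    then show ?case by (intro mobius_sum Q.partial_order_axioms finite_quotients[OF G])
  qed (use quot_bot[OF G] qtop_car[OF G] qle_top[OF G] in \<open>auto intro: Q.join_closed Q.meet_closed\<close>)
qed

lemma quot_fml: "G \<in> Ob C \<Longrightarrow> finite_modular_lattice (car G) (qle G) (qjn G) (qmt G) (qbot G) (qtop G)"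
  by (rule mobius_lattice.axioms(1)[OF quot_lattice])

lemma pull_embedding:
  assumes t: "\<tau> \<in> Epi C H G"
  shows "lower_embedding (car G) (qle G) (qjn G) (qmt G) (qbot G) (qtop G)
    (car H) (qle H) (qjn H) (qmt H) (qbot H) (qtop H) (pull \<tau>)"
proof -
  have O: "H \<in> Ob C" "G \<in> Ob C" using Epi_Ob[OF t] by auto
  interpret L1: finite_modular_lattice "car G" "qle G" "qjn G" "qmt G" "qbot G" "qtop G" by (rule quot_fml[OF O(2)])
  interpret L2: finite_modular_lattice "car H" "qle H" "qjn H" "qmt H" "qbot H" "qtop H" by (rule quot_fml[OF O(1)])
  show ?thesis
  proof unfold_locales
    fix z x assume z: "z \<in> car H" "x \<in> car G" "qle H z (pull \<tau> x)"
    have "qle H (pull \<tau> x) (cls \<tau>)" using pull_le_iff[OF t z(2) qtop_car[OF O(2)]] pull_top[OF t] qle_top[OF O(2) z(2)] by simp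
    then have "qle H z (cls \<tau>)" using L2.trans[OF z(1) pull_car[OF t z(2)] cls_car[OF t] z(3)] by blast
    then show "z \<in> pull \<tau> ` car G" using pull_image[OF t z(1)] by blast
  qed (use pull_car[OF t] pull_le_iff[OF t] in auto)
qed

lemma pull_bot:
  assumes t: "\<tau> \<in> Epi C H G"
  shows "pull \<tau> (qbot G) = qbot H"
proof -
  have O: "H \<in> Ob C" "G \<in> Ob C" using Epi_Ob[OF t] by auto
  interpret L: lower_embedding "car G" "qle G" "qjn G" "qmt G" "qbot G" "qtop G"
    "car H" "qle H" "qjn H" "qmt H" "qbot H" "qtop H" "pull \<tau>" by (rule pull_embedding[OF t])
  obtain x where x: "x \<in> car G" "qbot H = pull \<tau> x"
    using L.lower[of "qbot H" "qtop G"] L.closed by auto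
  then have "qle G x (qbot G)" using L.le_iff[of x "qbot G"] L.closed[of "qbot G"] L.L2.bt_le by force
  then have "x = qbot G" using L.L1.antisym x by simp
  then show ?thesis using x by simp
qed

lemma mobius_pull:
  assumes t: "\<tau> \<in> Epi C H G" and a: "a \<in> car G" "b \<in> car G" "qle G a b"
  shows "mobius (quot_poset C G) a b = mobius (quot_poset C H) (pull \<tau> a) (pull \<tau> b)"
proof -
  have O: "H \<in> Ob C" "G \<in> Ob C" using Epi_Ob[OF t] by auto
  interpret L: lower_embedding "car G" "qle G" "qjn G" "qmt G" "qbot G" "qtop G"
    "car H" "qle H" "qjn H" "qmt H" "qbot H" "qtop H" "pull \<tau>" by (rule pull_embedding[OF t])
  show ?thesis
    using mobius_iso[OF quot_lattice[OF O(2)] quot_lattice[OF O(1)] a L.bij_int] a L.le_iff by blast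
qed

lemma finite_car: "G \<in> Ob C \<Longrightarrow> finite (car G)"
  by (rule finite_quotients)

lemma card_Aut_pos: "G \<in> Ob C \<Longrightarrow> card (Aut C G) > 0"
  using ident_Iso finite_Aut by (auto simp: card_gt_0_iff)

text \<open>The automorphisms of F act simply transitively on the epimorphisms to F in one class:
  freely by cancellation, transitively by the definition of the class.\<close>

lemma card_fibre:
  assumes x: "x \<in> car G" and F: "F \<in> quot_obj C x"
  shows "card {\<tau> \<in> Epi C G F. cls \<tau> = x} = card (Aut C F)"
proof -
  obtain \<tau> where t: "\<tau> \<in> Epi C G F" "x = cls \<tau>" using ex_rep[OF x F] by blast
  have "bij_betw (\<lambda>\<alpha>. \<alpha> \<bullet> \<tau>) (Aut C F) {\<tau> \<in> Epi C G F. cls \<tau> = x}"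
    unfolding bij_betw_def
  proof
    show "inj_on (\<lambda>\<alpha>. \<alpha> \<bullet> \<tau>) (Aut C F)"
      by (rule inj_onI) (use Epi_cancel[OF t(1)] Iso_Hom in blast)
    show "(\<lambda>\<alpha>. \<alpha> \<bullet> \<tau>) ` Aut C F = {\<tau> \<in> Epi C G F. cls \<tau> = x}"
    proof (intro equalityI subsetI)
      fix \<sigma> assume "\<sigma> \<in> (\<lambda>\<alpha>. \<alpha> \<bullet> \<tau>) ` Aut C F"
      then show "\<sigma> \<in> {\<tau> \<in> Epi C G F. cls \<tau> = x}" using t Epi_comp[OF t(1) Iso_Epi] cls_eqI[OF t(1)] by auto
    next
      fix \<sigma> assume "\<sigma> \<in> {\<tau> \<in> Epi C G F. cls \<tau> = x}"
      then show "\<sigma> \<in> (\<lambda>\<alpha>. \<alpha> \<bullet> \<tau>) ` Aut C F" using cls_eq_iff[OF t(1), of \<sigma> F] t by auto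
    qed
  qed
  then show ?thesis by (simp add: bij_betw_same_card)
qed

end

section \<open>Formations and levels\<close>

context diamond_category
begin

lemma least_join:
  assumes G: "G \<in> Ob C" and x: "x \<in> car G" "y \<in> car G"
  shows "least (quot_poset C G) (qjn G x y) (Upper (quot_poset C G) {x, y})"
proof -
  interpret Q: finite_modular_lattice "car G" "qle G" "qjn G" "qmt G" "qbot G" "qtop G" by (rule quot_fml[OF G])
  show ?thesis using x by (auto simp: least_def Upper_def Q.jn_le_iff)
qed

lemma least_join_unique:
  assumes G: "G \<in> Ob C" and x: "x \<in> car G" "y \<in> car G"
    and j: "least (quot_poset C G) j (Upper (quot_poset C G) {x, y})"
  shows "j = qjn G x y"
proof -
  interpret Q: finite_modular_lattice "car G" "qle G" "qjn G" "qmt G" "qbot G" "qtop G" by (rule quot_fml[OF G])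
  show ?thesis
    using x j least_join[OF G x] Q.antisym[of j "qjn G x y"] by (auto simp: least_def Upper_def)
qed

text \<open>In the lattice of quotients the least upper bound of x and y always exists and is
  unique, so join-closedness may speak of \<open>qjn\<close> directly.\<close>

lemma formation_iff: "formation C S \<longleftrightarrow> S \<subseteq> iso_classes C \<and> minimal_classes C \<subseteq> S \<and>
    (\<forall>\<gamma> \<in> S. \<forall>G \<in> \<gamma>. \<forall>x \<in> car G. quot_obj C x \<in> S) \<and>
    (\<forall>G \<in> Ob C. \<forall>x \<in> car G. \<forall>y \<in> car G. quot_obj C x \<in> S \<longrightarrow> quot_obj C y \<in> S \<longrightarrow> quot_obj C (qjn G x y) \<in> S)"
proof -
  have "join_closed C S \<longleftrightarrow>
    (\<forall>G \<in> Ob C. \<forall>x \<in> car G. \<forall>y \<in> car G. quot_obj C x \<in> S \<longrightarrow> quot_obj C y \<in> S \<longrightarrow> quot_obj C (qjn G x y) \<in> S)"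
    unfolding join_closed_def using least_join least_join_unique by metis
  then show ?thesis by (auto simp: formation_def downward_closed_def)
qed

text \<open>Guarantees that the family of formations containing a given set is nonempty, so that its
  hull is an intersection of formations and thus a formation.\<close>

lemma formation_iso_classes: "formation C (iso_classes C)"
proof -
  have "qjn G x y \<in> car G" if "G \<in> Ob C" "x \<in> car G" "y \<in> car G" for G x y
    using finite_modular_lattice.jn_closed[OF quot_fml] that by blast
  moreover have "minimal_classes C \<subseteq> iso_classes C" by (auto simp: minimal_classes_def)
  ultimately show ?thesis unfolding formation_iff by (meson order_refl quot_obj_iso)
qed

lemma formation_sub: "formation C L \<Longrightarrow> L \<subseteq> iso_classes C"
  by (simp add: formation_def)

lemma formation_quot: "formation C S \<Longrightarrow> \<gamma> \<in> S \<Longrightarrow> G \<in> \<gamma> \<Longrightarrow> x \<in> car G \<Longrightarrow> quot_obj C x \<in> S"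
  by (simp add: formation_iff)

lemma formation_jn: "formation C S \<Longrightarrow> G \<in> Ob C \<Longrightarrow> x \<in> car G \<Longrightarrow> y \<in> car G \<Longrightarrow>
    quot_obj C x \<in> S \<Longrightarrow> quot_obj C y \<in> S \<Longrightarrow> quot_obj C (qjn G x y) \<in> S"
  by (simp add: formation_iff)

lemma formation_Inter:
  assumes "\<F> \<noteq> {}" and S: "\<And>S. S \<in> \<F> \<Longrightarrow> formation C S"
  shows "formation C (\<Inter>\<F>)"
  unfolding formation_iff
proof (intro conjI ballI impI)
  show "\<Inter>\<F> \<subseteq> iso_classes C" using assms(1) formation_sub[OF S] by blast
  show "minimal_classes C \<subseteq> \<Inter>\<F>" using S by (intro Inter_greatest) (simp add: formation_def)
  show "quot_obj C x \<in> \<Inter>\<F>" if "\<gamma> \<in> \<Inter>\<F>" "G \<in> \<gamma>" "x \<in> car G" for \<gamma> G x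
    using that formation_quot[OF S] by blast
  show "quot_obj C (qjn G x y) \<in> \<Inter>\<F>" if "G \<in> Ob C" "x \<in> car G" "y \<in> car G"
    "quot_obj C x \<in> \<Inter>\<F>" "quot_obj C y \<in> \<Inter>\<F>" for G x y
    using that formation_jn[OF S] by blast
qed

lemma formation_Int: "formation C S \<Longrightarrow> formation C T \<Longrightarrow> formation C (S \<inter> T)"
  using formation_Inter[of "{S, T}"] by auto

lemma formation_hull: "B \<subseteq> iso_classes C \<Longrightarrow> formation C (formation C hull B)"
  unfolding hull_def by (rule formation_Inter) (use formation_iso_classes in auto)

lemma level_formation: "L \<in> levels C \<Longrightarrow> formation C L"
  unfolding levels_def using formation_hull by blast

lemma level_sub: "L \<in> levels C \<Longrightarrow> L \<subseteq> iso_classes C"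
  using level_formation formation_sub by blast

lemma hull_level: "G \<in> iso_classes C \<Longrightarrow> formation C hull {G} \<in> levels C"
  unfolding levels_def by blast

lemma mem_hull: "G \<in> formation C hull {G}"
  using hull_subset by fastforce

lemma hull_sub: "formation C L \<Longrightarrow> G \<in> L \<Longrightarrow> formation C hull {G} \<subseteq> L"
  by (rule hull_minimal) auto

lemma level_ex: "\<exists>L. L \<in> levels C"
  unfolding levels_def by blast

lemma levels_directed:
  assumes "L1 \<in> levels C" "L2 \<in> levels C"
  obtains L where "L \<in> levels C" "L1 \<subseteq> L" "L2 \<subseteq> L"
proof -
  obtain B1 B2 where B: "finite B1" "B1 \<subseteq> iso_classes C" "L1 = formation C hull B1"
    "finite B2" "B2 \<subseteq> iso_classes C" "L2 = formation C hull B2" using assms by (auto simp: levels_def)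
  have "formation C hull (B1 \<union> B2) \<in> levels C" using B by (auto simp: levels_def)
  moreover have "L1 \<subseteq> formation C hull (B1 \<union> B2)" "L2 \<subseteq> formation C hull (B1 \<union> B2)"
    using B by (auto intro: hull_mono[THEN subsetD, rotated])
  ultimately show ?thesis using that by blast
qed

lemma Epi_formation:
  assumes "formation C L" "icls G \<in> L" "\<pi> \<in> Epi C G F"
  shows "icls F \<in> L"
proof -
  have "G \<in> icls G" using Epi_Ob[OF assms(3)] ident_Iso icls_mem by blast
  then show ?thesis
    using formation_quot[OF assms(1,2) _ cls_car[OF assms(3)]] quot_obj_cls[OF assms(3)] by simp
qed

text \<open>Quotients of the least quotient pull back to quotients below it, so its top and bottom
  coincide. Hence every formation contains at least one quotient of any object.\<close>

lemma bot_minimal: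
  assumes G: "G \<in> Ob C"
  shows "quot_obj C (qbot G) \<in> minimal_classes C"
proof -
  interpret Q: finite_modular_lattice "car G" "qle G" "qjn G" "qmt G" "qbot G" "qtop G" by (rule quot_fml[OF G])
  have "minimal_obj C F" if F: "F \<in> quot_obj C (qbot G)" for F
  proof -
    obtain \<tau> where t: "\<tau> \<in> Epi C G F" "qbot G = cls \<tau>" using ex_rep[OF Q.bt_closed F] by blast
    have FO: "F \<in> Ob C" using Epi_Ob t by blast
    interpret L: lower_embedding "car F" "qle F" "qjn F" "qmt F" "qbot F" "qtop F"
      "car G" "qle G" "qjn G" "qmt G" "qbot G" "qtop G" "pull \<tau>" by (rule pull_embedding[OF t(1)])
    have "qbot F = qtop F" using L.eq_iff[of "qbot F" "qtop F"] pull_top[OF t(1)] pull_bot[OF t(1)] t by simp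
    then have "car F = {qtop F}" 
      using L.L1.bt_le L.L1.le_tp L.L1.antisym[of _ "qtop F"] by force
    then show ?thesis using FO by (simp add: minimal_obj_def)
  qed
  then show ?thesis using quot_obj_iso[OF Q.bt_closed] by (auto simp: minimal_classes_def)
qed

section \<open>Maximal quotients in a formation\<close>

definition maxq :: "'o set set \<Rightarrow> 'o \<Rightarrow> 'm set" where
  "maxq L G = (SOME z. z \<in> car G \<and> quot_obj C z \<in> L \<and> (\<forall>y \<in> car G. quot_obj C y \<in> L \<longrightarrow> qle G y z))"

lemma maxq:
  assumes L: "formation C L" and G: "G \<in> Ob C"
  shows maxq_car: "maxq L G \<in> car G" and maxq_obj: "quot_obj C (maxq L G) \<in> L"
    and maxq_ge: "y \<in> car G \<Longrightarrow> quot_obj C y \<in> L \<Longrightarrow> qle G y (maxq L G)"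
proof -
  interpret Q: finite_modular_lattice "car G" "qle G" "qjn G" "qmt G" "qbot G" "qtop G" by (rule quot_fml[OF G])
  have "\<exists>z. z \<in> car G \<and> quot_obj C z \<in> L \<and> (\<forall>y \<in> S. qle G y z)"
    if "finite S" "S \<subseteq> {y \<in> car G. quot_obj C y \<in> L}" for S
    using that
  proof (induction S)
    case empty
    have "quot_obj C (qbot G) \<in> L" using bot_minimal[OF G] L by (auto simp: formation_def)
    then show ?case using Q.bt_closed by blast
  next
    case (insert x S)
    then obtain z where z: "z \<in> car G" "quot_obj C z \<in> L" "\<forall>y \<in> S. qle G y z" by auto
    have "qjn G x z \<in> car G" using insert z by auto
    moreover have "quot_obj C (qjn G x z) \<in> L" using formation_jn[OF L G _ z(1) _ z(2)] insert by auto
    moreover have "\<forall>y \<in> insert x S. qle G y (qjn G x z)" using insert z Q.le_jn2[of x z] by auto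
    ultimately show ?case by blast
  qed
  from this[of "{y \<in> car G. quot_obj C y \<in> L}"]
  have "\<exists>z. z \<in> car G \<and> quot_obj C z \<in> L \<and> (\<forall>y \<in> car G. quot_obj C y \<in> L \<longrightarrow> qle G y z)"
    using Q.finite_carrier by auto
  from someI_ex[OF this, folded maxq_def]
  show "maxq L G \<in> car G" "quot_obj C (maxq L G) \<in> L"
    "y \<in> car G \<Longrightarrow> quot_obj C y \<in> L \<Longrightarrow> qle G y (maxq L G)" by auto
qed

lemma maxq_eqI:
  assumes L: "formation C L" and G: "G \<in> Ob C" and z: "z \<in> car G" "quot_obj C z \<in> L"
    "\<And>y. y \<in> car G \<Longrightarrow> quot_obj C y \<in> L \<Longrightarrow> qle G y z"
  shows "maxq L G = z"
proof -
  interpret Q: finite_modular_lattice "car G" "qle G" "qjn G" "qmt G" "qbot G" "qtop G" by (rule quot_fml[OF G])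
  show ?thesis using maxq[OF L G] z Q.antisym by blast
qed

lemma maxq_mono:
  assumes "formation C L" "formation C L'" "L \<subseteq> L'" "G \<in> Ob C"
  shows "qle G (maxq L G) (maxq L' G)"
  using maxq[OF assms(1,4)] maxq_ge[OF assms(2,4)] assms(3) by blast

lemma level_quot_rep:
  assumes L: "formation C L" and g: "\<gamma> \<in> iso_classes C"
  shows "level_quot C L \<gamma> = quot_obj C (maxq L (rep \<gamma>))"
proof -
  let ?G = "rep \<gamma>" let ?Q = "quot_poset C ?G" let ?S = "{x \<in> car ?G. quot_obj C x \<in> L}"
  have G: "?G \<in> Ob C" using rep_Ob[OF g] .
  interpret Q: finite_modular_lattice "car ?G" "qle ?G" "qjn ?G" "qmt ?G" "qbot ?G" "qtop ?G" by (rule quot_fml[OF G])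
  note m = maxq[OF L G]
  have 1: "least ?Q (maxq L ?G) (Upper ?Q ?S)"
    using m by (auto simp: least_def Upper_def)
  have 2: "x = maxq L ?G" if "least ?Q x (Upper ?Q ?S)" for x
    using that 1 m Q.antisym[of x "maxq L ?G"] by (auto simp: least_def)
  have "Lattice.sup ?Q ?S = maxq L ?G" unfolding Lattice.sup_def
    by (rule some_equality[where P = "\<lambda>x. least ?Q x (Upper ?Q ?S)", OF 1 2])
  then show ?thesis by (simp add: level_quot_def Let_def)
qed

text \<open>If all quotients of H in L factor through \<tau>, they may be computed on the target of
  \<tau>. Used when \<tau> is an isomorphism and when \<tau> is the maximal quotient in a larger
  formation.\<close>

lemma maxq_pull:
  assumes L: "formation C L" and t: "\<tau> \<in> Epi C H G"
    and ge: "\<And>y. y \<in> car H \<Longrightarrow> quot_obj C y \<in> L \<Longrightarrow> qle H y (cls \<tau>)"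
  shows "maxq L H = pull \<tau> (maxq L G)"
proof (rule maxq_eqI[OF L])
  have O: "H \<in> Ob C" "G \<in> Ob C" using Epi_Ob[OF t] by auto
  note m = maxq[OF L O(2)]
  show "H \<in> Ob C" "pull \<tau> (maxq L G) \<in> car H" "quot_obj C (pull \<tau> (maxq L G)) \<in> L"
    using O pull_car[OF t m(1)] quot_obj_pull[OF t m(1)] m by auto
  fix y assume y: "y \<in> car H" "quot_obj C y \<in> L"
  then obtain x where x: "x \<in> car G" "y = pull \<tau> x" using pull_image[OF t] ge by blast
  then show "qle H y (pull \<tau> (maxq L G))" using pull_le_iff[OF t x(1) m(1)] m(3) y quot_obj_pull[OF t] by auto
qed

lemma level_quot_eq:
  assumes L: "formation C L" and G: "G \<in> Ob C"
  shows "level_quot C L (icls G) = quot_obj C (maxq L G)"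
proof -
  have g: "icls G \<in> iso_classes C" using icls_iso G .
  have "rep (icls G) \<in> icls G" using rep_mem[OF g] .
  then obtain \<rho> where r: "\<rho> \<in> Iso C G (rep (icls G))" using icls_mem by blast
  have "maxq L G = pull \<rho> (maxq L (rep (icls G)))"
    using maxq_pull[OF L Iso_Epi[OF r]] cls_top_iff[OF Iso_Epi[OF r]] r qle_top[OF G] by simp
  then show ?thesis
    using quot_obj_pull[OF Iso_Epi[OF r]] maxq_car[OF L rep_Ob[OF g]] level_quot_rep[OF L g] by simp
qed

lemma level_quot_mem: "formation C L \<Longrightarrow> \<gamma> \<in> iso_classes C \<Longrightarrow> level_quot C L \<gamma> \<in> L"
  using level_quot_rep maxq_obj rep_Ob by metis

lemma level_quot_self:
  assumes L: "formation C L" and g: "\<gamma> \<in> L"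
  shows "level_quot C L \<gamma> = \<gamma>"
proof -
  have i: "\<gamma> \<in> iso_classes C" using g formation_sub[OF L] by blast
  let ?G = "rep \<gamma>"
  have G: "?G \<in> Ob C" using rep_Ob[OF i] .
  have o: "quot_obj C (qtop ?G) = \<gamma>" using quot_obj_cls[OF ident_Epi[OF G]] icls_rep[OF i] by simp
  have "maxq L ?G = qtop ?G"
    by (rule maxq_eqI[OF L G]) (use qtop_car[OF G] qle_top[OF G] o g in auto)
  then show ?thesis using level_quot_rep[OF L i] o by simp
qed

lemma level_quot_epi:
  assumes L: "formation C L" and g: "\<gamma> \<in> iso_classes C" and H: "H \<in> Ob C" "icls H = \<gamma>"
  obtains \<tau> where "\<tau> \<in> Epi C H (rep (level_quot C L \<gamma>))" "cls \<tau> = maxq L H"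
proof -
  have "level_quot C L \<gamma> = quot_obj C (maxq L H)" using level_quot_eq[OF L H(1)] H by simp
  moreover have "rep (level_quot C L \<gamma>) \<in> level_quot C L \<gamma>"
    using rep_mem level_quot_mem[OF L g] formation_sub[OF L] by blast
  ultimately show ?thesis using ex_rep[OF maxq_car[OF L H(1)]] that by metis
qed

lemma level_quot_trans:
  assumes L: "formation C L" and L': "formation C L'" and sub: "L \<subseteq> L'" and g: "\<gamma> \<in> iso_classes C"
  shows "level_quot C L (level_quot C L' \<gamma>) = level_quot C L \<gamma>"
proof -
  let ?H = "rep \<gamma>" let ?\<delta> = "level_quot C L' \<gamma>"
  have H: "?H \<in> Ob C" using rep_Ob[OF g] .
  have d: "?\<delta> \<in> iso_classes C" using level_quot_mem[OF L' g] formation_sub[OF L'] by blast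
  obtain \<tau> where t: "\<tau> \<in> Epi C ?H (rep ?\<delta>)" "cls \<tau> = maxq L' ?H"
    using level_quot_epi[OF L' g H icls_rep[OF g]] .
  have "maxq L ?H = pull \<tau> (maxq L (rep ?\<delta>))"
    by (rule maxq_pull[OF L t(1)]) (use maxq_ge[OF L' H] sub t in auto)
  then show ?thesis
    using level_quot_rep[OF L g] level_quot_rep[OF L d] quot_obj_pull[OF t(1) maxq_car[OF L rep_Ob[OF d]]] by simp
qed

text \<open>Every epimorphism to an object of L factors uniquely through the maximal quotient in L.
  This is why the number of epimorphisms from a pro-isomorphism class does not depend on the
  level.\<close>

lemma card_Epi_level_quot:
  assumes L: "formation C L" and g: "\<gamma> \<in> iso_classes C" and F: "F \<in> L"
  shows "card (Epi C (rep (level_quot C L \<gamma>)) (rep F)) = card (Epi C (rep \<gamma>) (rep F))"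
proof -
  let ?H = "rep \<gamma>" let ?\<delta> = "level_quot C L \<gamma>"
  have H: "?H \<in> Ob C" using rep_Ob[OF g] .
  have Fi: "F \<in> iso_classes C" using F formation_sub[OF L] by blast
  obtain \<tau> where t: "\<tau> \<in> Epi C ?H (rep ?\<delta>)" "cls \<tau> = maxq L ?H"
    using level_quot_epi[OF L g H icls_rep[OF g]] .
  have "bij_betw (\<lambda>h. h \<bullet> \<tau>) (Epi C (rep ?\<delta>) (rep F)) (Epi C ?H (rep F))"
    unfolding bij_betw_def
  proof
    show "inj_on (\<lambda>h. h \<bullet> \<tau>) (Epi C (rep ?\<delta>) (rep F))"
      by (rule inj_onI) (use Epi_cancel[OF t(1)] Epi_Hom in blast)
    show "(\<lambda>h. h \<bullet> \<tau>) ` Epi C (rep ?\<delta>) (rep F) = Epi C ?H (rep F)"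
    proof (intro equalityI subsetI)
      fix \<sigma> assume s: "\<sigma> \<in> Epi C ?H (rep F)"
      have "quot_obj C (cls \<sigma>) \<in> L" using quot_obj_cls[OF s] icls_rep[OF Fi] F by simp
      then have "qle ?H (cls \<sigma>) (cls \<tau>)" using maxq_ge[OF L H cls_car[OF s]] t by simp
      then show "\<sigma> \<in> (\<lambda>h. h \<bullet> \<tau>) ` Epi C (rep ?\<delta>) (rep F)" using cls_le_iff[OF s t(1)] by auto
    qed (use Epi_comp[OF t(1)] in auto)
  qed
  then show ?thesis by (rule bij_betw_same_card)
qed

subsection \<open>Levels have bounded Loewy length and are countable\<close>

abbreviation "qloewy G \<equiv> finite_modular_lattice.loewy (car G) (qle G)"
abbreviation "qcov G \<equiv> finite_modular_lattice.cov (car G) (qle G)"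
abbreviation "qSoc G \<equiv> finite_modular_lattice.Soc (car G) (qle G)"
abbreviation "qss G \<equiv> finite_modular_lattice.ss (car G) (qle G)"

lemma loewy_cls:
  assumes t: "\<tau> \<in> Epi C H G"
  shows "qloewy G r (qbot G) (qtop G) \<longleftrightarrow> qloewy H r (qbot H) (cls \<tau>)"
proof -
  interpret L: lower_embedding "car G" "qle G" "qjn G" "qmt G" "qbot G" "qtop G"
    "car H" "qle H" "qjn H" "qmt H" "qbot H" "qtop H" "pull \<tau>" by (rule pull_embedding[OF t])
  show ?thesis using L.loewy_iff[of "qbot G" "qtop G"] pull_bot[OF t] pull_top[OF t] by simp
qed

definition loewy_classes :: "nat \<Rightarrow> 'o set set" where
  "loewy_classes r = {\<gamma> \<in> iso_classes C. \<forall>G \<in> \<gamma>. qloewy G r (qbot G) (qtop G)}"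

lemma quot_obj_loewy:
  assumes G: "G \<in> Ob C" and x: "x \<in> car G"
  shows "quot_obj C x \<in> loewy_classes r \<longleftrightarrow> qloewy G r (qbot G) x"
proof -
  have "(\<exists>F. F \<in> quot_obj C x)"
    using x quot_obj_iso rep_mem by blast
  moreover have "qloewy F r (qbot F) (qtop F) \<longleftrightarrow> qloewy G r (qbot G) x" if "F \<in> quot_obj C x" for F
    using ex_rep[OF x that] loewy_cls by metis
  ultimately show ?thesis using quot_obj_iso[OF x] by (auto simp: loewy_classes_def)
qed

text \<open>Bounded Loewy length passes to quotients (\<open>loewy_lower\<close>) and joins
  (\<open>loewy_jn2\<close>). A finite generating set lies in one of these formations, hence so does
  the level it generates.\<close>

lemma formation_loewy: "formation C (loewy_classes r)"
  unfolding formation_iff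
proof (intro conjI ballI impI subsetI)
  fix \<gamma> assume g: "\<gamma> \<in> minimal_classes C"
  have "qloewy G r (qbot G) (qtop G)" if G: "G \<in> \<gamma>" for G
  proof -
    have GO: "G \<in> Ob C" "car G = {qtop G}" using g G by (auto simp: minimal_classes_def minimal_obj_def)
    interpret Q: finite_modular_lattice "car G" "qle G" "qjn G" "qmt G" "qbot G" "qtop G" by (rule quot_fml[OF GO(1)])
    have "qbot G = qtop G" using Q.bt_closed GO(2) by auto
    then have "Q.loewy 0 (qbot G) (qtop G)" by simp
    then show ?thesis using Q.loewy_mono[of "qbot G" "qtop G" 0 r] by auto
  qed
  then show "\<gamma> \<in> loewy_classes r" using g by (auto simp: loewy_classes_def minimal_classes_def)
next
  fix \<gamma> G x assume g: "\<gamma> \<in> loewy_classes r" "G \<in> \<gamma>" "x \<in> car G"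
  have GO: "G \<in> Ob C" using g iso_class_mem by (auto simp: loewy_classes_def)
  interpret Q: finite_modular_lattice "car G" "qle G" "qjn G" "qmt G" "qbot G" "qtop G" by (rule quot_fml[OF GO(1)])
  have "Q.loewy r (qbot G) (qtop G)" using g by (auto simp: loewy_classes_def)
  then have "Q.loewy r (qbot G) x" using Q.loewy_lower[of "qbot G" "qtop G" x r] g by auto
  then show "quot_obj C x \<in> loewy_classes r" using quot_obj_loewy[OF GO g(3)] by simp
next
  fix G x y assume G: "G \<in> Ob C" and x: "x \<in> car G" "y \<in> car G"
    and l: "quot_obj C x \<in> loewy_classes r" "quot_obj C y \<in> loewy_classes r"
  interpret Q: finite_modular_lattice "car G" "qle G" "qjn G" "qmt G" "qbot G" "qtop G" by (rule quot_fml[OF G])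
  have "Q.loewy r (qbot G) (qjn G x y)"
    using Q.loewy_jn2[of "qbot G" x y r] x l quot_obj_loewy[OF G] by auto
  then show "quot_obj C (qjn G x y) \<in> loewy_classes r" using quot_obj_loewy[OF G] x by auto
qed (auto simp: loewy_classes_def)

lemma loewy_class_ex:
  assumes g: "\<gamma> \<in> iso_classes C"
  shows "\<exists>r. \<gamma> \<in> loewy_classes r"
proof -
  let ?G = "rep \<gamma>"
  have G: "?G \<in> Ob C" using rep_Ob[OF g] .
  interpret Q: finite_modular_lattice "car ?G" "qle ?G" "qjn ?G" "qmt ?G" "qbot ?G" "qtop ?G" by (rule quot_fml[OF G])
  obtain r where "Q.loewy r (qbot ?G) (qtop ?G)" using Q.loewy_ex[of "qbot ?G" "qtop ?G"] by auto
  then have "quot_obj C (qtop ?G) \<in> loewy_classes r" using quot_obj_loewy[OF G Q.tp_closed] by simp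
  then show ?thesis using quot_obj_cls[OF ident_Epi[OF G]] icls_rep[OF g] by auto
qed

lemma loewy_classes_mono:
  assumes "r \<le> s" shows "loewy_classes r \<subseteq> loewy_classes s"
proof -
  have "qloewy G s (qbot G) (qtop G)" if "G \<in> Ob C" "qloewy G r (qbot G) (qtop G)" for G
    using finite_modular_lattice.loewy_mono[OF quot_fml[OF that(1)] _ _ that(2) assms]
      finite_modular_lattice.bt_closed[OF quot_fml[OF that(1)]] qtop_car[OF that(1)] by blast
  then show ?thesis using iso_class_mem by (auto simp: loewy_classes_def)
qed

lemma level_loewy:
  assumes "L \<in> levels C"
  shows "\<exists>r. L \<subseteq> loewy_classes r"
proof -
  obtain B where B: "finite B" "B \<subseteq> iso_classes C" "L = formation C hull B" using assms by (auto simp: levels_def)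
  have "\<exists>r. B \<subseteq> loewy_classes r"
    using B(1,2)
  proof (induction B)
    case (insert b B)
    then obtain r s where "B \<subseteq> loewy_classes r" "b \<in> loewy_classes s"
      using loewy_class_ex[of b] by blast
    then have "insert b B \<subseteq> loewy_classes (max r s)"
      using loewy_classes_mono[of r "max r s"] loewy_classes_mono[of s "max r s"] by auto
    then show ?case by blast
  qed auto
  then show ?thesis using B hull_minimal[of B _ "formation C"] formation_loewy by blast
qed

text \<open>Translates covers in the lattice of quotients into simple epimorphisms, the notion to
  which the finiteness axiom of a diamond category refers.\<close>

lemma cov_simple_epi:
  assumes G: "G \<in> Ob C" and t: "\<tau> \<in> Epi C G H" and e: "\<sigma> \<in> Epi C G F" and c: "qcov G (cls \<sigma>) (cls \<tau>)"
  obtains h where "simple_epi C H F h" "h \<bullet> \<tau> = \<sigma>"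
proof -
  have O: "H \<in> Ob C" "F \<in> Ob C" using Epi_Ob t e by blast+
  interpret L: lower_embedding "car H" "qle H" "qjn H" "qmt H" "qbot H" "qtop H"
    "car G" "qle G" "qjn G" "qmt G" "qbot G" "qtop G" "pull \<tau>" by (rule pull_embedding[OF t])
  obtain h where h: "h \<in> Epi C H F" "h \<bullet> \<tau> = \<sigma>" using L.L2.covD(3)[OF c] cls_le_iff[OF e t] by auto
  have p: "pull \<tau> (cls h) = cls \<sigma>" "pull \<tau> (qtop H) = cls \<tau>" using pull_cls[OF t h(1)] h pull_top[OF t] by auto
  have cv: "L.L1.cov (cls h) (qtop H)" using L.cov_iff[OF cls_car[OF h(1)] qtop_car[OF O(1)]] c p by simp
  have "quot_interval C h = {cls h, qtop H}"
    using L.L1.covD[OF cv] cls_car[OF h(1)] by (auto simp: quot_interval_def Epi_dom[OF h(1)])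
  moreover have "h \<notin> Iso C H F" using cls_top_iff[OF h(1)] L.L1.covD[OF cv] by auto
  ultimately have "simple_epi C H F h" using h by (auto simp: simple_epi_def)
  then show ?thesis using that h by blast
qed

text \<open>Every object of the level is reached from a minimal one by finitely many simple
  epimorphisms inside the level, and each object is the target of only finitely many of these, up to
  isomorphism of their sources.\<close>

lemma level_countable:
  assumes L: "L \<in> levels C"
  shows "countable L"
proof -
  note Lf = level_formation[OF L]
  \<comment> \<open>Only classes in L are extended, since finiteness of the set of simple
    epimorphisms is known only there.\<close>
  define ext where "ext S = S \<union> (\<Union>\<gamma> \<in> S \<inter> L. {\<eta> \<in> L. \<exists>H \<in> \<eta>. \<exists>G \<in> \<gamma>. \<exists>\<pi>. simple_epi C H G \<pi>})" for S
  have cext: "countable (ext S)" if "countable S" for S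
    unfolding ext_def using that finite_simple_epi[OF L] by (intro countable_Un countable_UN) (auto intro: countable_finite)
  have c: "countable ((ext ^^ n) (minimal_classes C))" for n
    by (induction n) (auto simp: countable_minimal cext)
  have "icls G \<in> (\<Union>n. (ext ^^ n) (minimal_classes C))" if "G \<in> Ob C" "icls G \<in> L" for G
    using that
  proof (induction "card (car G)" arbitrary: G rule: less_induct)
    case (less G)
    interpret Q: finite_modular_lattice "car G" "qle G" "qjn G" "qmt G" "qbot G" "qtop G" by (rule quot_fml[OF less(2)])
    show ?case
    proof (cases "qbot G = qtop G")
      case True
      then have "icls G = quot_obj C (qbot G)" using quot_obj_cls[OF ident_Epi[OF less(2)]] by simp
      then have "icls G \<in> (ext ^^ 0) (minimal_classes C)" using bot_minimal[OF less(2)] by simp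
      then show ?thesis by blast
    next
      case False
      \<comment> \<open>A maximal proper quotient. The epimorphism onto it is simple, and it has
        fewer quotients than G, so the induction hypothesis applies.\<close>
      obtain x where x: "x \<in> {x \<in> car G. x \<noteq> qtop G}" "\<forall>y \<in> {x \<in> car G. x \<noteq> qtop G}. qle G x y \<longrightarrow> y = x"
        using Q.ex_max[of "{x \<in> car G. x \<noteq> qtop G}"] False Q.bt_closed by blast
      have cv: "Q.cov x (qtop G)" using x by (auto simp: Q.cov_def)
      have "x \<in> car G" using x(1) by simp
      then obtain F \<sigma> where s: "\<sigma> \<in> Epi C G F" "x = cls \<sigma>" using car_iff by blast
      obtain h where h: "simple_epi C G F h"
        using cov_simple_epi[OF less(2) ident_Epi[OF less(2)] s(1)] cv s by auto
      have FO: "F \<in> Ob C" using Epi_Ob s by blast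
      have FL: "icls F \<in> L" using Epi_formation[OF Lf less(3) s(1)] .
      interpret L: lower_embedding "car F" "qle F" "qjn F" "qmt F" "qbot F" "qtop F"
        "car G" "qle G" "qjn G" "qmt G" "qbot G" "qtop G" "pull \<sigma>" by (rule pull_embedding[OF s(1)])
      have "pull \<sigma> ` car F \<subseteq> car G - {qtop G}"
      proof
        fix z assume "z \<in> pull \<sigma> ` car F"
        then obtain y where y: "y \<in> car F" "z = pull \<sigma> y" by blast
        have "qle G z x" using L.le_iff[of y "qtop F"] y pull_top[OF s(1)] s by auto
        then show "z \<in> car G - {qtop G}" using y L.closed x Q.antisym[of x "qtop G"] by auto
      qed
      then have "card (pull \<sigma> ` car F) \<le> card (car G - {qtop G})"
        using Q.finite_carrier by (intro card_mono) auto
      also have "\<dots> < card (car G)" using Q.finite_carrier Q.tp_closed by (rule card_Diff1_less)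
      also have "card (pull \<sigma> ` car F) = card (car F)"
        by (rule card_image) (auto simp: inj_on_def L.eq_iff)
      finally obtain n where n: "icls F \<in> (ext ^^ n) (minimal_classes C)" using less(1)[OF _ FO FL] by blast
      have "G \<in> icls G" "F \<in> icls F" using ident_Iso less(2) FO icls_mem by blast+
      then have "icls G \<in> {\<eta> \<in> L. \<exists>H \<in> \<eta>. \<exists>G' \<in> icls F. \<exists>\<pi>. simple_epi C H G' \<pi>}"
        using less(3) h by blast
      moreover have "icls F \<in> (ext ^^ n) (minimal_classes C) \<inter> L" using n FL by simp
      ultimately have "icls G \<in> ext ((ext ^^ n) (minimal_classes C))"
        unfolding ext_def by (intro UnI2 UN_I)
      then have "icls G \<in> (ext ^^ Suc n) (minimal_classes C)" by simp
      then show ?thesis by blast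
    qed
  qed
  note mem = this
  have "L \<subseteq> (\<Union>n. (ext ^^ n) (minimal_classes C))"
  proof
    fix \<gamma> assume g: "\<gamma> \<in> L"
    then have i: "\<gamma> \<in> iso_classes C" using level_sub[OF L] by (rule rev_subsetD)
    show "\<gamma> \<in> (\<Union>n. (ext ^^ n) (minimal_classes C))" using mem[OF rep_Ob[OF i]] icls_rep[OF i] g by simp
  qed
  then show ?thesis by (rule countable_subset) (use c in auto)
qed

end

subsection \<open>Pro-isomorphism classes with prescribed components\<close>

context diamond_category
begin

lemma self_icls: "G \<in> Ob C \<Longrightarrow> G \<in> icls G"
  using ident_Iso icls_mem by blast

lemma quot_obj_le:
  assumes S: "formation C S" and G: "G \<in> Ob C" and x: "x \<in> car G" "y \<in> car G" "qle G x y" and y: "quot_obj C y \<in> S"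
  shows "quot_obj C x \<in> S"
proof -
  obtain F \<pi> where p: "\<pi> \<in> Epi C G F" "x = cls \<pi>" using x(1) car_iff by blast
  obtain F' \<sigma> where s: "\<sigma> \<in> Epi C G F'" "y = cls \<sigma>" using x(2) car_iff by blast
  obtain h where "h \<in> Epi C F' F" using cls_le_iff[OF p(1) s(1)] x p s by auto
  then show ?thesis using Epi_formation[OF S] y p s quot_obj_cls[OF p(1)] quot_obj_cls[OF s(1)] by auto
qed

lemma level_quot_chain:
  assumes K: "\<And>n. K n \<in> levels C" "\<And>n. K n \<subseteq> K (Suc n)"
    and x: "\<And>n. x n \<in> K n" "\<And>n. level_quot C (K n) (x (Suc n)) = x n" and "m \<le> n"
  shows "level_quot C (K m) (x n) = x m"
  using \<open>m \<le> n\<close>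
proof (induction n)
  case 0
  then show ?case using level_quot_self[OF level_formation[OF K(1)] x(1)] by simp
next
  case (Suc n)
  note Kf = level_formation[OF K(1)]
  show ?case
  proof (cases "m = Suc n")
    case True
    then show ?thesis using level_quot_self[OF Kf x(1)] by simp
  next
    case False
    then have mn: "m \<le> n" using Suc by simp
    have sub: "K m \<subseteq> K n" using lift_Suc_mono_le[of K, OF K(2) mn] .
    have xi: "x (Suc n) \<in> iso_classes C" using x(1) level_sub[OF K(1)] by blast
    have "level_quot C (K m) (x (Suc n)) = level_quot C (K m) (level_quot C (K n) (x (Suc n)))"
      using level_quot_trans[OF Kf Kf sub xi] by simp
    then show ?thesis using Suc(1)[OF mn] x(2) by simp
  qed
qed

text \<open>Loewy lengths in \<open>L\<close> are bounded, and each Loewy layer is built from the finitely many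
  objects of \<open>L\<close> with a simple epimorphism to a given one, so each layer stabilises.\<close>

lemma level_quot_stabilises:
  assumes K: "\<And>n. K n \<in> levels C" "\<And>n. K n \<subseteq> K (Suc n)"
    and x: "\<And>n. x n \<in> K n" "\<And>n. level_quot C (K n) (x (Suc n)) = x n"
    and L: "L \<in> levels C"
  shows "\<exists>m. \<forall>n \<ge> m. level_quot C L (x n) = level_quot C L (x m)"
proof -
  note Lf = level_formation[OF L] and Kf = level_formation[OF K(1)]
  have LK: "formation C (L \<inter> K m)" for m using formation_Int[OF Lf Kf] .
  have Kmono: "K m \<subseteq> K n" if "m \<le> n" for m n using lift_Suc_mono_le[of K, OF K(2) that] .
  have xi: "x n \<in> iso_classes C" for n using x(1) level_sub[OF K(1)] by blast
  define G where "G n = rep (x n)" for n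
  have G: "G n \<in> Ob C" "icls (G n) = x n" for n using rep_Ob[OF xi] icls_rep[OF xi] by (auto simp: G_def)
  \<comment> \<open>The part of the maximal quotient in L that is already visible at stage m,
    realised inside the fixed lattice of quotients of \<open>G n\<close>.\<close>
  define e where "e n m = maxq (L \<inter> K m) (G n)" for n m
  note e = maxq[OF LK G(1), folded e_def]
  have inK: "quot_obj C z \<in> K n" if "z \<in> car (G n)" for z n
    using formation_quot[OF Kf x(1) _ that] rep_mem[OF xi] by (simp add: G_def)
  have top: "level_quot C L (x n) = quot_obj C (e n n)" for n
  proof -
    have "maxq L (G n) = e n n"
      by (rule maxq_eqI[OF Lf G(1) e(1)]) (use e inK in auto)
    then show ?thesis using level_quot_rep[OF Lf xi] by (simp add: G_def)
  qed
  \<comment> \<open>The isomorphism class of this part depends on m only, which makes a choice of m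
    uniform in n possible.\<close>
  have part: "quot_obj C (e n m) = level_quot C L (x m)" if mn: "m \<le> n" for m n
  proof -
    have "quot_obj C (e n m) = level_quot C (L \<inter> K m) (x n)"
      using level_quot_rep[OF LK xi] by (simp add: G_def e_def)
    also have "\<dots> = level_quot C (L \<inter> K m) (level_quot C (K m) (x n))"
      using level_quot_trans[OF LK Kf _ xi] by simp
    also have "\<dots> = level_quot C (L \<inter> K m) (x m)" using level_quot_chain[of K x, OF K x mn] by simp
    also have "\<dots> = quot_obj C (e m m)" using level_quot_rep[OF LK xi] by (simp add: G_def e_def)
    finally show ?thesis using top by simp
  qed
  have mono: "qle (G n) (e n m) (e n m')" if "m \<le> m'" for n m m'
    unfolding e_def by (rule maxq_mono[OF LK LK _ G(1)]) (use Kmono[OF that] in auto)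
  obtain r where r: "L \<subseteq> loewy_classes r" using level_loewy[OF L] by blast
  \<comment> \<open>Downward induction on k. The case \<open>k = r\<close> is the Loewy bound of the
    level; the case \<open>k = 0\<close> says \<open>e n m = e n n\<close>, which is
    stabilisation.\<close>
  have "\<exists>m. \<forall>n \<ge> m. qloewy (G n) k (e n m) (e n n)" if "k \<le> r" for k
    using that
  proof (induction "r - k" arbitrary: k)
    case 0
    then have k: "k = r" by simp
    have "qloewy (G n) r (e n 0) (e n n)" for n
    proof -
      interpret Q: finite_modular_lattice "car (G n)" "qle (G n)" "qjn (G n)" "qmt (G n)" "qbot (G n)" "qtop (G n)"
        by (rule quot_fml[OF G(1)])
      have "quot_obj C (e n n) \<in> loewy_classes r" using e(2)[of n n] r by auto
      then have "Q.loewy r (qbot (G n)) (e n n)" using quot_obj_loewy[OF G(1) e(1)] by simp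
      then show ?thesis
        using Q.loewy_upper[of "qbot (G n)" "e n n" "e n 0" r] e(1) mono[of 0 n n] by simp
    qed
    then show ?case using k by blast
  next
    case (Suc d)
    then have "d = r - Suc k" "Suc k \<le> r" by auto
    then obtain m where m: "\<And>n. n \<ge> m \<Longrightarrow> qloewy (G n) (Suc k) (e n m) (e n n)"
      using Suc(1)[of "Suc k"] by blast
    define y where "y = level_quot C L (x m)"
    have yL: "y \<in> L" using level_quot_mem[OF Lf xi] by (simp add: y_def)
    \<comment> \<open>The possible classes of covers of \<open>e n m\<close>. The set is finite by
      the axiom and the same for all n, as it depends only on y. Each member occurs in some
      \<open>K j\<close>, so one m' catches them all and the whole socle is absorbed below
      \<open>e n m'\<close>.\<close>
    define S where "S = {\<eta> \<in> L. \<exists>H \<in> \<eta>. \<exists>G \<in> y. \<exists>\<pi>. simple_epi C H G \<pi>} \<inter> (\<Union>j. K j)"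
    have fS: "finite S" using finite_simple_epi[OF L yL] by (simp add: S_def)
    have "\<exists>m'. m \<le> m' \<and> S' \<subseteq> K m'" if "finite S'" "S' \<subseteq> S" for S'
      using that
    proof (induction S')
      case (insert s S')
      then obtain m1 j where "m \<le> m1" "S' \<subseteq> K m1" "s \<in> K j" by (auto simp: S_def)
      then have "m \<le> max m1 j" "insert s S' \<subseteq> K (max m1 j)"
        using Kmono[of m1 "max m1 j"] Kmono[of j "max m1 j"] by auto
      then show ?case by blast
    qed auto
    from this[OF fS] obtain m' where m': "m \<le> m'" "S \<subseteq> K m'" by blast
    have "qloewy (G n) k (e n m') (e n n)" if n: "n \<ge> m'" for n
    proof -
      interpret Q: finite_modular_lattice "car (G n)" "qle (G n)" "qjn (G n)" "qmt (G n)" "qbot (G n)" "qtop (G n)"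
        by (rule quot_fml[OF G(1)])
      have "qle (G n) p (e n m')" if p: "Q.cov (e n m) p" "qle (G n) p (e n n)" for p
      proof -
        have pc: "p \<in> car (G n)" using Q.covD[OF p(1)] by blast
        have pL: "quot_obj C p \<in> L" using quot_obj_le[OF Lf G(1) pc e(1) p(2)] e(2) by simp
        obtain H \<tau> where t: "\<tau> \<in> Epi C (G n) H" "p = cls \<tau>" using pc car_iff by blast
        have "e n m \<in> car (G n)" by (rule e(1))
        then obtain F \<sigma> where s: "\<sigma> \<in> Epi C (G n) F" "e n m = cls \<sigma>" using car_iff by blast
        have "Q.cov (cls \<sigma>) (cls \<tau>)" using p(1) t(2) s(2) by simp
        from cov_simple_epi[OF G(1) t(1) s(1) this] obtain h where h: "simple_epi C H F h" by blast
        have "H \<in> quot_obj C p" "F \<in> quot_obj C (e n m)"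
          unfolding t(2) s(2) quot_obj_cls[OF t(1)] quot_obj_cls[OF s(1)]
          using Epi_Ob[OF t(1)] Epi_Ob[OF s(1)] self_icls by blast+
        then have "quot_obj C p \<in> S"
          using h pL inK[OF pc] part[of m n] m'(1) n unfolding S_def y_def by auto
        then show ?thesis using e(3)[OF pc] pL m' by auto
      qed
      then have "qle (G n) (Q.Soc (e n m) (e n n)) (e n m')"
        using e(1) mono[OF m'(1)] by (simp add: Q.Soc_le_iff)
      moreover have "Q.loewy k (Q.Soc (e n m) (e n n)) (e n n)"
        using Q.loewy_Soc[OF e(1) e(1)] m[of n] n m' by simp
      ultimately show ?thesis
        using Q.loewy_upper[of "Q.Soc (e n m) (e n n)" "e n n" "e n m'" k] e(1) mono[OF n] by simp
    qed
    then show ?case by blast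
  qed
  from this[of 0] obtain m where m: "\<And>n. n \<ge> m \<Longrightarrow> qloewy (G n) 0 (e n m) (e n n)" by auto
  have "level_quot C L (x n) = level_quot C L (x m)" if n: "n \<ge> m" for n
  proof -
    interpret Q: finite_modular_lattice "car (G n)" "qle (G n)" "qjn (G n)" "qmt (G n)" "qbot (G n)" "qtop (G n)"
      by (rule quot_fml[OF G(1)])
    have "e n m = e n n" using m[OF n] by simp
    then show ?thesis using part[OF n] top[of n] by simp
  qed
  then show ?thesis by blast
qed

text \<open>At each level L the value is the eventual maximal quotient in L of the sequence.
  Compatibility of two levels is read off at an index where both have become stable.\<close>

theorem pro_class_ex:
  assumes K: "\<And>n. K n \<in> levels C" "\<And>n. K n \<subseteq> K (Suc n)"
    and x: "\<And>n. x n \<in> K n" "\<And>n. level_quot C (K n) (x (Suc n)) = x n"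
  obtains X where "X \<in> pro_classes C" "\<And>n. X (K n) = x n"
proof -
  have "\<forall>L. \<exists>m. L \<in> levels C \<longrightarrow> (\<forall>n \<ge> m. level_quot C L (x n) = level_quot C L (x m))"
    using level_quot_stabilises[of K x, OF K x] by blast
  then obtain m where m: "\<And>L n. L \<in> levels C \<Longrightarrow> n \<ge> m L \<Longrightarrow> level_quot C L (x n) = level_quot C L (x (m L))"
    by metis
  have xi: "x n \<in> iso_classes C" for n using x(1) level_sub[OF K(1)] by blast
  define X where "X = (\<lambda>L \<in> levels C. level_quot C L (x (m L)))"
  have X: "X L = level_quot C L (x n)" if "L \<in> levels C" "n \<ge> m L" for L n
    using m[OF that] that(1) by (simp add: X_def)
  have "X \<in> pro_classes C"
    unfolding pro_classes_def
  proof (intro CollectI conjI ballI impI PiE_I)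
    fix L assume L: "L \<in> levels C"
    show "X L \<in> L" using X[OF L] level_quot_mem[OF level_formation[OF L] xi] by (metis order_refl)
    fix L' assume L': "L' \<in> levels C" "L \<subseteq> L'"
    let ?n = "max (m L) (m L')"
    have "level_quot C L (X L') = level_quot C L (x ?n)"
      using X[OF L'(1), of ?n] level_quot_trans[OF level_formation[OF L] level_formation[OF L'(1)] L'(2) xi] by simp
    then show "level_quot C L (X L') = X L" using X[OF L, of ?n] by simp
  qed (auto simp: X_def)
  moreover have "X (K n) = x n" for n
    using X[OF K(1), of n "max n (m (K n))"] level_quot_chain[of K x, OF K x, of n "max n (m (K n))"] by simp
  ultimately show ?thesis using that by blast
qed

lemma pro_class_ex1:
  assumes L: "L \<in> levels C" and g: "\<gamma> \<in> L"
  obtains X where "X \<in> pro_classes C" "X L = \<gamma>"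
  using pro_class_ex[of "\<lambda>_. L" "\<lambda>_. \<gamma>"] L g level_quot_self[OF level_formation[OF L] g] by auto

lemma pro_class_mem: "X \<in> pro_classes C \<Longrightarrow> L \<in> levels C \<Longrightarrow> X L \<in> L"
  by (auto simp: pro_classes_def)

lemma pro_class_level_quot:
  "X \<in> pro_classes C \<Longrightarrow> L \<in> levels C \<Longrightarrow> L' \<in> levels C \<Longrightarrow> L \<subseteq> L' \<Longrightarrow> level_quot C L (X L') = X L"
  by (auto simp: pro_classes_def)

lemma epi_count_level:
  assumes X: "X \<in> pro_classes C" and L: "L \<in> levels C" and G: "G \<in> L"
  shows "epi_count C X G = card (Epi C (rep (X L)) (rep G))"
proof -
  let ?L = "formation C hull {G}"
  have Gi: "G \<in> iso_classes C" using level_sub[OF L] G by blast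
  have l: "?L \<in> levels C" using hull_level[OF Gi] .
  have sub: "?L \<subseteq> L" using hull_sub[OF level_formation[OF L] G] .
  have i: "X L \<in> iso_classes C" using pro_class_mem[OF X L] level_sub[OF L] by blast
  show ?thesis
    using card_Epi_level_quot[OF level_formation[OF l] i mem_hull] pro_class_level_quot[OF X l L sub]
    by (simp add: epi_count_def)
qed

end

section \<open>Sums over pairs of an object and an epimorphism\<close>

lemma summable_on_Sigma_abs:
  fixes f :: "'a \<times> 'b \<Rightarrow> real"
  assumes "\<And>x. x \<in> A \<Longrightarrow> ((\<lambda>y. \<bar>f (x, y)\<bar>) has_sum g x) (B x)" "g summable_on A"
  shows "f summable_on Sigma A B"
proof -
  have "(\<lambda>z. \<bar>f z\<bar>) summable_on Sigma A B"
    by (rule summable_on_SigmaI[where g = g]) (use assms in auto)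
  then show ?thesis using summable_on_iff_abs_summable_on_real by (metis (no_types, lifting) real_norm_def summable_on_cong)
qed

lemma has_sum_cdiv_const: "(f has_sum a) A \<Longrightarrow> ((\<lambda>x. f x / c) has_sum (a / c)) A" for c :: real
  using has_sum_cmult_left[of f A a "1 / c"] by simp

text \<open>A sum over D is spread over a finite cover of D by dividing each term by the size of its
  fibre. The equivalence includes convergence in both directions.\<close>

lemma has_sum_fibres:
  fixes f :: "'b \<Rightarrow> real"
  assumes p: "\<And>e. e \<in> D' \<Longrightarrow> p e \<in> D"
    and fin: "\<And>d. d \<in> D \<Longrightarrow> finite {e \<in> D'. p e = d}"
    and n: "\<And>d. d \<in> D \<Longrightarrow> card {e \<in> D'. p e = d} = n d" "\<And>d. d \<in> D \<Longrightarrow> n d > 0"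
  shows "((\<lambda>e. f (p e) / real (n (p e))) has_sum s) D' \<longleftrightarrow> (f has_sum s) D"
proof -
  let ?F = "\<lambda>d. {e \<in> D'. p e = d}" and ?h = "\<lambda>(d, e). f d / real (n d)"
  have bij: "bij_betw snd (Sigma D ?F) D'"
    by (rule bij_betwI[where g = "\<lambda>e. (p e, e)"]) (use p in auto)
  have "((\<lambda>e. f (p e) / real (n (p e))) has_sum s) D' \<longleftrightarrow>
      ((\<lambda>x. f (p (snd x)) / real (n (p (snd x)))) has_sum s) (Sigma D ?F)"
    using has_sum_reindex_bij_betw[OF bij, of "\<lambda>e. f (p e) / real (n (p e))" s] by simp
  also have "\<dots> \<longleftrightarrow> (?h has_sum s) (Sigma D ?F)"
    by (rule has_sum_cong) auto
  also have "\<dots> \<longleftrightarrow> (f has_sum s) D"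
  proof -
    have inner: "((\<lambda>e. g d / real (n d)) has_sum g d) (?F d)" if "d \<in> D" for d and g :: "'b \<Rightarrow> real"
    proof -
      have "((\<lambda>e. g d / real (n d)) has_sum (\<Sum>e \<in> ?F d. g d / real (n d))) (?F d)"
        using fin that by (intro has_sum_finite) auto
      then show ?thesis using n that by simp
    qed
    show ?thesis
    proof
      assume "(?h has_sum s) (Sigma D ?F)"
      then show "(f has_sum s) D" by (rule has_sum_SigmaD) (use inner[of _ f] in simp)
    next
      assume f: "(f has_sum s) D"
      show "(?h has_sum s) (Sigma D ?F)"
      proof (rule has_sum_SigmaI[OF _ f])
        show "?h summable_on Sigma D ?F"
        proof (rule summable_on_Sigma_abs)
          fix d assume "d \<in> D"
          then show "((\<lambda>e. \<bar>?h (d, e)\<bar>) has_sum \<bar>f d\<bar>) (?F d)"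
            using inner[of d "\<lambda>d. \<bar>f d\<bar>"] by simp
        next
          show "(\<lambda>d. \<bar>f d\<bar>) summable_on D"
            using f has_sum_imp_summable summable_on_iff_abs_summable_on_real by fastforce
        qed
      qed (use inner[of _ f] in simp)
    qed
  qed
  finally show ?thesis .
qed

context diamond_category
begin

section \<open>Sums over factorisations of epimorphisms\<close>

definition epi_pairs :: "'o set set \<Rightarrow> 'o set \<Rightarrow> ('o set \<times> 'm) set" where
  "epi_pairs L S = Sigma L (\<lambda>H. Epi C (rep H) (rep S))"

definition up :: "'o \<Rightarrow> 'm set \<Rightarrow> 'm set set" where
  "up G x = {y. y \<in> car G \<and> qle G x y}"

lemma epi_pairs_mem: "(H, \<tau>) \<in> epi_pairs L S \<longleftrightarrow> H \<in> L \<and> \<tau> \<in> Epi C (rep H) (rep S)"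
  by (simp add: epi_pairs_def)

lemma finite_up: "G \<in> Ob C \<Longrightarrow> finite (up G x)"
  using finite_car by (simp add: up_def)

lemma formation_rep: "formation C L \<Longrightarrow> H \<in> L \<Longrightarrow> rep H \<in> Ob C \<and> icls (rep H) = H"
  using formation_sub rep_Ob icls_rep by blast

text \<open>The class x determines S, and \<tau> determines \<sigma> because \<tau> is an
  epimorphism. What remains free is the choice of \<tau> within its class, that is, an automorphism
  of the chosen representative of S.\<close>

lemma fibre_triples:
  assumes L: "formation C L" and T: "T \<in> L" and H: "(H, \<pi>) \<in> epi_pairs L T" and x: "x \<in> up (rep H) (cls \<pi>)"
  shows "bij_betw (\<lambda>e. snd (snd e))
    {e \<in> Sigma (epi_pairs L T) (\<lambda>s. epi_pairs L (fst s)). (\<lambda>((S, \<sigma>), (H', \<tau>)). ((H', \<sigma> \<bullet> \<tau>), cls \<tau>)) e = ((H, \<pi>), x)}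
    {\<tau> \<in> Epi C (rep H) (rep (quot_obj C x)). cls \<tau> = x}" (is "bij_betw _ ?E ?F")
proof -
  let ?S = "quot_obj C x"
  have H': "H \<in> L" "\<pi> \<in> Epi C (rep H) (rep T)" using H by (auto simp: epi_pairs_mem)
  have HO: "rep H \<in> Ob C" "icls (rep H) = H" using formation_rep[OF L H'(1)] by auto
  have xc: "x \<in> car (rep H)" "qle (rep H) (cls \<pi>) x" using x by (auto simp: up_def)
  have SL: "?S \<in> L" using formation_quot[OF L H'(1) _ xc(1)] self_icls[OF HO(1)] HO(2) by simp
  have S: "S = ?S" if "S \<in> L" "\<tau> \<in> Epi C (rep H) (rep S)" "cls \<tau> = x" for S \<tau>
    using quot_obj_cls[OF that(2)] formation_rep[OF L that(1)] that(3) by simp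
  show ?thesis unfolding bij_betw_def
  proof
    show "inj_on (\<lambda>e. snd (snd e)) ?E"
    proof (rule inj_onI)
      fix e e' assume E: "e \<in> ?E" "e' \<in> ?E" and eq: "snd (snd e) = snd (snd e')"
      obtain S \<sigma> H1 \<tau> where e: "e = ((S, \<sigma>), (H1, \<tau>))" by (metis surj_pair)
      obtain S' \<sigma>' H2 \<tau>' where e': "e' = ((S', \<sigma>'), (H2, \<tau>'))" by (metis surj_pair)
      have m: "S \<in> L" "\<sigma> \<in> Epi C (rep S) (rep T)" "\<tau> \<in> Epi C (rep H) (rep S)" "cls \<tau> = x"
          "\<sigma> \<bullet> \<tau> = \<pi>" "H1 = H" using E(1) unfolding e by (auto simp: epi_pairs_mem)
      have m': "S' \<in> L" "\<sigma>' \<in> Epi C (rep S') (rep T)" "\<tau> \<in> Epi C (rep H) (rep S')" "\<sigma>' \<bullet> \<tau> = \<pi>"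
          "\<tau>' = \<tau>" "H2 = H" using E(2) eq unfolding e e' by (auto simp: epi_pairs_mem)
      have SS: "S = S'" using S[OF m(1,3,4)] S[OF m'(1,3) m(4)] by simp
      have "\<sigma> = \<sigma>'"
        by (rule Epi_cancel[OF m(3) Epi_Hom[OF m(2)]]) (use m m' SS Epi_Hom in auto)
      then show "e = e'" using e e' m m' SS by simp
    qed
    show "(\<lambda>e. snd (snd e)) ` ?E = ?F"
    proof (intro equalityI subsetI)
      fix \<tau> assume "\<tau> \<in> (\<lambda>e. snd (snd e)) ` ?E"
      then obtain e where E: "e \<in> ?E" "\<tau> = snd (snd e)" by blast
      obtain S \<sigma> H1 \<tau>1 where e: "e = ((S, \<sigma>), (H1, \<tau>1))" by (metis surj_pair)
      have m: "S \<in> L" "\<tau> \<in> Epi C (rep H) (rep S)" "cls \<tau> = x"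
        using E unfolding e by (auto simp: epi_pairs_mem)
      then show "\<tau> \<in> ?F" using S[OF m] by simp
    next
      fix \<tau> assume t: "\<tau> \<in> ?F"
      then have t': "\<tau> \<in> Epi C (rep H) (rep ?S)" "cls \<tau> = x" by auto
      then obtain \<sigma> where "\<sigma> \<in> Epi C (rep ?S) (rep T)" "\<sigma> \<bullet> \<tau> = \<pi>"
        using cls_le_iff[OF H'(2) t'(1)] xc(2) by auto
      then have "((?S, \<sigma>), (H, \<tau>)) \<in> ?E" using t' SL H' by (auto simp: epi_pairs_mem)
      then show "\<tau> \<in> (\<lambda>e. snd (snd e)) ` ?E" by (rule rev_image_eqI) simp
    qed
  qed
qed

text \<open>A quotient \<open>x\<close> between \<open>H\<close> and \<open>\<pi> : H \<rightarrow> T\<close> is the same as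
  a factorisation of \<open>\<pi>\<close> through an object \<open>S\<close>, up to \<open>Aut S\<close>.\<close>

lemma has_sum_triples:
  fixes f :: "'o set \<Rightarrow> 'm \<Rightarrow> 'm set \<Rightarrow> real"
  assumes L: "formation C L" and T: "T \<in> L"
  shows "((\<lambda>((S, \<sigma>), (H, \<tau>)). f H (\<sigma> \<bullet> \<tau>) (cls \<tau>) / real (card (Aut C (rep S)))) has_sum s)
      (Sigma (epi_pairs L T) (\<lambda>s. epi_pairs L (fst s))) \<longleftrightarrow>
    ((\<lambda>((H, \<pi>), x). f H \<pi> x) has_sum s) (Sigma (epi_pairs L T) (\<lambda>(H, \<pi>). up (rep H) (cls \<pi>)))"
proof -
  let ?D' = "Sigma (epi_pairs L T) (\<lambda>s. epi_pairs L (fst s))" and ?D = "Sigma (epi_pairs L T) (\<lambda>(H, \<pi>). up (rep H) (cls \<pi>))"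
  let ?p = "\<lambda>((S, \<sigma>), (H, \<tau>)). ((H, \<sigma> \<bullet> \<tau>), cls \<tau>)"
  let ?n = "\<lambda>((H :: 'o set, \<pi> :: 'm), x). card (Aut C (rep (quot_obj C x)))"
  have mem: "rep S \<in> Ob C" "quot_obj C (cls \<tau>) = S" "?p ((S, \<sigma>), (H, \<tau>)) \<in> ?D"
    if "((S, \<sigma>), (H, \<tau>)) \<in> ?D'" for S \<sigma> H \<tau>
  proof -
    have m: "S \<in> L" "\<sigma> \<in> Epi C (rep S) (rep T)" "H \<in> L" "\<tau> \<in> Epi C (rep H) (rep S)"
      using that by (auto simp: epi_pairs_mem)
    show "rep S \<in> Ob C" "quot_obj C (cls \<tau>) = S"
      using formation_rep[OF L m(1)] quot_obj_cls[OF m(4)] by auto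
    have "qle (rep H) (cls (\<sigma> \<bullet> \<tau>)) (cls \<tau>)"
      using cls_le_iff[OF Epi_comp[OF m(4,2)] m(4)] m(2) by blast
    then show "?p ((S, \<sigma>), (H, \<tau>)) \<in> ?D"
      using m Epi_comp[OF m(4,2)] cls_car[OF m(4)] by (simp add: epi_pairs_mem up_def)
  qed
  have "((\<lambda>((S, \<sigma>), (H, \<tau>)). f H (\<sigma> \<bullet> \<tau>) (cls \<tau>) / real (card (Aut C (rep S)))) has_sum s) ?D' \<longleftrightarrow>
      ((\<lambda>e. (\<lambda>((H, \<pi>), x). f H \<pi> x) (?p e) / real (?n (?p e))) has_sum s) ?D'"
  proof (rule has_sum_cong)
    fix e assume "e \<in> ?D'"
    moreover obtain S \<sigma> H \<tau> where "e = ((S, \<sigma>), (H, \<tau>))" by (metis surj_pair)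
    ultimately show "(\<lambda>((S, \<sigma>), (H, \<tau>)). f H (\<sigma> \<bullet> \<tau>) (cls \<tau>) / real (card (Aut C (rep S)))) e =
        (\<lambda>((H, \<pi>), x). f H \<pi> x) (?p e) / real (?n (?p e))" using mem by simp
  qed
  also have "\<dots> \<longleftrightarrow> ((\<lambda>((H, \<pi>), x). f H \<pi> x) has_sum s) ?D"
  proof (rule has_sum_fibres)
    fix e assume "e \<in> ?D'"
    moreover obtain S \<sigma> H \<tau> where "e = ((S, \<sigma>), (H, \<tau>))" by (metis surj_pair)
    ultimately show "?p e \<in> ?D" using mem(3) by simp
  next
    fix d assume d: "d \<in> ?D"
    obtain H \<pi> x where d': "d = ((H, \<pi>), x)" by (metis surj_pair)
    then have m: "(H, \<pi>) \<in> epi_pairs L T" "x \<in> up (rep H) (cls \<pi>)" using d by auto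
    have x: "x \<in> car (rep H)" using m by (simp add: up_def)
    have S: "rep (quot_obj C x) \<in> quot_obj C x" using rep_mem[OF quot_obj_iso[OF x]] .
    have SO: "rep (quot_obj C x) \<in> Ob C" using rep_Ob[OF quot_obj_iso[OF x]] .
    have HO: "rep H \<in> Ob C" using m formation_rep[OF L] by (auto simp: epi_pairs_mem)
    note b = fibre_triples[OF L T m, folded d']
    have fin: "finite {\<tau> \<in> Epi C (rep H) (rep (quot_obj C x)). cls \<tau> = x}"
      using finite_Epi[OF HO SO] by simp
    show "finite {e \<in> ?D'. ?p e = d}" using bij_betw_finite[OF b] fin by simp
    show "card {e \<in> ?D'. ?p e = d} = ?n d" using bij_betw_same_card[OF b] card_fibre[OF x S] d' by simp
    show "?n d > 0" using card_Aut_pos[OF SO] d' by simp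
  qed
  finally show ?thesis .
qed

text \<open>Absolute summability of f over intermediate quotients permits summing instead first over
  \<open>H \<rightarrow> S\<close> and then over \<open>S \<rightarrow> T\<close>.\<close>

lemma fubini_forward:
  fixes f :: "'o set \<Rightarrow> 'm \<Rightarrow> 'm set \<Rightarrow> real"
  assumes L: "formation C L" and T: "T \<in> L"
    and sm: "(\<lambda>(H, \<pi>). \<Sum>x \<in> up (rep H) (cls \<pi>). \<bar>f H \<pi> x\<bar>) summable_on epi_pairs L T"
  shows "(S, \<sigma>) \<in> epi_pairs L T \<Longrightarrow> (\<lambda>(H, \<tau>). f H (\<sigma> \<bullet> \<tau>) (cls \<tau>)) summable_on epi_pairs L S"
    and "((\<lambda>(S, \<sigma>). infsum (\<lambda>(H, \<tau>). f H (\<sigma> \<bullet> \<tau>) (cls \<tau>)) (epi_pairs L S) / real (card (Aut C (rep S)))) has_sum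
      infsum (\<lambda>(H, \<pi>). \<Sum>x \<in> up (rep H) (cls \<pi>). f H \<pi> x) (epi_pairs L T)) (epi_pairs L T)"
proof -
  let ?D' = "Sigma (epi_pairs L T) (\<lambda>s. epi_pairs L (fst s))" and ?D = "Sigma (epi_pairs L T) (\<lambda>(H, \<pi>). up (rep H) (cls \<pi>))"
  let ?g = "\<lambda>((S, \<sigma>), (H, \<tau>)). f H (\<sigma> \<bullet> \<tau>) (cls \<tau>) / real (card (Aut C (rep S)))"
  have fin: "finite (up (rep H) (cls \<pi>))" if "(H, \<pi>) \<in> epi_pairs L T" for H \<pi>
    using that formation_rep[OF L] finite_up by (auto simp: epi_pairs_mem)
  have "(\<lambda>((H, \<pi>), x). f H \<pi> x) summable_on ?D"
    by (rule summable_on_Sigma_abs[OF _ sm]) (use fin in \<open>auto intro!: has_sum_finite\<close>)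
  then obtain s where s: "((\<lambda>((H, \<pi>), x). f H \<pi> x) has_sum s) ?D" by (auto simp: summable_on_def)
  then have g: "(?g has_sum s) ?D'" using has_sum_triples[OF L T] by blast
  have aut: "real (card (Aut C (rep S))) > 0" if "(S, \<sigma>) \<in> epi_pairs L T" for S \<sigma>
    using that formation_rep[OF L] card_Aut_pos by (auto simp: epi_pairs_mem)
  have 1: "(\<lambda>(H, \<tau>). f H (\<sigma> \<bullet> \<tau>) (cls \<tau>)) summable_on epi_pairs L S" if m: "(S, \<sigma>) \<in> epi_pairs L T" for S \<sigma>
  proof -
    have "(\<lambda>(x, y). ?g (x, y)) summable_on Sigma (epi_pairs L T) (\<lambda>s. epi_pairs L (fst s))"
    proof -
      have "(\<lambda>(x, y). ?g (x, y)) = ?g" by (rule ext) (simp add: split_beta)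
      then show ?thesis using has_sum_imp_summable[OF g] by simp
    qed
    from summable_on_SigmaD1[OF this m]
    have "(\<lambda>y. ?g ((S, \<sigma>), y)) summable_on epi_pairs L S" by simp
    then have "(\<lambda>y. real (card (Aut C (rep S))) * ?g ((S, \<sigma>), y)) summable_on epi_pairs L S"
      by (rule summable_on_cmult_right)
    then show ?thesis using aut[OF m] unfolding case_prod_beta by simp
  qed
  then show "(S, \<sigma>) \<in> epi_pairs L T \<Longrightarrow> (\<lambda>(H, \<tau>). f H (\<sigma> \<bullet> \<tau>) (cls \<tau>)) summable_on epi_pairs L S" .
  have "((\<lambda>(H, \<pi>). \<Sum>x \<in> up (rep H) (cls \<pi>). f H \<pi> x) has_sum s) (epi_pairs L T)"
    by (rule has_sum_SigmaD[OF s]) (use fin in \<open>auto intro!: has_sum_finite\<close>)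
  then have "infsum (\<lambda>(H, \<pi>). \<Sum>x \<in> up (rep H) (cls \<pi>). f H \<pi> x) (epi_pairs L T) = s" by (rule infsumI)
  moreover have "((\<lambda>(S, \<sigma>). infsum (\<lambda>(H, \<tau>). f H (\<sigma> \<bullet> \<tau>) (cls \<tau>)) (epi_pairs L S) / real (card (Aut C (rep S)))) has_sum s) (epi_pairs L T)"
  proof (rule has_sum_SigmaD[OF g])
    fix a assume "a \<in> epi_pairs L T"
    moreover obtain S \<sigma> where "a = (S, \<sigma>)" by (metis surj_pair)
    ultimately show "((\<lambda>y. ?g (a, y)) has_sum (case a of (S, \<sigma>) \<Rightarrow>
        infsum (\<lambda>(H, \<tau>). f H (\<sigma> \<bullet> \<tau>) (cls \<tau>)) (epi_pairs L S) / real (card (Aut C (rep S))))) (epi_pairs L (fst a))"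
      using has_sum_cdiv_const[OF has_sum_infsum[OF 1], of S \<sigma> "real (card (Aut C (rep S)))"]
      by (simp add: case_prod_beta)
  qed
  ultimately show "((\<lambda>(S, \<sigma>). infsum (\<lambda>(H, \<tau>). f H (\<sigma> \<bullet> \<tau>) (cls \<tau>)) (epi_pairs L S) / real (card (Aut C (rep S)))) has_sum
      infsum (\<lambda>(H, \<pi>). \<Sum>x \<in> up (rep H) (cls \<pi>). f H \<pi> x) (epi_pairs L T)) (epi_pairs L T)" by simp
qed

text \<open>The reverse exchange. Nonnegativity replaces the summability hypothesis: iterated sums
  that exist give a convergent triple sum.\<close>

lemma fubini_backward:
  fixes f :: "'o set \<Rightarrow> 'm \<Rightarrow> 'm set \<Rightarrow> real"
  assumes L: "formation C L" and T: "T \<in> L"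
    and pos: "\<And>S \<sigma> H \<tau>. (S, \<sigma>) \<in> epi_pairs L T \<Longrightarrow> (H, \<tau>) \<in> epi_pairs L S \<Longrightarrow> 0 \<le> f H (\<sigma> \<bullet> \<tau>) (cls \<tau>)"
    and inner: "\<And>S \<sigma>. (S, \<sigma>) \<in> epi_pairs L T \<Longrightarrow> ((\<lambda>(H, \<tau>). f H (\<sigma> \<bullet> \<tau>) (cls \<tau>)) has_sum w S \<sigma>) (epi_pairs L S)"
    and outer: "((\<lambda>(S, \<sigma>). w S \<sigma> / real (card (Aut C (rep S)))) has_sum s) (epi_pairs L T)"
  shows "((\<lambda>(H, \<pi>). \<Sum>x \<in> up (rep H) (cls \<pi>). f H \<pi> x) has_sum s) (epi_pairs L T)"
proof -
  let ?D' = "Sigma (epi_pairs L T) (\<lambda>s. epi_pairs L (fst s))" and ?D = "Sigma (epi_pairs L T) (\<lambda>(H, \<pi>). up (rep H) (cls \<pi>))"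
  let ?g = "\<lambda>((S, \<sigma>), (H, \<tau>)). f H (\<sigma> \<bullet> \<tau>) (cls \<tau>) / real (card (Aut C (rep S)))"
  have fin: "finite (up (rep H) (cls \<pi>))" if "(H, \<pi>) \<in> epi_pairs L T" for H \<pi>
    using that formation_rep[OF L] finite_up by (auto simp: epi_pairs_mem)
  have in': "((\<lambda>y. ?g (a, y)) has_sum (case a of (S, \<sigma>) \<Rightarrow> w S \<sigma> / real (card (Aut C (rep S))))) (epi_pairs L (fst a))"
    if "a \<in> epi_pairs L T" for a
  proof -
    obtain S \<sigma> where "a = (S, \<sigma>)" by (metis surj_pair)
    then show ?thesis using has_sum_cdiv_const[OF inner, of S \<sigma> "real (card (Aut C (rep S)))"] that
      by (simp add: case_prod_beta)
  qed
  have "?g summable_on ?D'"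
    by (rule summable_on_SigmaI[OF in']) (use outer has_sum_imp_summable pos in \<open>auto\<close>)
  then have "(?g has_sum s) ?D'" using has_sum_SigmaI[OF in' outer] by blast
  then have "((\<lambda>((H, \<pi>), x). f H \<pi> x) has_sum s) ?D" using has_sum_triples[OF L T] by blast
  then show ?thesis
    by (rule has_sum_SigmaD) (use fin in \<open>auto intro!: has_sum_finite\<close>)
qed

subsection \<open>Moebius functions of epimorphisms\<close>

lemma mu_Epi: "\<tau> \<in> Epi C H G \<Longrightarrow> mu C \<tau> = mobius (quot_poset C H) (cls \<tau>) (qtop H)"
  by (simp add: mu_def Epi_dom)

lemma mu_comp:
  assumes t: "\<tau> \<in> Epi C H G" and s: "\<sigma> \<in> Epi C G F"
  shows "mobius (quot_poset C H) (cls (\<sigma> \<bullet> \<tau>)) (cls \<tau>) = mu C \<sigma>"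
  using mobius_pull[OF t cls_car[OF s] qtop_car] qle_top[OF _ cls_car[OF s]] Epi_Ob[OF s]
  by (simp add: mu_Epi[OF s] pull_cls[OF t s] pull_top[OF t])

text \<open>The orbits of the automorphisms of F are the fibres of \<open>cls\<close>, all of size
  \<open>card (Aut C F)\<close>, and \<open>mu\<close> is constant on each. In particular the
  representatives chosen in \<open>mu_hat\<close> do not matter.\<close>

lemma sum_mu:
  assumes G: "G \<in> Ob C" and F: "F \<in> Ob C"
  shows "(\<Sum>\<pi> \<in> Epi C G F. mu C \<pi>) = int (card (Aut C F)) * mu_hat C F G"
proof -
  let ?E = "Epi C G F" let ?fib = "\<lambda>x. {\<sigma> \<in> ?E. cls \<sigma> = x}"
  have fE: "finite ?E" using finite_Epi[OF G F] .
  have orb: "{(\<pi>, \<pi>'). \<exists>\<alpha> \<in> Aut C F. \<pi>' = \<alpha> \<bullet> \<pi>} `` {\<pi>} = ?fib (cls \<pi>)" if p: "\<pi> \<in> ?E" for \<pi>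
  proof (intro equalityI subsetI)
    fix \<sigma> assume "\<sigma> \<in> {(\<pi>, \<pi>'). \<exists>\<alpha> \<in> Aut C F. \<pi>' = \<alpha> \<bullet> \<pi>} `` {\<pi>}"
    then show "\<sigma> \<in> ?fib (cls \<pi>)" using Epi_comp[OF p Iso_Epi] cls_eqI[OF p] by auto
  next
    fix \<sigma> assume "\<sigma> \<in> ?fib (cls \<pi>)"
    then show "\<sigma> \<in> {(\<pi>, \<pi>'). \<exists>\<alpha> \<in> Aut C F. \<pi>' = \<alpha> \<bullet> \<pi>} `` {\<pi>}" using cls_eq_iff[OF p, of \<sigma> F] by auto
  qed
  have orbits: "Epi_orbits C G F = ?fib ` (cls ` ?E)"
    unfolding Epi_orbits_def quotient_def image_image UNION_singleton_eq_range by (rule image_cong[OF refl orb])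
  have inj: "inj_on ?fib (cls ` ?E)"
    by (rule inj_onI) blast
  have rp: "mu C (rep (?fib x)) = mobius (quot_poset C G) x (qtop G)" if "x \<in> cls ` ?E" for x
  proof -
    have "rep (?fib x) \<in> ?fib x" using that unfolding rep_def by (intro someI_ex[where P = "\<lambda>y. y \<in> ?fib x"]) auto
    then show ?thesis using mu_Epi[of "rep (?fib x)" G F] by simp
  qed
  have cd: "card (?fib x) = card (Aut C F)" if x: "x \<in> cls ` ?E" for x
  proof -
    obtain \<pi> where p: "\<pi> \<in> ?E" "x = cls \<pi>" using x by blast
    then show ?thesis using card_fibre[OF cls_car[OF p(1)]] quot_obj_cls[OF p(1)] self_icls[OF F] by simp
  qed
  have "(\<Sum>\<pi> \<in> ?E. mu C \<pi>) = (\<Sum>x \<in> cls ` ?E. \<Sum>\<pi> \<in> ?fib x. mu C \<pi>)"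
    using fE by (intro sum.group[symmetric]) auto
  also have "\<dots> = (\<Sum>x \<in> cls ` ?E. int (card (Aut C F)) * mobius (quot_poset C G) x (qtop G))"
  proof (rule sum.cong)
    fix x assume x: "x \<in> cls ` ?E"
    have "(\<Sum>\<pi> \<in> ?fib x. mu C \<pi>) = (\<Sum>\<pi> \<in> ?fib x. mobius (quot_poset C G) x (qtop G))"
      by (rule sum.cong) (auto simp: mu_Epi)
    then show "(\<Sum>\<pi> \<in> ?fib x. mu C \<pi>) = int (card (Aut C F)) * mobius (quot_poset C G) x (qtop G)"
      using cd[OF x] by simp
  qed auto
  also have "\<dots> = int (card (Aut C F)) * (\<Sum>x \<in> cls ` ?E. mu C (rep (?fib x)))"
    using rp by (simp add: sum_distrib_left)
  also have "(\<Sum>x \<in> cls ` ?E. mu C (rep (?fib x))) = mu_hat C F G"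
    unfolding mu_hat_def orbits by (rule sum.reindex[OF inj, unfolded o_def, symmetric])
  finally show ?thesis .
qed

lemma Z_count_Epi:
  assumes p: "\<pi> \<in> Epi C G F"
  shows "Z_count C \<pi> = card {h \<in> up G (cls \<pi>). \<forall>k1 \<in> up G (cls \<pi>). \<forall>k2 \<in> up G (cls \<pi>).
    qjn G h (qmt G k1 k2) = qmt G (qjn G h k1) (qjn G h k2)}"
  by (simp add: Z_count_def quot_interval_def up_def Epi_dom[OF p] Let_def)

lemma mobius_bound:
  assumes p: "\<pi> \<in> Epi C G F" and s: "qss G (cls \<pi>) (qtop G)"
  shows "(\<Sum>x \<in> up G (cls \<pi>). \<bar>real_of_int (mobius (quot_poset C G) x (qtop G))\<bar>) \<le>
    \<bar>real_of_int (mu C \<pi>)\<bar> * real (Z_count C \<pi>) ^ 3"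
proof -
  have G: "G \<in> Ob C" using Epi_Ob p by blast
  interpret Q: mobius_lattice "car G" "qle G" "qjn G" "qmt G" "qbot G" "qtop G" "mobius (quot_poset C G)"
    by (rule quot_lattice[OF G])
  show ?thesis using Q.ss_bound[OF s] unfolding Z_count_Epi[OF p] mu_Epi[OF p] up_def by simp
qed

lemma Z_count_pos:
  assumes p: "\<pi> \<in> Epi C G F"
  shows "Z_count C \<pi> \<ge> 1"
proof -
  have G: "G \<in> Ob C" using Epi_Ob p by blast
  interpret Q: mobius_lattice "car G" "qle G" "qjn G" "qmt G" "qbot G" "qtop G" "mobius (quot_poset C G)"
    by (rule quot_lattice[OF G])
  let ?Z = "{h \<in> up G (cls \<pi>). \<forall>k1 \<in> up G (cls \<pi>). \<forall>k2 \<in> up G (cls \<pi>).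
    qjn G h (qmt G k1 k2) = qmt G (qjn G h k1) (qjn G h k2)}"
  have c: "cls \<pi> \<in> car G" using cls_car[OF p] .
  have "cls \<pi> \<in> ?Z"
    using c by (auto simp: up_def Q.jn_absorb Q.le_mt_iff)
  moreover have "finite ?Z" using finite_up[OF G] by simp
  ultimately have "card ?Z > 0" by (auto simp: card_gt_0_iff)
  then show ?thesis using Z_count_Epi[OF p] by simp
qed

end

section \<open>Moments and the measure of a level\<close>

context finite_modular_lattice
begin

text \<open>The socle over a is contained in the socle over s, so it can be computed inside the
  latter. This separates the second layer of the sorting from everything above it.\<close>

lemma Soc_Soc:
  assumes "a \<in> A" "s \<in> A" "b \<in> A" "a \<sqsubseteq> s" "s \<sqsubseteq> b"
  shows "Soc a (Soc s b) = Soc a b"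
proof -
  have ab: "a \<sqsubseteq> b" using trans[of a s b] assms by auto
  have "Soc s b \<in> A" "a \<sqsubseteq> Soc s b" "Soc s b \<sqsubseteq> b"
    using assms Soc_le[of s b] trans[of a s "Soc s b"] by auto
  then have "Soc a (Soc s b) = Soc s b \<sqinter> Soc a b" using Soc_mt[of a b "Soc s b"] assms by auto
  also have "\<dots> = Soc a b" using mt_absorb2[of "Soc s b" "Soc a b"] Soc_antimono[of a b s] assms by auto
  finally show ?thesis .
qed

end

text \<open>With \<open>z = Soc a tp\<close> the condition reads \<open>x \<sqinter> z = s\<close>,
  so Weisner's theorem gives 0 unless z is the top, in which case only \<open>x = s\<close> is
  left.\<close>

lemma (in mobius_lattice) sum_Soc:
  assumes s: "ss a s" "ss s tp"
  shows "(\<Sum>x | x \<in> A \<and> s \<sqsubseteq> x. if Soc a x = s then m x tp else 0) = (if ss a tp then m s tp else 0)"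
proof -
  note d = ssD[OF s(1)]
  let ?z = "Soc a tp"
  have sz: "s \<sqsubseteq> ?z" using ss_le_Soc[OF s(1), of tp] d by auto
  have "Soc a x = x \<sqinter> ?z" if "x \<in> A" "s \<sqsubseteq> x" for x
    using Soc_mt[of a tp x] that d trans[of a s x] by auto
  then have "(\<Sum>x | x \<in> A \<and> s \<sqsubseteq> x. if Soc a x = s then m x tp else 0) =
      (\<Sum>x | x \<in> A \<and> s \<sqsubseteq> x. if x \<sqinter> ?z = s then m x tp else 0)" by (intro sum.cong) auto
  also have "\<dots> = (\<Sum>x | x \<in> A \<and> s \<sqsubseteq> x \<and> x \<sqsubseteq> tp \<and> x \<sqinter> ?z = s. m x tp)"
    by (rule sum.mono_neutral_cong_right) auto
  also have "\<dots> = (if ss a tp then m s tp else 0)"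
  proof (cases "?z = tp")
    case True
    have "{x. x \<in> A \<and> s \<sqsubseteq> x \<and> x \<sqsubseteq> tp \<and> x \<sqinter> ?z = s} = {s}"
      using True d by (auto simp: mt_absorb)
    moreover have "ss a tp" using True d by (simp add: ss_def)
    ultimately show ?thesis by simp
  next
    case False
    then have "\<not> ss a tp" by (simp add: ss_def)
    then show ?thesis using weisner_mt[of s tp ?z] False d sz by simp
  qed
  finally show ?thesis .
qed

context diamond_category
begin

lemma epi_pairs_Ob:
  assumes "formation C L" "T \<in> L" "(H, \<pi>) \<in> epi_pairs L T"
  shows "rep H \<in> Ob C" "\<pi> \<in> Epi C (rep H) (rep T)" "cls \<pi> \<in> car (rep H)" "H \<in> L"
  using assms formation_rep cls_car by (auto simp: epi_pairs_mem)

lemma epi_pairs_comp: "(S, \<sigma>) \<in> epi_pairs L T \<Longrightarrow> (H, \<tau>) \<in> epi_pairs L S \<Longrightarrow> (H, \<sigma> \<bullet> \<tau>) \<in> epi_pairs L T"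
  using Epi_comp by (auto simp: epi_pairs_mem)

lemma epi_pairs_iso:
  assumes L: "formation C L" and H: "(H, \<pi>) \<in> epi_pairs L T" and T: "T \<in> L"
  shows "cls \<pi> = qtop (rep H) \<longleftrightarrow> H = T \<and> \<pi> \<in> Aut C (rep T)"
proof -
  note m = epi_pairs_Ob[OF L T H]
  have "H = T" if "\<pi> \<in> Iso C (rep H) (rep T)"
    using quot_obj_cls[OF m(2)] quot_obj_cls[OF ident_Epi[OF m(1)]] cls_top_iff[OF m(2)] that
      formation_rep[OF L T] formation_rep[OF L m(4)] by simp
  then show ?thesis using cls_top_iff[OF m(2)] by auto
qed

text \<open>Only automorphisms of T contribute; their number cancels the weight by automorphisms
  carried by the pairs.\<close>

lemma infsum_top:
  fixes g :: "'o set \<Rightarrow> real"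
  assumes L: "formation C L" and T: "T \<in> L"
  shows "infsum (\<lambda>(H, \<pi>). if cls \<pi> = qtop (rep H) then g H else 0) (epi_pairs L T) = real (card (Aut C (rep T))) * g T"
proof -
  have TO: "rep T \<in> Ob C" using formation_rep[OF L T] by simp
  have sub: "{T} \<times> Aut C (rep T) \<subseteq> epi_pairs L T" using T Iso_Epi by (auto simp: epi_pairs_mem)
  have "infsum (\<lambda>(H, \<pi>). if cls \<pi> = qtop (rep H) then g H else 0) (epi_pairs L T) =
      infsum (\<lambda>(H, \<pi>). g H) ({T} \<times> Aut C (rep T))"
  proof (rule infsum_cong_neutral)
    fix e assume e: "e \<in> epi_pairs L T - {T} \<times> Aut C (rep T)"
    obtain H \<pi> where e': "e = (H, \<pi>)" by (metis surj_pair)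
    then show "(case e of (H, \<pi>) \<Rightarrow> if cls \<pi> = qtop (rep H) then g H else 0) = 0"
      using epi_pairs_iso[OF L _ T, of H \<pi>] e by auto
  next
    fix e assume e: "e \<in> epi_pairs L T \<inter> {T} \<times> Aut C (rep T)"
    obtain H \<pi> where e': "e = (H, \<pi>)" by (metis surj_pair)
    then show "(case e of (H, \<pi>) \<Rightarrow> if cls \<pi> = qtop (rep H) then g H else 0) = (case e of (H, \<pi>) \<Rightarrow> g H)"
      using epi_pairs_iso[OF L _ T, of H \<pi>] e by auto
  qed (use sub in auto)
  also have "\<dots> = (\<Sum>(H, \<pi>) \<in> {T} \<times> Aut C (rep T). g H)"
    using finite_Aut[OF TO] by (intro infsum_finite) auto
  also have "\<dots> = real (card (Aut C (rep T))) * g T"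
    by (subst sum.cartesian_product[symmetric]) simp
  finally show ?thesis .
qed

subsection \<open>Consequences of well-behavedness\<close>

lemma well_behaved_summable:
  assumes wb: "well_behaved C M" and L: "L \<in> levels C" and F: "F \<in> L"
  shows "(\<lambda>(G, \<pi>). \<bar>real_of_int (mu C \<pi>)\<bar> * real (Z_count C \<pi>) ^ 3 * \<bar>M G / real (card (Aut C (rep G)))\<bar>) summable_on epi_pairs L F"
  unfolding epi_pairs_def
proof (rule summable_on_SigmaI)
  fix G assume G: "G \<in> L"
  have "finite (Epi C (rep G) (rep F))"
    using finite_Epi formation_rep[OF level_formation[OF L]] G F by blast
  then show "((\<lambda>\<pi>. case (G, \<pi>) of (G, \<pi>) \<Rightarrow> \<bar>real_of_int (mu C \<pi>)\<bar> * real (Z_count C \<pi>) ^ 3 * \<bar>M G / real (card (Aut C (rep G)))\<bar>) has_sum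
    (\<Sum>\<pi> \<in> Epi C (rep G) (rep F). \<bar>real_of_int (mu C \<pi>)\<bar> / real (card (Aut C (rep G))) * real (Z_count C \<pi>) ^ 3 * \<bar>M G\<bar>))
    (Epi C (rep G) (rep F))"
    by (auto intro!: has_sum_finiteI sum.cong simp: abs_divide)
qed (use wb L F in \<open>auto simp: well_behaved_def\<close>)

lemma summable_mu:
  assumes wb: "well_behaved C M" and L: "L \<in> levels C" and F: "F \<in> L"
  shows "(\<lambda>(G, \<pi>). \<bar>real_of_int (mu C \<pi>) * (M G / real (card (Aut C (rep G))))\<bar>) summable_on epi_pairs L F"
proof (rule summable_on_comparison_test[OF well_behaved_summable[OF assms]])
  fix e assume e: "e \<in> epi_pairs L F"
  obtain G \<pi> where e': "e = (G, \<pi>)" by (metis surj_pair)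
  have "real (Z_count C \<pi>) \<ge> 1" using Z_count_pos e e' by (fastforce simp: epi_pairs_mem)
  then have z: "real (Z_count C \<pi>) ^ 3 \<ge> 1" by simp
  have "\<bar>real_of_int (mu C \<pi>)\<bar> * 1 * \<bar>M G / real (card (Aut C (rep G)))\<bar> \<le>
      \<bar>real_of_int (mu C \<pi>)\<bar> * real (Z_count C \<pi>) ^ 3 * \<bar>M G / real (card (Aut C (rep G)))\<bar>"
    using z by (intro mult_right_mono mult_left_mono) auto
  then show "(case e of (G, \<pi>) \<Rightarrow> \<bar>real_of_int (mu C \<pi>) * (M G / real (card (Aut C (rep G))))\<bar>) \<le>
    (case e of (G, \<pi>) \<Rightarrow> \<bar>real_of_int (mu C \<pi>)\<bar> * real (Z_count C \<pi>) ^ 3 * \<bar>M G / real (card (Aut C (rep G)))\<bar>)"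
    using e' by (simp add: abs_mult)
qed auto

text \<open>Here the cube in well-behavedness is spent: once the pairs with a non-complemented
  interval are dropped, \<open>mobius_bound\<close> controls the inner sums.\<close>

lemma summable_ss:
  assumes wb: "well_behaved C M" and L: "L \<in> levels C" and F: "F \<in> L"
  shows "(\<lambda>(G, \<pi>). \<Sum>x \<in> up (rep G) (cls \<pi>). \<bar>if qss (rep G) (cls \<pi>) (qtop (rep G))
    then real_of_int (mobius (quot_poset C (rep G)) x (qtop (rep G))) * (M G / real (card (Aut C (rep G)))) else 0\<bar>)
    summable_on epi_pairs L F"
proof (rule summable_on_comparison_test[OF well_behaved_summable[OF assms]])
  fix e assume e: "e \<in> epi_pairs L F"
  obtain G \<pi> where e': "e = (G, \<pi>)" by (metis surj_pair)
  then have p: "\<pi> \<in> Epi C (rep G) (rep F)" using e by (auto simp: epi_pairs_mem)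
  show "(case e of (G, \<pi>) \<Rightarrow> \<Sum>x \<in> up (rep G) (cls \<pi>). \<bar>if qss (rep G) (cls \<pi>) (qtop (rep G))
      then real_of_int (mobius (quot_poset C (rep G)) x (qtop (rep G))) * (M G / real (card (Aut C (rep G)))) else 0\<bar>) \<le>
    (case e of (G, \<pi>) \<Rightarrow> \<bar>real_of_int (mu C \<pi>)\<bar> * real (Z_count C \<pi>) ^ 3 * \<bar>M G / real (card (Aut C (rep G)))\<bar>)"
  proof (cases "qss (rep G) (cls \<pi>) (qtop (rep G))")
    case True
    have "(\<Sum>x \<in> up (rep G) (cls \<pi>). \<bar>real_of_int (mobius (quot_poset C (rep G)) x (qtop (rep G))) * (M G / real (card (Aut C (rep G))))\<bar>) =
        (\<Sum>x \<in> up (rep G) (cls \<pi>). \<bar>real_of_int (mobius (quot_poset C (rep G)) x (qtop (rep G)))\<bar>) * \<bar>M G / real (card (Aut C (rep G)))\<bar>"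
      by (simp only: sum_distrib_right abs_mult)
    also have "\<dots> \<le> (\<bar>real_of_int (mu C \<pi>)\<bar> * real (Z_count C \<pi>) ^ 3) * \<bar>M G / real (card (Aut C (rep G)))\<bar>"
      by (intro mult_right_mono mobius_bound[OF p True]) auto
    finally show ?thesis using True e' by simp
  qed (use e' in auto)
qed (auto intro!: sum_nonneg)

lemma v_val_has_sum:
  assumes wb: "well_behaved C M" and L: "L \<in> levels C" and F: "F \<in> L"
  shows "((\<lambda>(G, \<pi>). real_of_int (mu C \<pi>) * (M G / real (card (Aut C (rep G))))) has_sum
    real (card (Aut C (rep F))) * v_val C M L F) (epi_pairs L F)"
proof -
  note Lf = level_formation[OF L]
  let ?f = "\<lambda>(G, \<pi>). real_of_int (mu C \<pi>) * (M G / real (card (Aut C (rep G))))"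
  have FO: "rep F \<in> Ob C" using formation_rep[OF Lf F] by simp
  have pos: "real (card (Aut C (rep F))) > 0" using card_Aut_pos[OF FO] by simp
  have "?f summable_on epi_pairs L F"
    using summable_mu[OF assms] unfolding summable_on_iff_abs_summable_on_real[of ?f] case_prod_beta
    by simp
  then obtain s where s: "(?f has_sum s) (epi_pairs L F)" by (auto simp: summable_on_def)
  have "((\<lambda>G. real (card (Aut C (rep F))) * (real_of_int (mu_hat C (rep F) (rep G)) / real (card (Aut C (rep G))) * M G)) has_sum s) L"
  proof (rule has_sum_SigmaD[OF s[unfolded epi_pairs_def]])
    fix G assume G: "G \<in> L"
    have GO: "rep G \<in> Ob C" using formation_rep[OF Lf G] by simp
    have "(\<Sum>\<pi> \<in> Epi C (rep G) (rep F). real_of_int (mu C \<pi>)) = real (card (Aut C (rep F))) * real_of_int (mu_hat C (rep F) (rep G))"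
      using arg_cong[OF sum_mu[OF GO FO], of real_of_int] by simp
    then have "(\<Sum>\<pi> \<in> Epi C (rep G) (rep F). real_of_int (mu C \<pi>) * (M G / real (card (Aut C (rep G))))) =
        real (card (Aut C (rep F))) * (real_of_int (mu_hat C (rep F) (rep G)) / real (card (Aut C (rep G))) * M G)"
      unfolding sum_distrib_right[symmetric] by simp
    then show "((\<lambda>y. ?f (G, y)) has_sum real (card (Aut C (rep F))) *
        (real_of_int (mu_hat C (rep F) (rep G)) / real (card (Aut C (rep G))) * M G)) (Epi C (rep G) (rep F))"
      using finite_Epi[OF GO FO] by (auto intro!: has_sum_finiteI)
  qed
  from has_sum_cdiv_const[OF this, of "real (card (Aut C (rep F)))"]
  have "((\<lambda>G. real_of_int (mu_hat C (rep F) (rep G)) / real (card (Aut C (rep G))) * M G) has_sum s / real (card (Aut C (rep F)))) L"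
    using pos by simp
  then have "v_val C M L F = s / real (card (Aut C (rep F)))" unfolding v_val_def by (rule infsumI)
  then show ?thesis using s pos by simp
qed

subsection \<open>Moments determine the measure of a level\<close>

text \<open>Each moment is inserted as a sum of p over epimorphisms into the formula for
  \<open>v_val\<close>. After exchanging sums the inner sum of \<open>\<mu>(T,x)\<close> over x
  below H vanishes unless H is T. Nonnegativity of p makes the exchange legitimate.\<close>

theorem moments_unique:
  assumes wb: "well_behaved C M" and L: "L \<in> levels C"
    and p: "\<And>F. F \<in> L \<Longrightarrow> 0 \<le> p F"
    and mom: "\<And>G. G \<in> L \<Longrightarrow> ((\<lambda>H. real (card (Epi C (rep H) (rep G))) * p H) has_sum M G) L"
    and T: "T \<in> L"
  shows "v_val C M L T = p T"
proof -
  note Lf = level_formation[OF L]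
  have TO: "rep T \<in> Ob C" using formation_rep[OF Lf T] by simp
  define f where "f H \<pi> x = real_of_int (mobius (quot_poset C (rep H)) (cls \<pi>) x) * p H" for H \<pi> x
  have M: "M G \<ge> 0" if "G \<in> L" for G using has_sum_nonneg[OF mom[OF that]] p by simp
  have Msum: "((\<lambda>(H, \<tau>). p H) has_sum M G) (epi_pairs L G)" if G: "G \<in> L" for G
    unfolding epi_pairs_def
  proof (rule has_sum_SigmaI[OF _ mom[OF G]])
    have in': "((\<lambda>y. case (H, y) of (H, \<tau>) \<Rightarrow> p H) has_sum real (card (Epi C (rep H) (rep G))) * p H) (Epi C (rep H) (rep G))"
      if H: "H \<in> L" for H
      using finite_Epi formation_rep[OF Lf G] formation_rep[OF Lf H] by (auto intro!: has_sum_finiteI)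
    then show "\<And>H. H \<in> L \<Longrightarrow> ((\<lambda>y. case (H, y) of (H, \<tau>) \<Rightarrow> p H) has_sum real (card (Epi C (rep H) (rep G))) * p H) (Epi C (rep H) (rep G))" .
    show "(\<lambda>(H, \<tau>). p H) summable_on Sigma L (\<lambda>H. Epi C (rep H) (rep G))"
      by (rule summable_on_SigmaI[OF in']) (use mom[OF G] has_sum_imp_summable p in auto)
  qed
  have fc: "f H (\<sigma> \<bullet> \<tau>) (cls \<tau>) = real_of_int (mu C \<sigma>) * p H"
    if "(S, \<sigma>) \<in> epi_pairs L T" "(H, \<tau>) \<in> epi_pairs L S" for S \<sigma> H \<tau>
    using that mu_comp[of \<tau> "rep H" "rep S" \<sigma> "rep T"] by (simp add: f_def epi_pairs_mem)
  \<comment> \<open>Stated for a function g so that it yields both the absolute sums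
    (\<open>g = abs\<close>), used to establish summability, and the signed ones.\<close>
  have inner: "((\<lambda>(H, \<tau>). g (f H (\<sigma> \<bullet> \<tau>) (cls \<tau>))) has_sum g (real_of_int (mu C \<sigma>)) * M S) (epi_pairs L S)"
    if m: "(S, \<sigma>) \<in> epi_pairs L T" and g: "\<And>c t. 0 \<le> t \<Longrightarrow> g (c * t) = g c * t" for S \<sigma> and g :: "real \<Rightarrow> real"
  proof -
    have S: "S \<in> L" using m by (simp add: epi_pairs_mem)
    have "((\<lambda>(H, \<tau>). g (f H (\<sigma> \<bullet> \<tau>) (cls \<tau>))) has_sum g (real_of_int (mu C \<sigma>)) * M S) (epi_pairs L S) \<longleftrightarrow>
        ((\<lambda>e. g (real_of_int (mu C \<sigma>)) * (case e of (H, \<tau>) \<Rightarrow> p H)) has_sum g (real_of_int (mu C \<sigma>)) * M S) (epi_pairs L S)"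
    proof (rule has_sum_cong)
      fix e assume e: "e \<in> epi_pairs L S"
      obtain H \<tau> where e': "e = (H, \<tau>)" by (metis surj_pair)
      then show "(case e of (H, \<tau>) \<Rightarrow> g (f H (\<sigma> \<bullet> \<tau>) (cls \<tau>))) = g (real_of_int (mu C \<sigma>)) * (case e of (H, \<tau>) \<Rightarrow> p H)"
        using fc[OF m, of H \<tau>] e g[of "p H"] p[of H] by (auto simp: epi_pairs_mem)
    qed
    then show ?thesis using has_sum_cmult_right[OF Msum[OF S]] by blast
  qed
  have "(\<lambda>(S, \<sigma>). \<bar>real_of_int (mu C \<sigma>)\<bar> * M S / real (card (Aut C (rep S)))) summable_on epi_pairs L T"
    using summable_mu[OF wb L T]
    by (rule summable_on_cong[THEN iffD1, rotated]) (auto simp: abs_mult M epi_pairs_mem)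
  then obtain s where s: "((\<lambda>(S, \<sigma>). \<bar>real_of_int (mu C \<sigma>)\<bar> * M S / real (card (Aut C (rep S)))) has_sum s) (epi_pairs L T)"
    by (auto simp: summable_on_def)
  have "((\<lambda>(H, \<pi>). \<Sum>x \<in> up (rep H) (cls \<pi>). \<bar>f H \<pi> x\<bar>) has_sum s) (epi_pairs L T)"
    by (rule fubini_backward[OF Lf T _ _ s]) (use inner[where g = abs] in \<open>auto simp: abs_mult\<close>)
  then have sm: "(\<lambda>(H, \<pi>). \<Sum>x \<in> up (rep H) (cls \<pi>). \<bar>f H \<pi> x\<bar>) summable_on epi_pairs L T" by (rule has_sum_imp_summable)
  have 1: "((\<lambda>(S, \<sigma>). infsum (\<lambda>(H, \<tau>). f H (\<sigma> \<bullet> \<tau>) (cls \<tau>)) (epi_pairs L S) / real (card (Aut C (rep S)))) has_sum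
      infsum (\<lambda>(H, \<pi>). \<Sum>x \<in> up (rep H) (cls \<pi>). f H \<pi> x) (epi_pairs L T)) (epi_pairs L T)"
    by (rule fubini_forward(2)[OF Lf T sm])
  have "((\<lambda>(S, \<sigma>). real_of_int (mu C \<sigma>) * (M S / real (card (Aut C (rep S))))) has_sum
      infsum (\<lambda>(H, \<pi>). \<Sum>x \<in> up (rep H) (cls \<pi>). f H \<pi> x) (epi_pairs L T)) (epi_pairs L T)"
  proof (rule has_sum_cong[THEN iffD1, OF _ 1])
    fix e assume e: "e \<in> epi_pairs L T"
    obtain S \<sigma> where e': "e = (S, \<sigma>)" by (metis surj_pair)
    then show "(case e of (S, \<sigma>) \<Rightarrow> infsum (\<lambda>(H, \<tau>). f H (\<sigma> \<bullet> \<tau>) (cls \<tau>)) (epi_pairs L S) / real (card (Aut C (rep S)))) =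
        (case e of (S, \<sigma>) \<Rightarrow> real_of_int (mu C \<sigma>) * (M S / real (card (Aut C (rep S)))))"
      using infsumI[OF inner[where g = "\<lambda>t. t"], of S \<sigma>] e by simp
  qed
  then have "real (card (Aut C (rep T))) * v_val C M L T = infsum (\<lambda>(H, \<pi>). \<Sum>x \<in> up (rep H) (cls \<pi>). f H \<pi> x) (epi_pairs L T)"
    by (rule has_sum_unique[OF v_val_has_sum[OF wb L T]])
  also have "\<dots> = infsum (\<lambda>(H, \<pi>). if cls \<pi> = qtop (rep H) then p H else 0) (epi_pairs L T)"
  proof (rule infsum_cong)
    fix e assume e: "e \<in> epi_pairs L T"
    obtain H \<pi> where e': "e = (H, \<pi>)" by (metis surj_pair)
    note m = epi_pairs_Ob[OF Lf T, of H \<pi>]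
    interpret Q: mobius_lattice "car (rep H)" "qle (rep H)" "qjn (rep H)" "qmt (rep H)" "qbot (rep H)" "qtop (rep H)"
      "mobius (quot_poset C (rep H))" by (rule quot_lattice) (use m e e' in auto)
    have c: "cls \<pi> \<in> car (rep H)" using m e e' by simp
    have u: "up (rep H) (cls \<pi>) = {z. z \<in> car (rep H) \<and> qle (rep H) (cls \<pi>) z \<and> qle (rep H) z (qtop (rep H))}"
      by (auto simp: up_def)
    have "(\<Sum>x \<in> up (rep H) (cls \<pi>). f H \<pi> x) = real_of_int (\<Sum>x \<in> up (rep H) (cls \<pi>). mobius (quot_poset C (rep H)) (cls \<pi>) x) * p H"
      by (simp add: f_def sum_distrib_right)
    then show "(case e of (H, \<pi>) \<Rightarrow> \<Sum>x \<in> up (rep H) (cls \<pi>). f H \<pi> x) = (case e of (H, \<pi>) \<Rightarrow> if cls \<pi> = qtop (rep H) then p H else 0)"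
      using Q.sum_left[OF c Q.tp_closed] c u e' by simp
  qed
  also have "\<dots> = real (card (Aut C (rep T))) * p T" by (rule infsum_top[OF Lf T])
  finally show ?thesis using card_Aut_pos[OF TO] by simp
qed

end

subsection \<open>Nonnegativity of the candidate measure gives back the moments\<close>

text \<open>The pairs \<open>(F, \<phi> : F \<rightarrow> T)\<close> are sorted by the iterated socles of \<open>F\<close> over \<open>T\<close>. The weight
  \<open>layer L M S \<sigma>\<close> is the inclusion-exclusion formula, in terms of moments, for the mass of the
  pairs whose socle over \<open>T\<close> is \<open>\<sigma> : S \<rightarrow> T\<close>. Each single step of the sorting is an absolutely
  convergent sum, unlike the inversion as a whole.\<close>

context diamond_category
begin

definition layer :: "'o set set \<Rightarrow> ('o set \<Rightarrow> real) \<Rightarrow> 'o set \<Rightarrow> 'm \<Rightarrow> real" where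
  "layer L M S \<sigma> = infsum (\<lambda>(H, \<tau>). if qss (rep H) (cls (\<sigma> \<bullet> \<tau>)) (qtop (rep H))
    then real_of_int (mu C \<tau>) * (M H / real (card (Aut C (rep H)))) else 0) (epi_pairs L S)"

lemma sum_mobius_up:
  assumes G: "G \<in> Ob C" and x: "x \<in> car G"
  shows "(\<Sum>y \<in> up G x. real_of_int (mobius (quot_poset C G) y (qtop G))) = (if x = qtop G then 1 else 0)"
proof -
  interpret Q: mobius_lattice "car G" "qle G" "qjn G" "qmt G" "qbot G" "qtop G" "mobius (quot_poset C G)"
    by (rule quot_lattice[OF G])
  have u: "up G x = {z. z \<in> car G \<and> qle G x z \<and> qle G z (qtop G)}" by (auto simp: up_def)
  show ?thesis unfolding u of_int_sum[symmetric] using Q.sum_right[OF x Q.tp_closed] x by simp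
qed

text \<open>Summing the layer weights over all S gives, for each pair H over T with complemented
  interval, the full sum of \<open>\<mu>(x,H)\<close>, which is 0 unless H is T. The complementation
  condition does not involve x, so this inner sum is complete.\<close>

lemma moment_layers:
  assumes wb: "well_behaved C M" and L: "L \<in> levels C" and T: "T \<in> L"
  shows "((\<lambda>(S, \<sigma>). layer L M S \<sigma> / real (card (Aut C (rep S)))) has_sum M T) (epi_pairs L T)"
proof -
  note Lf = level_formation[OF L]
  have TO: "rep T \<in> Ob C" using formation_rep[OF Lf T] by simp
  let ?mob = "\<lambda>H x. real_of_int (mobius (quot_poset C (rep H)) x (qtop (rep H)))"
  let ?m = "\<lambda>H. M H / real (card (Aut C (rep H)))"
  define f where "f H \<pi> x = (if qss (rep H) (cls \<pi>) (qtop (rep H)) then ?mob H x * ?m H else 0)" for H \<pi> x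
  have sm: "(\<lambda>(H, \<pi>). \<Sum>x \<in> up (rep H) (cls \<pi>). \<bar>f H \<pi> x\<bar>) summable_on epi_pairs L T"
    unfolding f_def by (rule summable_ss[OF wb L T])
  have w: "infsum (\<lambda>(H, \<tau>). f H (\<sigma> \<bullet> \<tau>) (cls \<tau>)) (epi_pairs L S) = layer L M S \<sigma>" for S \<sigma>
    unfolding layer_def by (rule infsum_cong) (auto simp: f_def epi_pairs_mem mu_Epi)
  have "infsum (\<lambda>(H, \<pi>). \<Sum>x \<in> up (rep H) (cls \<pi>). f H \<pi> x) (epi_pairs L T) =
      infsum (\<lambda>(H, \<pi>). if cls \<pi> = qtop (rep H) then ?m H else 0) (epi_pairs L T)"
  proof (rule infsum_cong)
    fix e assume e: "e \<in> epi_pairs L T"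
    obtain H \<pi> where e': "e = (H, \<pi>)" by (metis surj_pair)
    note m = epi_pairs_Ob[OF Lf T e[unfolded e']]
    interpret Q: finite_modular_lattice "car (rep H)" "qle (rep H)" "qjn (rep H)" "qmt (rep H)" "qbot (rep H)" "qtop (rep H)"
      by (rule quot_fml[OF m(1)])
    have "(\<Sum>x \<in> up (rep H) (cls \<pi>). f H \<pi> x) =
        (if qss (rep H) (cls \<pi>) (qtop (rep H)) then (\<Sum>x \<in> up (rep H) (cls \<pi>). ?mob H x) * ?m H else 0)"
      by (simp only: f_def sum_distrib_right if_cancel) simp
    also have "\<dots> = (if cls \<pi> = qtop (rep H) then ?m H else 0)"
      unfolding sum_mobius_up[OF m(1,3)] using Q.ss_refl[OF Q.tp_closed] by auto
    finally show "(case e of (H, \<pi>) \<Rightarrow> \<Sum>x \<in> up (rep H) (cls \<pi>). f H \<pi> x) =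
        (case e of (H, \<pi>) \<Rightarrow> if cls \<pi> = qtop (rep H) then ?m H else 0)"
      using e' by simp
  qed
  also have "\<dots> = M T" using infsum_top[OF Lf T, of ?m] card_Aut_pos[OF TO] by simp
  finally show ?thesis using fubini_forward(2)[OF Lf T sm] w by simp
qed

lemma ss_pull:
  assumes t: "\<tau> \<in> Epi C H G" and s: "\<sigma> \<in> Epi C G F"
  shows "qss H (cls (\<sigma> \<bullet> \<tau>)) (cls \<tau>) \<longleftrightarrow> qss G (cls \<sigma>) (qtop G)"
proof -
  have O: "H \<in> Ob C" "G \<in> Ob C" using Epi_Ob[OF t] by auto
  interpret L: lower_embedding "car G" "qle G" "qjn G" "qmt G" "qbot G" "qtop G"
    "car H" "qle H" "qjn H" "qmt H" "qbot H" "qtop H" "pull \<tau>" by (rule pull_embedding[OF t])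
  show ?thesis using L.ss_iff[OF cls_car[OF s] qtop_car[OF O(2)]] pull_cls[OF t s] pull_top[OF t] by simp
qed

lemma Soc_pull:
  assumes t: "\<tau> \<in> Epi C H G" and r: "\<rho> \<in> Epi C G F" and s: "\<sigma> \<in> Epi C F E"
  shows "qSoc H (cls (\<sigma> \<bullet> (\<rho> \<bullet> \<tau>))) (cls \<tau>) = cls (\<rho> \<bullet> \<tau>) \<longleftrightarrow> qSoc G (cls (\<sigma> \<bullet> \<rho>)) (qtop G) = cls \<rho>"
proof -
  have O: "H \<in> Ob C" "G \<in> Ob C" using Epi_Ob[OF t] by auto
  interpret L: lower_embedding "car G" "qle G" "qjn G" "qmt G" "qbot G" "qtop G"
    "car H" "qle H" "qjn H" "qmt H" "qbot H" "qtop H" "pull \<tau>" by (rule pull_embedding[OF t])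
  have sr: "\<sigma> \<bullet> \<rho> \<in> Epi C G E" using Epi_comp[OF r s] .
  have a: "(\<sigma> \<bullet> \<rho>) \<bullet> \<tau> = \<sigma> \<bullet> (\<rho> \<bullet> \<tau>)" using Comp_assoc Epi_Hom t r s by blast
  have "pull \<tau> (qSoc G (cls (\<sigma> \<bullet> \<rho>)) (qtop G)) = qSoc H (cls (\<sigma> \<bullet> (\<rho> \<bullet> \<tau>))) (cls \<tau>)"
    using L.Soc_eq[OF cls_car[OF sr] qtop_car[OF O(2)] qle_top[OF O(2) cls_car[OF sr]]]
      pull_cls[OF t sr] pull_top[OF t] a by simp
  moreover have "pull \<tau> (cls \<rho>) = cls (\<rho> \<bullet> \<tau>)" using pull_cls[OF t r] .
  ultimately show ?thesis
    using L.eq_iff[OF L.L1.Soc_closed[OF cls_car[OF sr]] cls_car[OF r], of "qtop G"] by simp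
qed

lemma cls_comp_le:
  assumes t: "\<tau> \<in> Epi C H G" and s: "\<sigma> \<in> Epi C G F"
  shows "qle H (cls (\<sigma> \<bullet> \<tau>)) (cls \<tau>)"
  using cls_le_iff[OF Epi_comp[OF t s] t] s by blast

lemma layer_zero:
  assumes L: "L \<in> levels C" and s: "\<sigma> \<in> Epi C (rep S) (rep T)" and S: "S \<in> L" and n: "\<not> qss (rep S) (cls \<sigma>) (qtop (rep S))"
  shows "layer L M S \<sigma> = 0"
  unfolding layer_def
proof (rule infsum_0)
  fix e assume e: "e \<in> epi_pairs L S"
  obtain H \<tau> where e': "e = (H, \<tau>)" by (metis surj_pair)
  note m = epi_pairs_Ob[OF level_formation[OF L] S e[unfolded e']]
  interpret Q: finite_modular_lattice "car (rep H)" "qle (rep H)" "qjn (rep H)" "qmt (rep H)" "qbot (rep H)" "qtop (rep H)"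
    by (rule quot_fml[OF m(1)])
  have "\<not> qss (rep H) (cls (\<sigma> \<bullet> \<tau>)) (qtop (rep H))"
    using Q.ss_lower[of "cls (\<sigma> \<bullet> \<tau>)" "qtop (rep H)" "cls \<tau>"] cls_comp_le[OF m(2) s] m(3) n ss_pull[OF m(2) s] by auto
  then show "(case e of (H, \<tau>) \<Rightarrow> if qss (rep H) (cls (\<sigma> \<bullet> \<tau>)) (qtop (rep H))
    then real_of_int (mu C \<tau>) * (M H / real (card (Aut C (rep H)))) else 0) = 0" using e' by simp
qed

text \<open>Splits the mass of pairs with socle S over T according to the socle R over S. Then R
  must itself have socle S over T, which is the condition on \<open>qSoc\<close>.\<close>

lemma layer_layers:
  assumes wb: "well_behaved C M" and L: "L \<in> levels C" and T: "T \<in> L" and S: "(S, \<sigma>) \<in> epi_pairs L T"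
  shows "((\<lambda>(R, \<rho>). (if qSoc (rep R) (cls (\<sigma> \<bullet> \<rho>)) (qtop (rep R)) = cls \<rho> then layer L M R \<rho> else 0) /
    real (card (Aut C (rep R)))) has_sum layer L M S \<sigma>) (epi_pairs L S)"
proof -
  note Lf = level_formation[OF L]
  have SL: "S \<in> L" and s: "\<sigma> \<in> Epi C (rep S) (rep T)" using S by (auto simp: epi_pairs_mem)
  let ?mob = "\<lambda>H x. real_of_int (mobius (quot_poset C (rep H)) x (qtop (rep H)))"
  let ?m = "\<lambda>H. M H / real (card (Aut C (rep H)))"
  show ?thesis
  proof (cases "qss (rep S) (cls \<sigma>) (qtop (rep S))")
    case False
    have "((\<lambda>(R, \<rho>). (if qSoc (rep R) (cls (\<sigma> \<bullet> \<rho>)) (qtop (rep R)) = cls \<rho> then layer L M R \<rho> else 0) /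
      real (card (Aut C (rep R)))) has_sum 0) (epi_pairs L S)"
    proof (rule has_sum_0)
      fix e assume e: "e \<in> epi_pairs L S"
      obtain R \<rho> where e': "e = (R, \<rho>)" by (metis surj_pair)
      note m = epi_pairs_Ob[OF Lf SL e[unfolded e']]
      interpret Q: finite_modular_lattice "car (rep R)" "qle (rep R)" "qjn (rep R)" "qmt (rep R)" "qbot (rep R)" "qtop (rep R)"
        by (rule quot_fml[OF m(1)])
      have c: "cls (\<sigma> \<bullet> \<rho>) \<in> car (rep R)" using cls_car[OF Epi_comp[OF m(2) s]] .
      have "qSoc (rep R) (cls (\<sigma> \<bullet> \<rho>)) (qtop (rep R)) \<noteq> cls \<rho>"
        using Q.ss_Soc[OF c Q.tp_closed] c False ss_pull[OF m(2) s] by auto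
      then show "(case e of (R, \<rho>) \<Rightarrow> (if qSoc (rep R) (cls (\<sigma> \<bullet> \<rho>)) (qtop (rep R)) = cls \<rho> then layer L M R \<rho> else 0) /
        real (card (Aut C (rep R)))) = 0" using e' by simp
    qed
    then show ?thesis using layer_zero[OF L s SL False] by simp
  next
    case True
    \<comment> \<open>The requirement that x have socle S over T can only remove terms, so the bound
      for complemented intervals over S still gives summability.\<close>
    define f where "f H \<psi> x = (if qSoc (rep H) (cls (\<sigma> \<bullet> \<psi>)) x = cls \<psi> then
      (if qss (rep H) (cls \<psi>) (qtop (rep H)) then ?mob H x * ?m H else 0) else 0)" for H \<psi> x
    have sm: "(\<lambda>(H, \<pi>). \<Sum>x \<in> up (rep H) (cls \<pi>). \<bar>f H \<pi> x\<bar>) summable_on epi_pairs L S"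
      by (rule summable_on_comparison_test[OF summable_ss[OF wb L SL]])
        (auto simp: f_def intro!: sum_mono sum_nonneg)
    have w: "infsum (\<lambda>(H, \<tau>). f H (\<rho> \<bullet> \<tau>) (cls \<tau>)) (epi_pairs L R) =
        (if qSoc (rep R) (cls (\<sigma> \<bullet> \<rho>)) (qtop (rep R)) = cls \<rho> then layer L M R \<rho> else 0)" if R: "(R, \<rho>) \<in> epi_pairs L S" for R \<rho>
    proof -
      have "infsum (\<lambda>(H, \<tau>). f H (\<rho> \<bullet> \<tau>) (cls \<tau>)) (epi_pairs L R) =
        infsum (\<lambda>(H, \<tau>). if qSoc (rep R) (cls (\<sigma> \<bullet> \<rho>)) (qtop (rep R)) = cls \<rho> then
          (if qss (rep H) (cls (\<rho> \<bullet> \<tau>)) (qtop (rep H)) then real_of_int (mu C \<tau>) * ?m H else 0) else 0) (epi_pairs L R)"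
      proof (rule infsum_cong)
        fix e assume e: "e \<in> epi_pairs L R"
        obtain H \<tau> where e': "e = (H, \<tau>)" by (metis surj_pair)
        have t: "\<tau> \<in> Epi C (rep H) (rep R)" and r: "\<rho> \<in> Epi C (rep R) (rep S)" using e e' R by (auto simp: epi_pairs_mem)
        show "(case e of (H, \<tau>) \<Rightarrow> f H (\<rho> \<bullet> \<tau>) (cls \<tau>)) =
          (case e of (H, \<tau>) \<Rightarrow> if qSoc (rep R) (cls (\<sigma> \<bullet> \<rho>)) (qtop (rep R)) = cls \<rho> then
          (if qss (rep H) (cls (\<rho> \<bullet> \<tau>)) (qtop (rep H)) then real_of_int (mu C \<tau>) * ?m H else 0) else 0)"
          using e' Soc_pull[OF t r s] mu_Epi[OF t] by (simp add: f_def)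
      qed
      moreover have "infsum (\<lambda>(H :: 'o set, \<tau> :: 'm). 0 :: real) (epi_pairs L R) = 0" by (rule infsum_0) auto
      ultimately show ?thesis
        by (cases "qSoc (rep R) (cls (\<sigma> \<bullet> \<rho>)) (qtop (rep R)) = cls \<rho>") (simp_all add: layer_def)
    qed
    have "infsum (\<lambda>(H, \<pi>). \<Sum>x \<in> up (rep H) (cls \<pi>). f H \<pi> x) (epi_pairs L S) = layer L M S \<sigma>"
      unfolding layer_def
    proof (rule infsum_cong)
      fix e assume e: "e \<in> epi_pairs L S"
      obtain H \<psi> where e': "e = (H, \<psi>)" by (metis surj_pair)
      note m = epi_pairs_Ob[OF Lf SL e[unfolded e']]
      interpret Q: mobius_lattice "car (rep H)" "qle (rep H)" "qjn (rep H)" "qmt (rep H)" "qbot (rep H)" "qtop (rep H)"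
        "mobius (quot_poset C (rep H))" by (rule quot_lattice[OF m(1)])
      have c: "cls (\<sigma> \<bullet> \<psi>) \<in> car (rep H)" using cls_car[OF Epi_comp[OF m(2) s]] .
      have s1: "Q.ss (cls (\<sigma> \<bullet> \<psi>)) (cls \<psi>)" using ss_pull[OF m(2) s] True by simp
      \<comment> \<open>By \<open>sum_Soc\<close> the sum over x collapses to
        \<open>x = \<psi>\<close> and demands that H be complemented over T, which is precisely the
        summand of \<open>layer L M S \<sigma>\<close>.\<close>
      have "(\<Sum>x \<in> up (rep H) (cls \<psi>). f H \<psi> x) =
          (if Q.ss (cls (\<sigma> \<bullet> \<psi>)) (qtop (rep H)) then ?mob H (cls \<psi>) * ?m H else 0)"
      proof (cases "Q.ss (cls \<psi>) (qtop (rep H))")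
        case True
        have "(\<Sum>x \<in> up (rep H) (cls \<psi>). f H \<psi> x) =
            real_of_int (\<Sum>x \<in> up (rep H) (cls \<psi>). if Q.Soc (cls (\<sigma> \<bullet> \<psi>)) x = cls \<psi> then mobius (quot_poset C (rep H)) x (qtop (rep H)) else 0) * ?m H"
          unfolding of_int_sum sum_distrib_right by (rule sum.cong) (use True in \<open>auto simp: f_def\<close>)
        then show ?thesis using Q.sum_Soc[OF s1 True] unfolding up_def by simp
      next
        case False
        then have "\<not> Q.ss (cls (\<sigma> \<bullet> \<psi>)) (qtop (rep H))"
          using Q.ss_upper[of "cls (\<sigma> \<bullet> \<psi>)" "qtop (rep H)" "cls \<psi>"] Q.ssD[OF s1] by auto
        then show ?thesis using False by (auto simp: f_def intro!: sum.neutral)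
      qed
      then show "(case e of (H, \<pi>) \<Rightarrow> \<Sum>x \<in> up (rep H) (cls \<pi>). f H \<pi> x) =
        (case e of (H, \<tau>) \<Rightarrow> if qss (rep H) (cls (\<sigma> \<bullet> \<tau>)) (qtop (rep H)) then real_of_int (mu C \<tau>) * ?m H else 0)"
        using e' mu_Epi[OF m(2)] by simp
    qed
    then have 1: "((\<lambda>(R, \<rho>). infsum (\<lambda>(H, \<tau>). f H (\<rho> \<bullet> \<tau>) (cls \<tau>)) (epi_pairs L R) / real (card (Aut C (rep R)))) has_sum layer L M S \<sigma>) (epi_pairs L S)"
      using fubini_forward(2)[OF Lf SL sm] by simp
    show ?thesis
      by (rule has_sum_cong[THEN iffD1, OF _ 1]) (use w in auto)
  qed
qed

text \<open>For an automorphism the complementation condition drops only terms with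
  \<open>mu C \<tau> = 0\<close>, so the layer weight is the series for
  \<open>v_val\<close>.\<close>

lemma layer_iso:
  assumes wb: "well_behaved C M" and L: "L \<in> levels C" and S: "S \<in> L" and r: "\<rho> \<in> Aut C (rep S)"
  shows "layer L M S \<rho> = real (card (Aut C (rep S))) * v_val C M L S"
proof -
  note Lf = level_formation[OF L]
  have "layer L M S \<rho> = infsum (\<lambda>(H, \<tau>). real_of_int (mu C \<tau>) * (M H / real (card (Aut C (rep H))))) (epi_pairs L S)"
    unfolding layer_def
  proof (rule infsum_cong)
    fix e assume e: "e \<in> epi_pairs L S"
    obtain H \<tau> where e': "e = (H, \<tau>)" by (metis surj_pair)
    note m = epi_pairs_Ob[OF Lf S e[unfolded e']]
    interpret Q: mobius_lattice "car (rep H)" "qle (rep H)" "qjn (rep H)" "qmt (rep H)" "qbot (rep H)" "qtop (rep H)"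
      "mobius (quot_poset C (rep H))" by (rule quot_lattice[OF m(1)])
    have c: "cls (\<rho> \<bullet> \<tau>) = cls \<tau>" using cls_eqI[OF m(2) r] .
    have "mu C \<tau> = 0" if "\<not> Q.ss (cls \<tau>) (qtop (rep H))"
      using Q.not_ss_imp_zero[OF m(3) Q.tp_closed] m that mu_Epi[OF m(2)] by simp
    then show "(case e of (H, \<tau>) \<Rightarrow> if qss (rep H) (cls (\<rho> \<bullet> \<tau>)) (qtop (rep H))
      then real_of_int (mu C \<tau>) * (M H / real (card (Aut C (rep H)))) else 0) =
      (case e of (H, \<tau>) \<Rightarrow> real_of_int (mu C \<tau>) * (M H / real (card (Aut C (rep H)))))"
      using e' c by auto
  qed
  then show ?thesis using infsumI[OF v_val_has_sum[OF wb L S]] by simp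
qed

text \<open>Induction on the Loewy length left above S. Each step replaces a layer weight by those
  of the next layer; when no length is left, only automorphisms of S remain and the weight is
  \<open>v_val\<close>. Positivity allows the steps to be recombined.\<close>

lemma layer_has_sum:
  assumes wb: "well_behaved C M" and L: "L \<in> levels C" and T: "T \<in> L" and S: "(S, \<sigma>) \<in> epi_pairs L T"
    and pos: "\<And>F. F \<in> L \<Longrightarrow> 0 \<le> v_val C M L F"
    and bd: "\<And>F \<phi>. (F, \<phi>) \<in> epi_pairs L S \<Longrightarrow> qSoc (rep F) (cls (\<sigma> \<bullet> \<phi>)) (qtop (rep F)) = cls \<phi> \<Longrightarrow>
      qloewy (rep F) n (cls \<phi>) (qtop (rep F))"
  shows "((\<lambda>(F, \<phi>). if qSoc (rep F) (cls (\<sigma> \<bullet> \<phi>)) (qtop (rep F)) = cls \<phi> then v_val C M L F else 0)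
    has_sum layer L M S \<sigma>) (epi_pairs L S)"
  using T S bd
proof (induction n arbitrary: T S \<sigma>)
  case 0
  note Lf = level_formation[OF L]
  have SL: "S \<in> L" using 0 by (simp add: epi_pairs_mem)
  show ?case
  proof (rule has_sum_cong[THEN iffD1, OF _ layer_layers[OF wb L 0(1,2)]])
    fix e assume e: "e \<in> epi_pairs L S"
    obtain R \<rho> where e': "e = (R, \<rho>)" by (metis surj_pair)
    note m = epi_pairs_Ob[OF Lf SL e[unfolded e']]
    interpret Q: finite_modular_lattice "car (rep R)" "qle (rep R)" "qjn (rep R)" "qmt (rep R)" "qbot (rep R)" "qtop (rep R)"
      by (rule quot_fml[OF m(1)])
    have "layer L M R \<rho> / real (card (Aut C (rep R))) = v_val C M L R"
      if "qSoc (rep R) (cls (\<sigma> \<bullet> \<rho>)) (qtop (rep R)) = cls \<rho>"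
    proof -
      have "cls \<rho> = qtop (rep R)" using 0(3)[OF e[unfolded e'] that] by simp
      then have "R = S" "\<rho> \<in> Aut C (rep S)" using epi_pairs_iso[OF Lf e[unfolded e'] SL] by auto
      then show ?thesis using layer_iso[OF wb L SL, of \<rho>] card_Aut_pos[OF m(1)] by simp
    qed
    then show "(case e of (R, \<rho>) \<Rightarrow> (if qSoc (rep R) (cls (\<sigma> \<bullet> \<rho>)) (qtop (rep R)) = cls \<rho> then layer L M R \<rho> else 0) /
        real (card (Aut C (rep R)))) =
      (case e of (F, \<phi>) \<Rightarrow> if qSoc (rep F) (cls (\<sigma> \<bullet> \<phi>)) (qtop (rep F)) = cls \<phi> then v_val C M L F else 0)"
      using e' by simp
  qed
next
  case (Suc n)
  note Lf = level_formation[OF L]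
  have SL: "S \<in> L" and s: "\<sigma> \<in> Epi C (rep S) (rep T)" using Suc.prems by (auto simp: epi_pairs_mem)
  \<comment> \<open>Here x records the socle of F over S, and the second condition says that x has
    socle S over T.\<close>
  define f where "f F \<psi> x = (if qSoc (rep F) (cls \<psi>) (qtop (rep F)) = x \<and> qSoc (rep F) (cls (\<sigma> \<bullet> \<psi>)) x = cls \<psi>
    then v_val C M L F else 0)" for F \<psi> x
  have pf: "0 \<le> f F \<psi> x" if "F \<in> L" for F \<psi> x using pos that by (simp add: f_def)
  have fe: "f F (\<rho> \<bullet> \<phi>) (cls \<phi>) = (if qSoc (rep R) (cls (\<sigma> \<bullet> \<rho>)) (qtop (rep R)) = cls \<rho> then
      (if qSoc (rep F) (cls (\<rho> \<bullet> \<phi>)) (qtop (rep F)) = cls \<phi> then v_val C M L F else 0) else 0)"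
    if "(R, \<rho>) \<in> epi_pairs L S" "(F, \<phi>) \<in> epi_pairs L R" for R \<rho> F \<phi>
    using Soc_pull[of \<phi> "rep F" "rep R" \<rho> "rep S" \<sigma> "rep T"] that s by (auto simp: f_def epi_pairs_mem)
  have inner: "((\<lambda>(F, \<phi>). f F (\<rho> \<bullet> \<phi>) (cls \<phi>)) has_sum
      (if qSoc (rep R) (cls (\<sigma> \<bullet> \<rho>)) (qtop (rep R)) = cls \<rho> then layer L M R \<rho> else 0)) (epi_pairs L R)"
    if R: "(R, \<rho>) \<in> epi_pairs L S" for R \<rho>
  proof (cases "qSoc (rep R) (cls (\<sigma> \<bullet> \<rho>)) (qtop (rep R)) = cls \<rho>")
    case False
    then show ?thesis using fe[OF R] by (auto intro!: has_sum_0)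
  next
    case True
    have r: "\<rho> \<in> Epi C (rep R) (rep S)" and RL: "R \<in> L" using R by (auto simp: epi_pairs_mem)
    have "((\<lambda>(F, \<phi>). if qSoc (rep F) (cls (\<rho> \<bullet> \<phi>)) (qtop (rep F)) = cls \<phi> then v_val C M L F else 0)
      has_sum layer L M R \<rho>) (epi_pairs L R)"
    proof (rule Suc.IH[OF SL R])
      fix F \<phi> assume F: "(F, \<phi>) \<in> epi_pairs L R" and e: "qSoc (rep F) (cls (\<rho> \<bullet> \<phi>)) (qtop (rep F)) = cls \<phi>"
      note m = epi_pairs_Ob[OF Lf RL F]
      interpret Q: finite_modular_lattice "car (rep F)" "qle (rep F)" "qjn (rep F)" "qmt (rep F)" "qbot (rep F)" "qtop (rep F)"
        by (rule quot_fml[OF m(1)])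
      have rf: "\<rho> \<bullet> \<phi> \<in> Epi C (rep F) (rep S)" using Epi_comp[OF m(2) r] .
      have c: "cls (\<rho> \<bullet> \<phi>) \<in> car (rep F)" "cls (\<sigma> \<bullet> (\<rho> \<bullet> \<phi>)) \<in> car (rep F)"
        using cls_car[OF rf] cls_car[OF Epi_comp[OF rf s]] by auto
      have "Q.Soc (cls (\<sigma> \<bullet> (\<rho> \<bullet> \<phi>))) (cls \<phi>) = cls (\<rho> \<bullet> \<phi>)" using Soc_pull[OF m(2) r s] True by simp
      \<comment> \<open>The socle of F over T agrees with that of R, the next layer, so the Loewy
        bound of the hypothesis reaches F over S; passing to R lowers it by one.\<close>
      then have "Q.Soc (cls (\<sigma> \<bullet> (\<rho> \<bullet> \<phi>))) (qtop (rep F)) = cls (\<rho> \<bullet> \<phi>)"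
        using Q.Soc_Soc[OF c(2,1) Q.tp_closed cls_comp_le[OF rf s]] c e by simp
      then have "Q.loewy (Suc n) (cls (\<rho> \<bullet> \<phi>)) (qtop (rep F))"
        using Suc.prems(3)[of F "\<rho> \<bullet> \<phi>"] epi_pairs_comp[OF R F] by blast
      from Q.loewy_Soc[OF c(1) Q.tp_closed this] show "qloewy (rep F) n (cls \<phi>) (qtop (rep F))" using e by simp
    qed
    moreover have "((\<lambda>(F, \<phi>). f F (\<rho> \<bullet> \<phi>) (cls \<phi>)) has_sum layer L M R \<rho>) (epi_pairs L R) \<longleftrightarrow>
      ((\<lambda>(F, \<phi>). if qSoc (rep F) (cls (\<rho> \<bullet> \<phi>)) (qtop (rep F)) = cls \<phi> then v_val C M L F else 0)
      has_sum layer L M R \<rho>) (epi_pairs L R)"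
      by (rule has_sum_cong) (use fe[OF R] True in auto)
    ultimately show ?thesis using True by simp
  qed
  have 1: "((\<lambda>(F, \<psi>). \<Sum>x \<in> up (rep F) (cls \<psi>). f F \<psi> x) has_sum layer L M S \<sigma>) (epi_pairs L S)"
    by (rule fubini_backward[OF Lf SL _ inner layer_layers[OF wb L Suc.prems(1,2)]]) (auto simp: epi_pairs_mem pf)
  have 2: "(\<Sum>x \<in> up (rep F) (cls \<psi>). f F \<psi> x) =
      (if qSoc (rep F) (cls (\<sigma> \<bullet> \<psi>)) (qtop (rep F)) = cls \<psi> then v_val C M L F else 0)"
    if F: "(F, \<psi>) \<in> epi_pairs L S" for F \<psi>
  proof -
    note m = epi_pairs_Ob[OF Lf SL F]
    interpret Q: finite_modular_lattice "car (rep F)" "qle (rep F)" "qjn (rep F)" "qmt (rep F)" "qbot (rep F)" "qtop (rep F)"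
      by (rule quot_fml[OF m(1)])
    have c: "cls (\<sigma> \<bullet> \<psi>) \<in> car (rep F)" using cls_car[OF Epi_comp[OF m(2) s]] .
    let ?x = "Q.Soc (cls \<psi>) (qtop (rep F))"
    have x: "?x \<in> up (rep F) (cls \<psi>)" using m(3) by (simp add: up_def)
    have "(\<Sum>x \<in> up (rep F) (cls \<psi>). f F \<psi> x) = (\<Sum>x \<in> up (rep F) (cls \<psi>). if x = ?x then f F \<psi> ?x else 0)"
      by (rule sum.cong) (auto simp: f_def)
    also have "\<dots> = f F \<psi> ?x" using x finite_up[OF m(1)] by simp
    also have "\<dots> = (if Q.Soc (cls (\<sigma> \<bullet> \<psi>)) (qtop (rep F)) = cls \<psi> then v_val C M L F else 0)"
      using Q.Soc_Soc[OF c m(3) Q.tp_closed cls_comp_le[OF m(2) s]] m(3) by (simp add: f_def)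
    finally show ?thesis .
  qed
  show ?case
    by (rule has_sum_cong[THEN iffD1, OF _ 1]) (use 2 in auto)
qed

theorem moments_exist:
  assumes wb: "well_behaved C M" and L: "L \<in> levels C" and T: "T \<in> L"
    and pos: "\<And>F. F \<in> L \<Longrightarrow> 0 \<le> v_val C M L F"
  shows "((\<lambda>F. real (card (Epi C (rep F) (rep T))) * v_val C M L F) has_sum M T) L"
proof -
  note Lf = level_formation[OF L]
  have TO: "rep T \<in> Ob C" using formation_rep[OF Lf T] by simp
  obtain r where r: "L \<subseteq> loewy_classes r" using level_loewy[OF L] by blast
  have bd: "qloewy (rep F) r (cls \<phi>) (qtop (rep F))" if F: "(F, \<phi>) \<in> epi_pairs L S" and SL: "S \<in> L" for F \<phi> S
  proof -
    note m = epi_pairs_Ob[OF Lf SL F]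
    interpret Q: finite_modular_lattice "car (rep F)" "qle (rep F)" "qjn (rep F)" "qmt (rep F)" "qbot (rep F)" "qtop (rep F)"
      by (rule quot_fml[OF m(1)])
    have "Q.loewy r (qbot (rep F)) (qtop (rep F))"
      using r m(4) rep_mem level_sub[OF L] by (auto simp: loewy_classes_def)
    then show ?thesis using Q.loewy_upper[of "qbot (rep F)" "qtop (rep F)" "cls \<phi>" r] m(3) by simp
  qed
  define f where "f F \<psi> x = (if qSoc (rep F) (cls \<psi>) (qtop (rep F)) = x then v_val C M L F else 0)" for F \<psi> x
  have inner: "((\<lambda>(F, \<phi>). f F (\<sigma> \<bullet> \<phi>) (cls \<phi>)) has_sum layer L M S \<sigma>) (epi_pairs L S)" if S: "(S, \<sigma>) \<in> epi_pairs L T" for S \<sigma>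
    unfolding f_def using S
    by (intro layer_has_sum[OF wb L T S pos, where n = r] bd) (auto simp: epi_pairs_mem)
  have pf: "0 \<le> f F \<psi> x" if "F \<in> L" for F \<psi> x using pos that by (simp add: f_def)
  have 1: "((\<lambda>(F, \<psi>). \<Sum>x \<in> up (rep F) (cls \<psi>). f F \<psi> x) has_sum M T) (epi_pairs L T)"
    by (rule fubini_backward[OF Lf T _ inner moment_layers[OF wb L T]]) (auto simp: epi_pairs_mem pf)
  have 2: "(\<Sum>x \<in> up (rep F) (cls \<psi>). f F \<psi> x) = v_val C M L F" if F: "(F, \<psi>) \<in> epi_pairs L T" for F \<psi>
  proof -
    note m = epi_pairs_Ob[OF Lf T F]
    interpret Q: finite_modular_lattice "car (rep F)" "qle (rep F)" "qjn (rep F)" "qmt (rep F)" "qbot (rep F)" "qtop (rep F)"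
      by (rule quot_fml[OF m(1)])
    have "Q.Soc (cls \<psi>) (qtop (rep F)) \<in> up (rep F) (cls \<psi>)" using m(3) by (simp add: up_def)
    then show ?thesis using finite_up[OF m(1)] by (simp add: f_def)
  qed
  have "((\<lambda>(F, \<psi>). v_val C M L F) has_sum M T) (epi_pairs L T)"
    by (rule has_sum_cong[THEN iffD1, OF _ 1]) (use 2 in auto)
  then show ?thesis
    unfolding epi_pairs_def
    by (rule has_sum_SigmaD) (use finite_Epi formation_rep[OF Lf] TO in \<open>auto intro!: has_sum_finiteI\<close>)
qed

end

section \<open>Measures on the set of pro-isomorphism classes\<close>

lemma has_bochner_integral_count_space:
  fixes f :: "'a \<Rightarrow> real"
  shows "has_bochner_integral (count_space A) f s \<longleftrightarrow> (f has_sum s) A"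
proof -
  have 1: "integrable (count_space A) f \<longleftrightarrow> f summable_on A"
    using abs_summable_equivalent[of f A] summable_on_iff_abs_summable_on_real[of f A]
    by (simp add: Infinite_Set_Sum.abs_summable_on_def)
  have 2: "integral\<^sup>L (count_space A) f = infsum f A" if "integrable (count_space A) f"
    using infsetsum_infsum[of f A] that by (simp add: Infinite_Set_Sum.abs_summable_on_def infsetsum_def)
  show ?thesis
    using 1 2 has_bochner_integral_iff[of "count_space A" f s] has_sum_iff[of f A s] by auto
qed

text \<open>The image measure on a countable set has the density p with respect to counting measure,
  so the integral is a sum over point masses.\<close>

lemma has_bochner_integral_countable_map:
  fixes g :: "'b \<Rightarrow> real"
  assumes A: "countable A" and h: "h \<in> measurable M (count_space A)"
    and p: "\<And>a. a \<in> A \<Longrightarrow> emeasure M (h -` {a} \<inter> space M) = ennreal (p a)" "\<And>a. a \<in> A \<Longrightarrow> 0 \<le> p a"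
  shows "has_bochner_integral M (\<lambda>x. g (h x)) s \<longleftrightarrow> ((\<lambda>a. g a * p a) has_sum s) A"
proof -
  have D: "distr M (count_space A) h = density (count_space A) (\<lambda>a. ennreal (p a))"
  proof (rule measure_eqI_countable)
    fix a assume a: "a \<in> A"
    have "emeasure (density (count_space A) (\<lambda>a. ennreal (p a))) {a} = (\<integral>\<^sup>+x. ennreal (p a) * indicator {a} x \<partial>count_space A)"
      using a by (subst emeasure_density) (auto intro!: nn_integral_cong simp: indicator_def)
    also have "\<dots> = ennreal (p a)" using a by (subst nn_integral_cmult_indicator) auto
    finally show "emeasure (distr M (count_space A) h) {a} = emeasure (density (count_space A) (\<lambda>a. ennreal (p a))) {a}"
      using a p(1)[OF a] by (simp add: emeasure_distr[OF h])
  qed (use A in auto)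
  have ae: "AE a in count_space A. 0 \<le> p a" using p(2) by (simp add: AE_count_space)
  have "has_bochner_integral M (\<lambda>x. g (h x)) s \<longleftrightarrow> has_bochner_integral (distr M (count_space A) h) g s"
    unfolding has_bochner_integral_iff using integrable_distr_eq[OF h, of g] integral_distr[OF h, of g] by simp
  also have "\<dots> \<longleftrightarrow> has_bochner_integral (count_space A) (\<lambda>a. p a *\<^sub>R g a) s"
    unfolding D has_bochner_integral_iff using ae
    by (subst integrable_density, simp_all, subst integral_density, simp_all)
  also have "\<dots> \<longleftrightarrow> ((\<lambda>a. g a * p a) has_sum s) A"
    unfolding has_bochner_integral_count_space by (simp add: mult.commute)
  finally show ?thesis .
qed

lemma has_sum_group:
  fixes f :: "'a \<Rightarrow> real"
  assumes f: "(f has_sum s) X" and h: "\<And>x. x \<in> X \<Longrightarrow> h x \<in> I"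
  shows "((\<lambda>i. infsum f {x \<in> X. h x = i}) has_sum s) I"
proof -
  have bij: "bij_betw snd (Sigma I (\<lambda>i. {x \<in> X. h x = i})) X"
    by (rule bij_betwI[where g = "\<lambda>x. (h x, x)"]) (use h in auto)
  have "((\<lambda>e. f (snd e)) has_sum s) (Sigma I (\<lambda>i. {x \<in> X. h x = i}))"
    using has_sum_reindex_bij_betw[OF bij, of f s] f by simp
  then show ?thesis
  proof (rule has_sum_SigmaD)
    fix i assume "i \<in> I"
    have "f summable_on {x \<in> X. h x = i}"
      by (rule summable_on_subset_banach[OF has_sum_imp_summable[OF f]]) auto
    then show "((\<lambda>y. f (snd (i, y))) has_sum infsum f {x \<in> X. h x = i}) {x \<in> X. h x = i}" by simp
  qed
qed

text \<open>If a decreasing mass with a positive lower bound is split into countably or uncountably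
  many pieces, some piece keeps positive mass forever: finitely many pieces carry all but a
  uniformly small part, and they cannot all tend to 0.\<close>

lemma persistent_piece:
  fixes a :: "nat \<Rightarrow> 'i \<Rightarrow> real"
  assumes nn: "\<And>m i. i \<in> I \<Longrightarrow> 0 \<le> a m i" and dec: "\<And>m i. i \<in> I \<Longrightarrow> a (Suc m) i \<le> a m i"
    and s: "\<And>m. (a m has_sum b m) I" and d: "d > 0" "\<And>m. d \<le> b m"
  shows "\<exists>i \<in> I. \<exists>e > 0. \<forall>m. e \<le> a m i"
proof (rule ccontr)
  assume neg: "\<not> ?thesis"
  have dec': "a n i \<le> a m i" if "i \<in> I" "m \<le> n" for m n i
    using lift_Suc_antimono_le[of "\<lambda>m. a m i", OF dec[OF that(1)] that(2)] .
  obtain F where F: "finite F" "F \<subseteq> I" "b 0 - d / 2 < sum (a 0) F"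
  proof -
    have "\<forall>\<^sub>F F in finite_subsets_at_top I. dist (sum (a 0) F) (b 0) < d / 2"
      using tendstoD[OF s[of 0, unfolded has_sum_def], of "d / 2"] d by simp
    then obtain F where "finite F" "F \<subseteq> I" "dist (sum (a 0) F) (b 0) < d / 2"
      unfolding eventually_finite_subsets_at_top by blast
    then show ?thesis using that by (auto simp: dist_real_def abs_if split: if_splits)
  qed
  \<comment> \<open>All pieces decrease, so the mass outside F is never larger than it was at the
    start.\<close>
  have tail: "b m - sum (a m) F < d / 2" for m
  proof -
    have "((\<lambda>i. a 0 i - a m i) has_sum (b 0 - b m)) I" 
      using has_sum_add[OF s[of 0] has_sum_cmult_right[OF s[of m], of "-1"]] by simp
    then have "sum (\<lambda>i. a 0 i - a m i) F \<le> b 0 - b m"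
      by (rule finite_sum_le_has_sum[OF _ F(1,2)]) (use dec' in auto)
    then show ?thesis using F(3) by (simp add: sum_subtractf)
  qed
  \<comment> \<open>Small enough that \<open>card F\<close> pieces of this size stay below d / 2;
    the 1 covers the case of empty F.\<close>
  define \<delta> where "\<delta> = d / (2 * (real (card F) + 1))"
  have \<delta>: "\<delta> > 0" using d by (simp add: \<delta>_def)
  have "\<forall>i \<in> F. \<exists>m. a m i < \<delta>" using neg F(2) \<delta> by (meson not_less subsetD)
  then obtain m where m: "\<And>i. i \<in> F \<Longrightarrow> a (m i) i < \<delta>" by metis
  let ?N = "Max (insert 0 (m ` F))"
  have "a ?N i \<le> \<delta>" if i: "i \<in> F" for i
    using dec'[of i "m i" ?N] m[OF i] F i by (auto intro: Max_ge)
  then have "sum (a ?N) F \<le> real (card F) * \<delta>" by (rule sum_bounded_above)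
  also have "\<dots> < d / 2" using d by (simp add: \<delta>_def field_simps)
  finally show False using tail[of ?N] d(2)[of ?N] by simp
qed

context diamond_category
begin

section \<open>Cylinder sets and uniqueness of the measure\<close>

definition cyl :: "'o set set \<Rightarrow> 'o set set \<Rightarrow> ('o set set \<Rightarrow> 'o set) set" where
  "cyl L S = {X \<in> pro_classes C. X L \<in> S}"

lemma basic_open_cyl: "basic_open C L F = cyl L {F}"
  by (auto simp: basic_open_def cyl_def)

lemma cyl_image:
  assumes "L \<in> levels C" "S \<subseteq> L"
  shows "(\<lambda>X. X L) ` cyl L S = S"
proof (intro equalityI subsetI)
  fix F assume F: "F \<in> S"
  then obtain X where "X \<in> pro_classes C" "X L = F" using pro_class_ex1[OF assms(1)] assms(2) by blast
  then show "F \<in> (\<lambda>X. X L) ` cyl L S" using F by (auto simp: cyl_def)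
qed (auto simp: cyl_def)

text \<open>Every object of a level is the value of some pro-isomorphism class, so a cylinder
  determines its base.\<close>

lemma cyl_subset_iff:
  assumes "L \<in> levels C" "S \<subseteq> L" "R \<subseteq> L"
  shows "cyl L S \<subseteq> cyl L R \<longleftrightarrow> S \<subseteq> R"
  using image_mono[of "cyl L S" "cyl L R" "\<lambda>X. X L"] cyl_image[OF assms(1,2)] cyl_image[OF assms(1,3)]
  by (auto simp: cyl_def)

lemma cyl_eq_iff:
  assumes "L \<in> levels C" "S \<subseteq> L" "R \<subseteq> L"
  shows "cyl L S = cyl L R \<longleftrightarrow> S = R"
  using cyl_subset_iff assms by blast

definition lift :: "'o set set \<Rightarrow> 'o set set \<Rightarrow> 'o set set \<Rightarrow> 'o set set" where
  "lift L L' S = {F \<in> L'. level_quot C L F \<in> S}"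

lemma cyl_lift:
  assumes "L \<in> levels C" "L' \<in> levels C" "L \<subseteq> L'"
  shows "cyl L S = cyl L' (lift L L' S)"
  using pro_class_level_quot[OF _ assms] pro_class_mem[OF _ assms(2)] by (auto simp: cyl_def lift_def)

lemma basic_sub: "{basic_open C L F | L F. L \<in> levels C \<and> F \<in> L} \<subseteq> Pow (pro_classes C)"
  by (auto simp: basic_open_def)

lemma sets_pro_algebra: "sets (pro_algebra C) = sigma_sets (pro_classes C) {basic_open C L F | L F. L \<in> levels C \<and> F \<in> L}"
  unfolding pro_algebra_def by (rule sets_measure_of[OF basic_sub])

lemma space_pro_algebra: "space (pro_algebra C) = pro_classes C"
  unfolding pro_algebra_def by (rule space_measure_of[OF basic_sub])

lemma cyl_sigma:
  assumes L: "L \<in> levels C" and S: "S \<subseteq> L"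
  shows "cyl L S \<in> sigma_sets (pro_classes C) {basic_open C L F | L F. L \<in> levels C \<and> F \<in> L}"
proof -
  interpret sigma_algebra "pro_classes C" "sigma_sets (pro_classes C) {basic_open C L F | L F. L \<in> levels C \<and> F \<in> L}"
    by (rule sigma_algebra_sigma_sets[OF basic_sub])
  have "cyl L S = (\<Union>F \<in> S. basic_open C L F)" by (auto simp: cyl_def basic_open_def)
  moreover have "countable S" using level_countable[OF L] S countable_subset by blast
  moreover have "basic_open C L F \<in> sigma_sets (pro_classes C) {basic_open C L F | L F. L \<in> levels C \<and> F \<in> L}" if "F \<in> S" for F
    using L S that by (intro sigma_sets.Basic) blast
  ultimately show ?thesis using countable_UN'[of S] by auto
qed

lemma level_measurable:
  assumes nu: "sets \<nu> = sets (pro_algebra C)" and L: "L \<in> levels C"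
  shows "(\<lambda>X. X L) \<in> measurable \<nu> (count_space L)" "space \<nu> = pro_classes C"
    "(\<lambda>X. X L) -` {F} \<inter> space \<nu> = basic_open C L F"
proof -
  show sp: "space \<nu> = pro_classes C" using sets_eq_imp_space_eq[OF nu] space_pro_algebra by simp
  have v: "(\<lambda>X. X L) -` {F} \<inter> space \<nu> = basic_open C L F" for F using sp by (auto simp: basic_open_def)
  then show "(\<lambda>X. X L) -` {F} \<inter> space \<nu> = basic_open C L F" .
  show "(\<lambda>X. X L) \<in> measurable \<nu> (count_space L)"
    unfolding measurable_count_space_eq_countable[OF level_countable[OF L]] v nu sets_pro_algebra
    using sp pro_class_mem[OF _ L] L by (auto intro!: sigma_sets.Basic)
qed

lemma has_moment_iff:
  assumes nu: "sets \<nu> = sets (pro_algebra C)" and L: "L \<in> levels C" and G: "G \<in> L"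
    and p: "\<And>F. F \<in> L \<Longrightarrow> emeasure \<nu> (basic_open C L F) = ennreal (p F)" "\<And>F. F \<in> L \<Longrightarrow> 0 \<le> p F"
  shows "has_moment C \<nu> G m \<longleftrightarrow> ((\<lambda>F. real (card (Epi C (rep F) (rep G))) * p F) has_sum m) L"
proof -
  note lm = level_measurable[OF nu L]
  have "has_moment C \<nu> G m \<longleftrightarrow> has_bochner_integral \<nu> (\<lambda>X. real (card (Epi C (rep (X L)) (rep G)))) m"
    unfolding has_moment_def
    by (rule has_bochner_integral_cong) (use lm(2) epi_count_level[OF _ L G] in auto)
  also have "\<dots> \<longleftrightarrow> ((\<lambda>F. real (card (Epi C (rep F) (rep G))) * p F) has_sum m) L"
    by (rule has_bochner_integral_countable_map[OF level_countable[OF L] lm(1), where g = "\<lambda>F. real (card (Epi C (rep F) (rep G)))"])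
      (use lm(3) p in auto)
  finally show ?thesis .
qed

lemma card_Epi_self: "F \<in> iso_classes C \<Longrightarrow> card (Epi C (rep F) (rep F)) \<ge> 1"
proof -
  assume "F \<in> iso_classes C"
  then have O: "rep F \<in> Ob C" using rep_Ob by blast
  then show ?thesis using ident_Epi[OF O] finite_Epi[OF O O] by (metis One_nat_def Suc_leI card_gt_0_iff empty_iff)
qed

text \<open>On this set the F-moment integrates a function that is at least 1, because the identity
  of F is an epimorphism, and the moment is finite.\<close>

lemma finite_basic:
  assumes mom: "has_moments C M \<nu>" and L: "L \<in> levels C" and F: "F \<in> L"
  shows "emeasure \<nu> (basic_open C L F) < \<infinity>"
proof -
  have nu: "sets \<nu> = sets (pro_algebra C)" using mom by (simp add: has_moments_def)
  note lm = level_measurable[OF nu L]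
  have Fi: "F \<in> iso_classes C" using F level_sub[OF L] by blast
  have b: "basic_open C L F \<in> sets \<nu>" unfolding nu sets_pro_algebra using L F by (intro sigma_sets.Basic) blast
  have "has_bochner_integral \<nu> (\<lambda>X. real (epi_count C X F)) (M F)"
    using mom Fi by (simp add: has_moments_def has_moment_def)
  then have fin: "(\<integral>\<^sup>+X. ennreal (real (epi_count C X F)) \<partial>\<nu>) < \<infinity>"
    by (simp add: has_bochner_integral_iff integrable_iff_bounded)
  have "emeasure \<nu> (basic_open C L F) = (\<integral>\<^sup>+X. indicator (basic_open C L F) X \<partial>\<nu>)" using b by simp
  also have "\<dots> \<le> (\<integral>\<^sup>+X. ennreal (real (epi_count C X F)) \<partial>\<nu>)"
  proof (rule nn_integral_mono)
    fix X
    show "indicator (basic_open C L F) X \<le> ennreal (real (epi_count C X F))"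
      using epi_count_level[OF _ L F, of X] card_Epi_self[OF Fi]
      by (auto simp: indicator_def basic_open_def)
  qed
  finally show ?thesis using fin by (rule le_less_trans)
qed

lemma measure_basic:
  assumes wb: "well_behaved C M" and mom: "has_moments C M \<nu>" and L: "L \<in> levels C" and F: "F \<in> L"
  shows "0 \<le> v_val C M L F" "emeasure \<nu> (basic_open C L F) = ennreal (v_val C M L F)"
proof -
  have nu: "sets \<nu> = sets (pro_algebra C)" using mom by (simp add: has_moments_def)
  define p where "p F = measure \<nu> (basic_open C L F)" for F
  have p: "emeasure \<nu> (basic_open C L F) = ennreal (p F)" if "F \<in> L" for F
    using finite_basic[OF mom L that] unfolding p_def by (intro emeasure_eq_ennreal_measure) auto
  have "((\<lambda>H. real (card (Epi C (rep H) (rep G))) * p H) has_sum M G) L" if G: "G \<in> L" for G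
  proof -
    have "has_moment C \<nu> G (M G)" using mom G level_sub[OF L] by (auto simp: has_moments_def)
    then show ?thesis using has_moment_iff[OF nu L G, where p = p] p by (simp add: p_def)
  qed
  then have "v_val C M L F = p F" by (intro moments_unique[OF wb L _ _ F]) (auto simp: p_def)
  then show "0 \<le> v_val C M L F" "emeasure \<nu> (basic_open C L F) = ennreal (v_val C M L F)"
    using p[OF F] by (auto simp: p_def)
qed

theorem measure_unique:
  assumes wb: "well_behaved C M" and mom: "has_moments C M \<nu>" "has_moments C M \<nu>'"
  shows "\<nu>' = \<nu>"
proof -
  let ?E = "{cyl L S | L S. L \<in> levels C \<and> S \<subseteq> L}"
  let ?B = "{basic_open C L F | L F. L \<in> levels C \<and> F \<in> L}"
  have E: "sigma_sets (pro_classes C) ?E = sigma_sets (pro_classes C) ?B"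
  proof (rule sigma_sets_eqI)
    show "a \<in> sigma_sets (pro_classes C) ?B" if "a \<in> ?E" for a using that cyl_sigma by blast
    show "b \<in> sigma_sets (pro_classes C) ?E" if "b \<in> ?B" for b
      using that basic_open_cyl by (intro sigma_sets.Basic) blast
  qed
  have eq: "emeasure \<nu>' (cyl L S) = emeasure \<nu> (cyl L S)" if L: "L \<in> levels C" and S: "S \<subseteq> L" for L S
  proof -
    have cS: "countable S" using level_countable[OF L] S countable_subset by blast
    have U: "cyl L S = (\<Union>F \<in> S. basic_open C L F)" by (auto simp: cyl_def basic_open_def)
    have dj: "disjoint_family_on (basic_open C L) S" by (auto simp: disjoint_family_on_def basic_open_def)
    have em: "emeasure \<mu> (cyl L S) = (\<integral>\<^sup>+F. ennreal (v_val C M L F) \<partial>count_space S)" if m: "has_moments C M \<mu>" for \<mu>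
    proof -
      have nu: "sets \<mu> = sets (pro_algebra C)" using m by (simp add: has_moments_def)
      have "basic_open C L F \<in> sets \<mu>" if "F \<in> S" for F
        unfolding nu sets_pro_algebra using L S that by (intro sigma_sets.Basic) blast
      then have "emeasure \<mu> (cyl L S) = (\<integral>\<^sup>+F. emeasure \<mu> (basic_open C L F) \<partial>count_space S)"
        unfolding U by (intro emeasure_UN_countable cS dj)
      also have "\<dots> = (\<integral>\<^sup>+F. ennreal (v_val C M L F) \<partial>count_space S)"
        using measure_basic[OF wb m L] S by (intro nn_integral_cong) auto
      finally show ?thesis .
    qed
    show ?thesis using em[OF mom(1)] em[OF mom(2)] by simp
  qed
  obtain L where L: "L \<in> levels C" using level_ex by blast
  define A where "A n = (if n \<in> to_nat_on L ` L then basic_open C L (from_nat_into L n) else cyl L {})" for n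
  have mem: "from_nat_into L n \<in> L" if "n \<in> to_nat_on L ` L" for n
    using that level_countable[OF L] by auto
  show ?thesis
  proof (rule measure_eqI_generator_eq[where E = ?E and \<Omega> = "pro_classes C" and A = A])
    show "Int_stable ?E"
    proof (rule Int_stableI)
      fix a b assume "a \<in> ?E" "b \<in> ?E"
      then obtain L S K R where a: "L \<in> levels C" "S \<subseteq> L" "a = cyl L S" and b: "K \<in> levels C" "R \<subseteq> K" "b = cyl K R" by auto
      obtain J where J: "J \<in> levels C" "L \<subseteq> J" "K \<subseteq> J" using levels_directed a b by metis
      have "a \<inter> b = cyl J (lift L J S \<inter> lift K J R)"
        using cyl_lift[OF a(1) J(1,2), of S] cyl_lift[OF b(1) J(1,3), of R] a b by (auto simp: cyl_def)
      then show "a \<inter> b \<in> ?E" using J by (auto simp: lift_def)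
    qed
    show "?E \<subseteq> Pow (pro_classes C)" by (auto simp: cyl_def)
    show "emeasure \<nu>' X = emeasure \<nu> X" if "X \<in> ?E" for X using that eq by auto
    show "sets \<nu>' = sigma_sets (pro_classes C) ?E" "sets \<nu> = sigma_sets (pro_classes C) ?E"
      using mom E sets_pro_algebra by (auto simp: has_moments_def)
    show "range A \<subseteq> ?E"
      unfolding A_def basic_open_cyl using L mem by auto
    show "(\<Union>i. A i) = pro_classes C"
    proof (intro equalityI subsetI)
      fix X assume X: "X \<in> pro_classes C"
      have "X L \<in> L" using pro_class_mem[OF X L] .
      then have "X \<in> A (to_nat_on L (X L))" using X level_countable[OF L] by (auto simp: A_def basic_open_def)
      then show "X \<in> (\<Union>i. A i)" by blast
    qed (auto simp: A_def basic_open_def cyl_def split: if_splits)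
    show "emeasure \<nu>' (A i) \<noteq> \<infinity>" for i
    proof (cases "i \<in> to_nat_on L ` L")
      case True
      then show ?thesis using finite_basic[OF mom(2) L mem[OF True]] by (simp add: A_def)
    qed (simp add: A_def cyl_def)
  qed
qed

end

subsection \<open>Construction of the measure\<close>

context diamond_category
begin

context
  fixes M :: "'o set \<Rightarrow> real"
  assumes wb: "well_behaved C M" and nonneg: "\<And>L F. L \<in> levels C \<Longrightarrow> F \<in> L \<Longrightarrow> 0 \<le> v_val C M L F"
begin

text \<open>The push-forward of the values at L' is nonnegative and has the same moments on L, since
  passing to the maximal quotient in L preserves the relevant numbers of epimorphisms. By
  \<open>moments_unique\<close> it equals the values at L.\<close>

lemma v_fibre:
  assumes L: "L \<in> levels C" "L' \<in> levels C" "L \<subseteq> L'" and F: "F \<in> L"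
  shows "(v_val C M L' has_sum v_val C M L F) {F' \<in> L'. level_quot C L F' = F}"
proof -
  note Lf = level_formation[OF L(1)] and Lf' = level_formation[OF L(2)]
  have i': "F' \<in> iso_classes C" if "F' \<in> L'" for F' using that level_sub[OF L(2)] by blast
  define p where "p F = infsum (v_val C M L') {F' \<in> L'. level_quot C L F' = F}" for F
  have mom: "((\<lambda>F'. real (card (Epi C (rep F') (rep G))) * v_val C M L' F') has_sum M G) L'" if G: "G \<in> L" for G
    using moments_exist[OF wb L(2) _ nonneg[OF L(2)]] G L(3) by blast
  have card: "card (Epi C (rep (level_quot C L F')) (rep G)) = card (Epi C (rep F') (rep G))" if "F' \<in> L'" "G \<in> L" for F' G
    using card_Epi_level_quot[OF Lf i'[OF that(1)] that(2)] .
  have sm: "v_val C M L' summable_on {F' \<in> L'. level_quot C L F' = F}" if F: "F \<in> L" for F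
  proof (rule summable_on_comparison_test)
    show "(\<lambda>F'. real (card (Epi C (rep F') (rep F))) * v_val C M L' F') summable_on {F' \<in> L'. level_quot C L F' = F}"
      by (rule summable_on_subset_banach[OF has_sum_imp_summable[OF mom[OF F]]]) auto
    fix F' assume F': "F' \<in> {F' \<in> L'. level_quot C L F' = F}"
    have "F \<in> iso_classes C" using F level_sub[OF L(1)] by blast
    then have "real (card (Epi C (rep F') (rep F))) \<ge> 1" using card[of F' F] F F' card_Epi_self[of F] by simp
    then show "v_val C M L' F' \<le> real (card (Epi C (rep F') (rep F))) * v_val C M L' F'"
      using mult_right_mono[of 1 _ "v_val C M L' F'"] nonneg[OF L(2)] F' by simp
  qed (use nonneg[OF L(2)] in auto)
  have "((\<lambda>F. real (card (Epi C (rep F) (rep G))) * p F) has_sum M G) L" if G: "G \<in> L" for G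
  proof -
    have "((\<lambda>F. infsum (\<lambda>F'. real (card (Epi C (rep F') (rep G))) * v_val C M L' F') {F' \<in> L'. level_quot C L F' = F}) has_sum M G) L"
      by (rule has_sum_group[OF mom[OF G]]) (use level_quot_mem[OF Lf i'] in auto)
    moreover have "infsum (\<lambda>F'. real (card (Epi C (rep F') (rep G))) * v_val C M L' F') {F' \<in> L'. level_quot C L F' = F} =
        real (card (Epi C (rep F) (rep G))) * p F" if F: "F \<in> L" for F
    proof -
      have "infsum (\<lambda>F'. real (card (Epi C (rep F') (rep G))) * v_val C M L' F') {F' \<in> L'. level_quot C L F' = F} =
          infsum (\<lambda>F'. real (card (Epi C (rep F) (rep G))) * v_val C M L' F') {F' \<in> L'. level_quot C L F' = F}"
        by (rule infsum_cong) (use card[OF _ G] in auto)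
      then show ?thesis by (simp add: p_def infsum_cmult_right')
    qed
    ultimately show ?thesis by (metis (no_types, lifting) has_sum_cong)
  qed
  moreover have "0 \<le> p F" if "F \<in> L" for F
    unfolding p_def by (rule infsum_nonneg) (use nonneg[OF L(2)] in auto)
  ultimately have "v_val C M L F = p F" by (intro moments_unique[OF wb L(1) _ _ F])
  then show ?thesis unfolding p_def using has_sum_infsum[OF sm[OF F]] by simp
qed

lemma v_lift:
  assumes L: "L \<in> levels C" "L' \<in> levels C" "L \<subseteq> L'" and S: "S \<subseteq> L"
  shows "(v_val C M L' has_sum s) (lift L L' S) \<longleftrightarrow> (v_val C M L has_sum s) S"
proof -
  have bij: "bij_betw snd (Sigma S (\<lambda>F. {F' \<in> L'. level_quot C L F' = F})) (lift L L' S)"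
    by (rule bij_betwI[where g = "\<lambda>x. (level_quot C L x, x)"]) (auto simp: lift_def)
  have 1: "(v_val C M L' has_sum s) (lift L L' S) \<longleftrightarrow>
      ((\<lambda>e. v_val C M L' (snd e)) has_sum s) (Sigma S (\<lambda>F. {F' \<in> L'. level_quot C L F' = F}))"
    using has_sum_reindex_bij_betw[OF bij, of "v_val C M L'" s] by simp
  have inner: "((\<lambda>y. v_val C M L' (snd (F, y))) has_sum v_val C M L F) {F' \<in> L'. level_quot C L F' = F}" if "F \<in> S" for F
    using v_fibre[OF L] that S by auto
  show ?thesis unfolding 1
  proof
    assume "((\<lambda>e. v_val C M L' (snd e)) has_sum s) (Sigma S (\<lambda>F. {F' \<in> L'. level_quot C L F' = F}))"
    then show "(v_val C M L has_sum s) S" by (rule has_sum_SigmaD) (rule inner)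
  next
    assume s: "(v_val C M L has_sum s) S"
    show "((\<lambda>e. v_val C M L' (snd e)) has_sum s) (Sigma S (\<lambda>F. {F' \<in> L'. level_quot C L F' = F}))"
    proof (rule has_sum_SigmaI[OF inner s])
      show "(\<lambda>e. v_val C M L' (snd e)) summable_on (Sigma S (\<lambda>F. {F' \<in> L'. level_quot C L F' = F}))"
        by (rule summable_on_SigmaI[OF inner has_sum_imp_summable[OF s]]) (use nonneg[OF L(2)] in auto)
    qed
  qed
qed

lemma v_lift_summable:
  assumes "L \<in> levels C" "L' \<in> levels C" "L \<subseteq> L'" "S \<subseteq> L"
  shows "v_val C M L' summable_on lift L L' S \<longleftrightarrow> v_val C M L summable_on S"
  using v_lift[OF assms] by (simp add: summable_on_def)

lemma v_lift_infsum:
  assumes "L \<in> levels C" "L' \<in> levels C" "L \<subseteq> L'" "S \<subseteq> L" "v_val C M L summable_on S"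
  shows "infsum (v_val C M L') (lift L L' S) = infsum (v_val C M L) S"
  using v_lift[OF assms(1-4)] has_sum_infsum[OF assms(5)] infsumI by blast

lemma lift_sub: "lift L L' S \<subseteq> L'"
  by (auto simp: lift_def)

definition pro_ring :: "('o set set \<Rightarrow> 'o set) set set" where
  "pro_ring = {cyl L S | L S. L \<in> levels C \<and> S \<subseteq> L \<and> v_val C M L summable_on S}"

text \<open>A cylinder has many presentations; \<open>premeasure_cyl\<close> compares two of them at
  a common larger level.\<close>

definition premeasure :: "('o set set \<Rightarrow> 'o set) set \<Rightarrow> ennreal" where
  "premeasure A = (let (L, S) = (SOME (L, S). L \<in> levels C \<and> S \<subseteq> L \<and> v_val C M L summable_on S \<and> A = cyl L S)
    in ennreal (infsum (v_val C M L) S))"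

lemma premeasure_cyl:
  assumes L: "L \<in> levels C" and S: "S \<subseteq> L" "v_val C M L summable_on S"
  shows "premeasure (cyl L S) = ennreal (infsum (v_val C M L) S)"
proof -
  let ?P = "\<lambda>(K, R). K \<in> levels C \<and> R \<subseteq> K \<and> v_val C M K summable_on R \<and> cyl L S = cyl K R"
  obtain K R where KR: "(SOME p. ?P p) = (K, R)" by (rule prod.exhaust)
  have "?P (L, S)" using assms by simp
  then have "?P (SOME p. ?P p)" by (rule someI)
  then have K: "K \<in> levels C" "R \<subseteq> K" "v_val C M K summable_on R" "cyl L S = cyl K R" using KR by auto
  obtain J where J: "J \<in> levels C" "L \<subseteq> J" "K \<subseteq> J" using levels_directed[OF L K(1)] by blast
  have "cyl J (lift L J S) = cyl J (lift K J R)"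
    using cyl_lift[OF L J(1,2)] cyl_lift[OF K(1) J(1,3)] K(4) by simp
  then have e: "lift L J S = lift K J R" using cyl_eq_iff[OF J(1) lift_sub lift_sub] by blast
  have "infsum (v_val C M K) R = infsum (v_val C M L) S"
    using v_lift_infsum[OF L J(1,2) S] v_lift_infsum[OF K(1) J(1,3) K(2,3)] e by simp
  moreover have "premeasure (cyl L S) = ennreal (infsum (v_val C M K) R)"
    unfolding premeasure_def KR by simp
  ultimately show ?thesis by simp
qed

lemma cyl_single: "L \<in> levels C \<Longrightarrow> F \<in> L \<Longrightarrow> cyl L {F} \<in> pro_ring"
  unfolding pro_ring_def by (rule CollectI, rule exI[of _ L], rule exI[of _ "{F}"]) simp

lemma pro_ring_common:
  assumes "A \<in> pro_ring" "B \<in> pro_ring"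
  obtains L S R where "L \<in> levels C" "S \<subseteq> L" "R \<subseteq> L" "A = cyl L S" "B = cyl L R"
    "v_val C M L summable_on S" "v_val C M L summable_on R"
proof -
  obtain L S where A: "L \<in> levels C" "S \<subseteq> L" "v_val C M L summable_on S" "A = cyl L S" using assms(1) by (auto simp: pro_ring_def)
  obtain K R where B: "K \<in> levels C" "R \<subseteq> K" "v_val C M K summable_on R" "B = cyl K R" using assms(2) by (auto simp: pro_ring_def)
  obtain J where J: "J \<in> levels C" "L \<subseteq> J" "K \<subseteq> J" using levels_directed[OF A(1) B(1)] by blast
  show ?thesis
    using that[OF J(1) lift_sub lift_sub, of L S K R] cyl_lift[OF A(1) J(1,2)] cyl_lift[OF B(1) J(1,3)] A B
      v_lift_summable[OF A(1) J(1,2)] v_lift_summable[OF B(1) J(1,3)] by simp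
qed

lemma cyl_Un: "cyl L S \<union> cyl L R = cyl L (S \<union> R)" and cyl_Diff: "cyl L S - cyl L R = cyl L (S - R)"
  by (auto simp: cyl_def)

lemma pro_ring: "ring_of_sets (pro_classes C) pro_ring"
  unfolding ring_of_sets_iff
proof (intro conjI ballI)
  show "pro_ring \<subseteq> Pow (pro_classes C)" by (auto simp: pro_ring_def cyl_def)
  obtain L where "L \<in> levels C" using level_ex by blast
  then have "cyl L {} \<in> pro_ring" unfolding pro_ring_def using summable_on_empty by blast
  then show "{} \<in> pro_ring" by (simp add: cyl_def)
  fix A B assume "A \<in> pro_ring" "B \<in> pro_ring"
  then obtain L S R where *: "L \<in> levels C" "S \<subseteq> L" "R \<subseteq> L" "A = cyl L S" "B = cyl L R"
    "v_val C M L summable_on S" "v_val C M L summable_on R" by (rule pro_ring_common)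
  have "v_val C M L summable_on (S \<union> (R - S))"
    using * by (intro summable_on_Un_disjoint) (auto intro: summable_on_subset_banach)
  then have "v_val C M L summable_on (S \<union> R)" by simp
  then show "A \<union> B \<in> pro_ring" using * unfolding pro_ring_def by (auto simp: cyl_Un)
  have "v_val C M L summable_on (S - R)" using *(6) by (rule summable_on_subset_banach) auto
  then show "A - B \<in> pro_ring" using * unfolding pro_ring_def by (auto simp: cyl_Diff)
qed

lemma premeasure_additive: "additive pro_ring premeasure"
  unfolding additive_def
proof (intro ballI impI)
  fix A B assume AB: "A \<in> pro_ring" "B \<in> pro_ring" "A \<inter> B = {}"
  from AB(1,2) obtain L S R where *: "L \<in> levels C" "S \<subseteq> L" "R \<subseteq> L" "A = cyl L S" "B = cyl L R"
    "v_val C M L summable_on S" "v_val C M L summable_on R" by (rule pro_ring_common)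
  have "cyl L (S \<inter> R) = cyl L {}" using AB(3) * by (auto simp: cyl_def)
  then have dj: "S \<inter> R = {}" using cyl_eq_iff[OF *(1), of "S \<inter> R" "{}"] * by auto
  have "v_val C M L summable_on (S \<union> R)" using * dj by (intro summable_on_Un_disjoint) auto
  moreover have "infsum (v_val C M L) (S \<union> R) = infsum (v_val C M L) S + infsum (v_val C M L) R"
    by (rule infsum_Un_disjoint) (use * dj in auto)
  moreover have "0 \<le> infsum (v_val C M L) S" "0 \<le> infsum (v_val C M L) R"
    using * nonneg by (auto intro!: infsum_nonneg)
  ultimately show "premeasure (A \<union> B) = premeasure A + premeasure B"
    using * premeasure_cyl[OF *(1)] by (simp add: cyl_Un)
qed

lemma premeasure_empty: "premeasure {} = 0"
proof -
  obtain L where L: "L \<in> levels C" using level_ex by blast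
  have "cyl L {} = {}" by (simp add: cyl_def)
  then show ?thesis using premeasure_cyl[OF L, of "{}"] by simp
qed

lemma pro_ring_sequence:
  assumes "range A \<subseteq> pro_ring"
  obtains K S where "\<And>n::nat. K n \<in> levels C" "\<And>n. K n \<subseteq> K (Suc n)" "\<And>n. S n \<subseteq> K n"
    "\<And>n. A n = cyl (K n) (S n)" "\<And>n. v_val C M (K n) summable_on S n"
proof -
  have "\<forall>n. \<exists>L S. L \<in> levels C \<and> S \<subseteq> L \<and> v_val C M L summable_on S \<and> A n = cyl L S"
  proof
    fix n
    have "A n \<in> pro_ring" using assms by blast
    then show "\<exists>L S. L \<in> levels C \<and> S \<subseteq> L \<and> v_val C M L summable_on S \<and> A n = cyl L S" by (auto simp: pro_ring_def)
  qed
  then obtain K0 S0 where K0: "\<And>n. K0 n \<in> levels C" "\<And>n. S0 n \<subseteq> K0 n" "\<And>n. v_val C M (K0 n) summable_on S0 n"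
    "\<And>n. A n = cyl (K0 n) (S0 n)" by metis
  have "\<exists>K. \<forall>n. (K n \<in> levels C \<and> K0 n \<subseteq> K n) \<and> K n \<subseteq> K (Suc n)"
  proof (rule dependent_nat_choice)
    show "\<exists>x. x \<in> levels C \<and> K0 0 \<subseteq> x" using K0(1) by blast
    fix x n assume "x \<in> levels C \<and> K0 n \<subseteq> x"
    then show "\<exists>y. (y \<in> levels C \<and> K0 (Suc n) \<subseteq> y) \<and> x \<subseteq> y" using levels_directed[OF _ K0(1)[of "Suc n"], of x] by metis
  qed
  then obtain K where K: "\<And>n. K n \<in> levels C" "\<And>n. K0 n \<subseteq> K n" "\<And>n. K n \<subseteq> K (Suc n)" by blast
  show ?thesis
    by (rule that[of K "\<lambda>n. lift (K0 n) (K n) (S0 n)"])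
      (use K K0 lift_sub cyl_lift[OF K0(1) K(1,2)] v_lift_summable[OF K0(1) K(1,2) K0(2)] in auto)
qed

text \<open>The compactness argument. If the masses stay bounded below, objects are chosen level by
  level over which the mass stays bounded below, and they are assembled into a point of the
  intersection.\<close>

lemma premeasure_continuous:
  assumes A: "range A \<subseteq> pro_ring" "decseq A" "(\<Inter>i. A i) = {}"
  shows "(\<lambda>i. premeasure (A i)) \<longlonglongrightarrow> 0"
proof (rule ccontr)
  assume neg: "\<not> (\<lambda>i. premeasure (A i)) \<longlonglongrightarrow> 0"
  obtain K S where K: "\<And>n::nat. K n \<in> levels C" "\<And>n. K n \<subseteq> K (Suc n)" and S: "\<And>n. S n \<subseteq> K n"
    and AS: "\<And>n. A n = cyl (K n) (S n)" and sm: "\<And>n. v_val C M (K n) summable_on S n"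
    using pro_ring_sequence[OF A(1)] by metis
  note Kf = level_formation[OF K(1)]
  have Kmono: "K m \<subseteq> K n" if "m \<le> n" for m n using lift_Suc_mono_le[of K, OF K(2) that] .
  have Ki: "F \<in> iso_classes C" if "F \<in> K m" for F m using that level_sub[OF K(1)] by blast
  let ?v = "\<lambda>m. v_val C M (K m)"
  have sub_sm: "?v m summable_on {F \<in> S m. P F}" for m P by (rule summable_on_subset_banach[OF sm[of m]]) auto
  \<comment> \<open>The mass of the m-th cylinder that lies over the object F of level n.\<close>
  define q where "q n m F = infsum (?v m) {F' \<in> S m. level_quot C (K n) F' = F}" for n m F
  have S_dec: "S (Suc m) \<subseteq> lift (K m) (K (Suc m)) (S m)" for m
  proof -
    have "cyl (K (Suc m)) (S (Suc m)) \<subseteq> cyl (K (Suc m)) (lift (K m) (K (Suc m)) (S m))"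
      using decseq_SucD[OF A(2), of m] cyl_lift[OF K(1) K(1) K(2), of m] by (simp add: AS)
    then show ?thesis using cyl_subset_iff[OF K(1) S lift_sub] by blast
  qed
  have mass_dec: "infsum (?v (Suc m)) {F' \<in> S (Suc m). P (level_quot C (K m) F')} \<le> infsum (?v m) {F \<in> S m. P F}" for m P
  proof -
    let ?R = "{F \<in> S m. P F}"
    have R: "?R \<subseteq> K m" using S by auto
    have l: "?v (Suc m) summable_on lift (K m) (K (Suc m)) ?R"
      using v_lift_summable[OF K(1) K(1) K(2) R] sub_sm by blast
    have "infsum (?v (Suc m)) {F' \<in> S (Suc m). P (level_quot C (K m) F')} \<le> infsum (?v (Suc m)) (lift (K m) (K (Suc m)) ?R)"
      by (rule infsum_mono_neutral[OF sub_sm l])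
        (use S_dec[of m] nonneg[OF K(1)] lift_sub in \<open>auto simp: lift_def\<close>)
    also have "\<dots> = infsum (?v m) ?R" by (rule v_lift_infsum[OF K(1) K(1) K(2) R sub_sm])
    finally show ?thesis .
  qed
  have q_dec: "q n (Suc m) F \<le> q n m F" if "n \<le> m" for n m F
  proof -
    have "{F' \<in> S (Suc m). level_quot C (K n) F' = F} = {F' \<in> S (Suc m). level_quot C (K n) (level_quot C (K m) F') = F}"
      using level_quot_trans[OF Kf Kf Kmono[OF that]] S Ki by blast
    then show ?thesis unfolding q_def using mass_dec[of m "\<lambda>F'. level_quot C (K n) F' = F"] by simp
  qed
  have q_nonneg: "0 \<le> q n m F" for n m F
    unfolding q_def by (rule infsum_nonneg) (use nonneg[OF K(1)] S in auto)
  define good where "good n F \<longleftrightarrow> F \<in> K n \<and> (\<exists>d > 0. \<forall>m \<ge> n. d \<le> q n m F)" for n F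
  obtain d where d: "d > 0" "\<And>m. d \<le> infsum (?v m) (S m)"
  proof -
    have pm: "premeasure (A m) = ennreal (infsum (?v m) (S m))" for m
      unfolding AS by (rule premeasure_cyl[OF K(1) S sm])
    have dec: "infsum (?v (Suc m)) (S (Suc m)) \<le> infsum (?v m) (S m)" for m
      using mass_dec[of m "\<lambda>_. True"] by simp
    have nn: "0 \<le> infsum (?v m) (S m)" for m
      by (rule infsum_nonneg) (use nonneg[OF K(1)] S in auto)
    have "\<exists>d > 0. \<forall>m. d \<le> infsum (?v m) (S m)"
    proof (rule ccontr)
      assume no: "\<not> ?thesis"
      have "(\<lambda>m. infsum (?v m) (S m)) \<longlonglongrightarrow> 0"
      proof (rule LIMSEQ_I)
        fix r :: real assume "r > 0"
        then obtain m0 where m0: "infsum (?v m0) (S m0) < r" using no by (meson not_le)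
        have "infsum (?v m) (S m) \<le> infsum (?v m0) (S m0)" if "m0 \<le> m" for m
          using lift_Suc_antimono_le[of "\<lambda>m. infsum (?v m) (S m)", OF dec that] .
        then show "\<exists>no. \<forall>m \<ge> no. norm (infsum (?v m) (S m) - 0) < r" using m0 nn by (auto intro: le_less_trans)
      qed
      then have "(\<lambda>m. ennreal (infsum (?v m) (S m))) \<longlonglongrightarrow> ennreal 0" by (rule tendsto_ennrealI)
      then show False using neg pm by simp
    qed
    then show ?thesis using that by blast
  qed
  have start: "\<exists>F. good 0 F"
  proof -
    have s: "((\<lambda>F. q 0 m F) has_sum infsum (?v m) (S m)) (K 0)" for m
      unfolding q_def by (rule has_sum_group[OF has_sum_infsum[OF sm]]) (use level_quot_mem[OF Kf Ki] S in blast)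
    have "\<exists>F \<in> K 0. \<exists>e > 0. \<forall>m. e \<le> q 0 m F"
      by (rule persistent_piece[where a = "q 0", OF _ _ s d]) (auto simp: q_nonneg q_dec)
    then show ?thesis by (auto simp: good_def)
  qed
  have step: "\<exists>F'. good (Suc n) F' \<and> level_quot C (K n) F' = F" if g: "good n F" for n F
  proof -
    obtain e where e: "e > 0" "\<And>m. m \<ge> n \<Longrightarrow> e \<le> q n m F" using g by (auto simp: good_def)
    let ?I = "{F' \<in> K (Suc n). level_quot C (K n) F' = F}"
    \<comment> \<open>The mass over F is split among the objects of the next level over F. Counting
      starts at stage \<open>Suc n\<close>, from which on the pieces are defined compatibly and
      decrease.\<close>
    have s: "((\<lambda>F'. q (Suc n) (Suc n + m) F') has_sum q n (Suc n + m) F) ?I" for m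
    proof -
      let ?m = "Suc n + m"
      have 1: "((\<lambda>F'. infsum (?v ?m) {F'' \<in> {F'' \<in> S ?m. level_quot C (K n) F'' = F}. level_quot C (K (Suc n)) F'' = F'}) has_sum q n ?m F) ?I"
        unfolding q_def
      proof (rule has_sum_group[OF has_sum_infsum[OF sub_sm]])
        fix F'' assume F'': "F'' \<in> {F'' \<in> S ?m. level_quot C (K n) F'' = F}"
        then have i: "F'' \<in> iso_classes C" using S Ki by blast
        show "level_quot C (K (Suc n)) F'' \<in> ?I"
          using level_quot_mem[OF Kf i] level_quot_trans[OF Kf Kf K(2) i] F'' by simp
      qed
      have 2: "{F'' \<in> {F'' \<in> S ?m. level_quot C (K n) F'' = F}. level_quot C (K (Suc n)) F'' = F'} =
          {F'' \<in> S ?m. level_quot C (K (Suc n)) F'' = F'}" if F': "F' \<in> ?I" for F'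
        using level_quot_trans[OF Kf Kf K(2)[of n]] F' S Ki by blast
      show ?thesis
      proof (rule has_sum_cong[THEN iffD1, OF _ 1])
        fix F' assume "F' \<in> ?I"
        then show "infsum (?v ?m) {F'' \<in> {F'' \<in> S ?m. level_quot C (K n) F'' = F}. level_quot C (K (Suc n)) F'' = F'} =
          q (Suc n) ?m F'" unfolding q_def by (simp only: 2)
      qed
    qed
    have "\<exists>F' \<in> ?I. \<exists>e > 0. \<forall>m. e \<le> q (Suc n) (Suc n + m) F'"
      by (rule persistent_piece[where a = "\<lambda>m. q (Suc n) (Suc n + m)", OF _ _ s e(1)])
        (use q_dec[of "Suc n"] q_nonneg e(2) in auto)
    then obtain F' e' where F': "F' \<in> ?I" "e' > 0" "\<And>m. e' \<le> q (Suc n) (Suc n + m) F'" by blast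
    have "e' \<le> q (Suc n) m F'" if "m \<ge> Suc n" for m using F'(3)[of "m - Suc n"] that by simp
    then show ?thesis using F' by (auto simp: good_def)
  qed
  have "\<exists>x. \<forall>n. good n (x n) \<and> level_quot C (K n) (x (Suc n)) = x n"
    by (rule dependent_nat_choice) (use start step in auto)
  then obtain x where x: "\<And>n. good n (x n)" "\<And>n. level_quot C (K n) (x (Suc n)) = x n" by blast
  have xK: "x n \<in> K n" for n using x(1) by (simp add: good_def)
  \<comment> \<open>At stage n the only object of level n lying over \<open>x n\<close> is
    \<open>x n\<close> itself, so outside \<open>S n\<close> the mass over it would be an empty
    sum.\<close>
  have xS: "x n \<in> S n" for n
  proof (rule ccontr)
    assume ns: "x n \<notin> S n"
    have self: "level_quot C (K n) F' = F'" if "F' \<in> S n" for F'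
      using level_quot_self[OF Kf] S that by blast
    have "{F' \<in> S n. level_quot C (K n) F' = x n} = {}"
    proof (rule ccontr)
      assume "{F' \<in> S n. level_quot C (K n) F' = x n} \<noteq> {}"
      then obtain F' where "F' \<in> S n" "level_quot C (K n) F' = x n" by blast
      then show False using self[of F'] ns by simp
    qed
    then have "q n n (x n) = 0" unfolding q_def by (simp only: infsum_empty)
    then show False using x(1)[of n] by (force simp: good_def)
  qed
  obtain X where "X \<in> pro_classes C" "\<And>n. X (K n) = x n" using pro_class_ex[of K x, OF K xK x(2)] by blast
  then have "X \<in> (\<Inter>i. A i)" using xS AS by (simp add: cyl_def)
  then show False using A(3) by simp
qed

theorem measure_exists: "\<exists>\<nu>. has_moments C M \<nu>"
proof -
  interpret R: ring_of_sets "pro_classes C" pro_ring by (rule pro_ring)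
  let ?B = "{basic_open C L F | L F. L \<in> levels C \<and> F \<in> L}"
  have fin: "premeasure A \<noteq> \<infinity>" if A: "A \<in> pro_ring" for A
  proof -
    obtain L S where "L \<in> levels C" "S \<subseteq> L" "v_val C M L summable_on S" "A = cyl L S" using A by (auto simp: pro_ring_def)
    then show ?thesis using premeasure_cyl[of L S] by simp
  qed
  have pos: "positive pro_ring premeasure" using premeasure_empty by (simp add: positive_def)
  \<comment> \<open>On a ring, finite values and continuity at the empty set replace countable
    additivity in the extension theorem.\<close>
  obtain \<mu> where mu: "\<forall>s \<in> pro_ring. \<mu> s = premeasure s" "measure_space (pro_classes C) (sigma_sets (pro_classes C) pro_ring) \<mu>"
    using R.caratheodory_empty_continuous[OF pos premeasure_additive fin premeasure_continuous] by blast
  have sg: "sigma_sets (pro_classes C) pro_ring = sigma_sets (pro_classes C) ?B"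
  proof (rule sigma_sets_eqI)
    show "a \<in> sigma_sets (pro_classes C) ?B" if "a \<in> pro_ring" for a using that cyl_sigma by (auto simp: pro_ring_def)
    show "b \<in> sigma_sets (pro_classes C) pro_ring" if b: "b \<in> ?B" for b
    proof -
      obtain L F where "L \<in> levels C" "F \<in> L" "b = cyl L {F}" using b unfolding basic_open_cyl by blast
      then have "b \<in> pro_ring" using cyl_single by simp
      then show ?thesis by (rule sigma_sets.Basic)
    qed
  qed
  define \<nu> where "\<nu> = measure_of (pro_classes C) (sigma_sets (pro_classes C) pro_ring) \<mu>"
  have sub: "sigma_sets (pro_classes C) pro_ring \<subseteq> Pow (pro_classes C)"
    using sigma_sets_into_sp[OF R.space_closed] by blast
  have sa: "sigma_algebra (pro_classes C) (sigma_sets (pro_classes C) pro_ring)"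
    using mu(2) by (simp add: measure_space_def)
  have sets: "sets \<nu> = sets (pro_algebra C)"
    unfolding \<nu>_def sets_pro_algebra sg[symmetric] sets_measure_of[OF sub]
    using sigma_algebra.sigma_sets_eq[OF sa] .
  have em: "emeasure \<nu> (basic_open C L F) = ennreal (v_val C M L F)" if L: "L \<in> levels C" and F: "F \<in> L" for L F
  proof -
    have r: "cyl L {F} \<in> pro_ring" using cyl_single[OF L F] .
    have "emeasure \<nu> (cyl L {F}) = \<mu> (cyl L {F})"
      unfolding \<nu>_def by (rule emeasure_measure_of_sigma[OF sa]) (use mu(2) r in \<open>auto simp: measure_space_def\<close>)
    also have "\<dots> = ennreal (v_val C M L F)"
      using mu(1) r premeasure_cyl[OF L, of "{F}"] F by simp
    finally show ?thesis by (simp add: basic_open_cyl)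
  qed
  have "has_moment C \<nu> G (M G)" if G: "G \<in> iso_classes C" for G
  proof -
    \<comment> \<open>The moment can be computed at any level containing G; the smallest one is
      taken.\<close>
    let ?L = "formation C hull {G}"
    have L: "?L \<in> levels C" "G \<in> ?L" using hull_level[OF G] mem_hull by auto
    show ?thesis
      using has_moment_iff[OF sets L, where p = "v_val C M ?L"] em[OF L(1)] nonneg[OF L(1)]
        moments_exist[OF wb L nonneg[OF L(1)]] by blast
  qed
  then have "has_moments C M \<nu>" using sets by (simp add: has_moments_def)
  then show ?thesis by blast
qed

end

end

theorem theorem1p7:
  fixes C :: "('o, 'm) cat" and M :: "'o set \<Rightarrow> real"
  assumes "diamond_category C" and "well_behaved C M"
  shows "((\<exists>\<nu>. has_moments C M \<nu>) \<longleftrightarrow> (\<forall>L \<in> levels C. \<forall>F \<in> L. 0 \<le> v_val C M L F)) \<and>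
    (\<forall>\<nu>. has_moments C M \<nu> \<longrightarrow>
       (\<forall>\<nu>'. has_moments C M \<nu>' \<longrightarrow> \<nu>' = \<nu>) \<and>
       (\<forall>L \<in> levels C. \<forall>F \<in> L. enn2ereal (emeasure \<nu> (basic_open C L F)) = ereal (v_val C M L F)))"
proof -
  interpret diamond_category C by (rule assms(1))
  note wb = assms(2)
  show ?thesis
  proof (intro conjI iffI allI impI ballI)
    fix L F assume "\<exists>\<nu>. has_moments C M \<nu>" "L \<in> levels C" "F \<in> L"
    then show "0 \<le> v_val C M L F" using measure_basic(1)[OF wb] by blast
  next
    assume "\<forall>L \<in> levels C. \<forall>F \<in> L. 0 \<le> v_val C M L F"
    then show "\<exists>\<nu>. has_moments C M \<nu>" by (intro measure_exists[OF wb]) simp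
  next
    fix \<nu> \<nu>' assume "has_moments C M \<nu>" "has_moments C M \<nu>'"
    then show "\<nu>' = \<nu>" by (rule measure_unique[OF wb])
  next
    fix \<nu> L F assume "has_moments C M \<nu>" "L \<in> levels C" "F \<in> L"
    then show "enn2ereal (emeasure \<nu> (basic_open C L F)) = ereal (v_val C M L F)"
      using measure_basic[OF wb] by (simp add: enn2ereal_ennreal)
  qed
qed

end
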